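(* For $\theta\in[1,2]$ and $\varsigma=\frac{2(\theta-1)}{\theta}$, let $$\Phi(x)\equiv x\,(\log(1+x))^\varsigma ,\qquad x\ge0 .$$ Let $d\mu_\theta=\frac{e^{-\beta d^\theta}}{Z}d\lambda$ be a probability measure on $\mathbb{R}^N$, $\beta\in(0,\infty)$. Suppose $0<\frac1\sigma\le|\nabla d|\le1$ for some $\sigma\in[1,\infty)$, and $\Delta d\le K+\beta\theta\,\varepsilon\,d^{\theta-1}$ outside the unit ball $\{d<1\}$ for some $K\in[0,\infty)$ and $\varepsilon\in[0,\frac1{\sigma^2})$. Suppose also that a Sobolev inequality holds: there are $\epsilon_0\in(0,1)$ and $\bar C,\bar D\in(0,\infty)$ such that $\big(\int|g|^{2+\epsilon_0}d\lambda\big)^{\frac2{2+\epsilon_0}}\le\bar C\int|\nabla g|^2d\lambda+\bar D\int g^2d\lambda$ for all $g\in\mathcal{L}$. If additionally $\mu_\theta$ satisfies the Poincaré inequality $M\,\mu_\theta(f-\mu_\theta f)^2\le\mu_\theta|\nabla f|^2$ for some $M\in(0,\infty)$ and all $f\in\mathcal{L}$ with $\mu_\theta f^2<\infty$, then there exists a constant $c_\theta\in(0,\infty)$ such that for all $f\in\mathcal{L}$ with $\mu_\theta f^2<\infty$ $$\mu_\theta\Phi(f^2)-\Phi(\mu_\theta f^2)\le c_\theta\int|\nabla f|^2\,d\mu_\theta .$$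
   Context: Setting. $\lambda$ is Lebesgue measure on $\mathbb{R}^N$. $\nabla=(X_1,\dots,X_k)$ is a finite collection of smooth, possibly noncommuting, vector fields on $\mathbb{R}^N$, each with zero divergence with respect to $\lambda$; $\nabla f=(X_1f,\dots,X_kf)$, $|\nabla f|=(\sum_i (X_if)^2)^{1/2}$ and $\Delta=\sum_i X_i^2$. $\mathcal{L}$ denotes the class of continuous functions $f:\mathbb{R}^N\to\mathbb{R}$ whose distributional derivatives $X_if$ are all in $L^\infty_{loc}$. $d:\mathbb{R}^N\to[0,\infty)$ is the distance from a fixed point (the origin) in some metric; it is assumed that $d\in\mathcal{L}$ and that the balls $\{d\le R\}$ are compact. Bounds on $|\nabla d|$ are understood almost everywhere, and the upper bound on $\Delta d$ in the sense of distributions on $\{d>1\}$. Notation: $\mu g=\int g\,d\mu$; right-hand sides may be $+\infty$. *)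

theory Defs
  imports "HOL-Probability.Probability"
begin

primrec Ck :: "nat \<Rightarrow> ('a::euclidean_space \<Rightarrow> 'b::real_normed_vector) \<Rightarrow> bool" where
  "Ck 0 f \<longleftrightarrow> continuous_on UNIV f"
| "Ck (Suc n) f \<longleftrightarrow>
     (\<forall>x. f differentiable (at x)) \<and> (\<forall>v. Ck n (\<lambda>x. frechet_derivative f (at x) v))"

definition smooth :: "('a::euclidean_space \<Rightarrow> 'b::real_normed_vector) \<Rightarrow> bool" where
  "smooth f \<longleftrightarrow> (\<forall>n. Ck n f)"

definition divergence :: "('a::euclidean_space \<Rightarrow> 'a) \<Rightarrow> 'a \<Rightarrow> real" where
  "divergence X x = (\<Sum>b\<in>Basis. frechet_derivative X (at x) b \<bullet> b)"

definition test_fun :: "'a::euclidean_space set \<Rightarrow> ('a \<Rightarrow> real) \<Rightarrow> bool" where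
  "test_fun U \<phi> \<longleftrightarrow> smooth \<phi> \<and> compact (closure {x. \<phi> x \<noteq> 0}) \<and> closure {x. \<phi> x \<noteq> 0} \<subseteq> U"

text \<open>The classical action of a vector field on differentiable functions.\<close>

definition vf_deriv :: "('a::euclidean_space \<Rightarrow> 'a) \<Rightarrow> ('a \<Rightarrow> real) \<Rightarrow> 'a \<Rightarrow> real" where
  "vf_deriv X \<phi> x = frechet_derivative \<phi> (at x) (X x)"

definition vf_laplacian ::
  "('i::finite \<Rightarrow> 'a::euclidean_space \<Rightarrow> 'a) \<Rightarrow> ('a \<Rightarrow> real) \<Rightarrow> 'a \<Rightarrow> real" where
  "vf_laplacian X \<phi> x = (\<Sum>i\<in>UNIV. vf_deriv (X i) (vf_deriv (X i) \<phi>) x)"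

definition Linf_loc :: "('a::euclidean_space \<Rightarrow> real) set" where
  "Linf_loc = {g. g \<in> borel_measurable lborel \<and>
     (\<forall>K. compact K \<longrightarrow> (\<exists>C. AE x in lborel. x \<in> K \<longrightarrow> \<bar>g x\<bar> \<le> C))}"

text \<open>For a divergence-free \<open>X\<close> the formal adjoint of \<open>X\<close> with respect to Lebesgue measure is \<open>-X\<close>;
  hence the two definitions below are the usual distributional ones only for such fields.\<close>

definition has_distr_deriv ::
  "('a::euclidean_space \<Rightarrow> 'a) \<Rightarrow> ('a \<Rightarrow> real) \<Rightarrow> ('a \<Rightarrow> real) \<Rightarrow> bool" where
  "has_distr_deriv X f g \<longleftrightarrow> (\<forall>\<phi>. test_fun UNIV \<phi> \<longrightarrow>
     (\<integral>x. g x * \<phi> x \<partial>lborel) = - (\<integral>x. f x * vf_deriv X \<phi> x \<partial>lborel))"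

definition distr_laplacian_le ::
  "('i::finite \<Rightarrow> 'a::euclidean_space \<Rightarrow> 'a) \<Rightarrow> 'a set \<Rightarrow> ('a \<Rightarrow> real) \<Rightarrow> ('a \<Rightarrow> real) \<Rightarrow> bool" where
  "distr_laplacian_le X U f h \<longleftrightarrow> (\<forall>\<phi>. test_fun U \<phi> \<and> (\<forall>x. 0 \<le> \<phi> x) \<longrightarrow>
     (\<integral>x. f x * vf_laplacian X \<phi> x \<partial>lborel) \<le> (\<integral>x. h x * \<phi> x \<partial>lborel))"

definition classL :: "('i::finite \<Rightarrow> 'a::euclidean_space \<Rightarrow> 'a) \<Rightarrow> ('a \<Rightarrow> real) set" where
  "classL X = {f. continuous_on UNIV f \<and> (\<forall>i. \<exists>g\<in>Linf_loc. has_distr_deriv (X i) f g)}"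

text \<open>A representative of the distributional derivative. It is determined only up to null sets, so
  it should occur only inside integrals and almost-everywhere statements.\<close>

definition distr_deriv :: "('a::euclidean_space \<Rightarrow> 'a) \<Rightarrow> ('a \<Rightarrow> real) \<Rightarrow> 'a \<Rightarrow> real" where
  "distr_deriv X f = (SOME g. g \<in> Linf_loc \<and> has_distr_deriv X f g)"

definition grad_norm ::
  "('i::finite \<Rightarrow> 'a::euclidean_space \<Rightarrow> 'a) \<Rightarrow> ('a \<Rightarrow> real) \<Rightarrow> 'a \<Rightarrow> real" where
  "grad_norm X f x = sqrt (\<Sum>i\<in>UNIV. (distr_deriv (X i) f x)\<^sup>2)"

definition mu_theta ::
  "('a::euclidean_space \<Rightarrow> real) \<Rightarrow> real \<Rightarrow> real \<Rightarrow> real \<Rightarrow> 'a measure" where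
  "mu_theta d \<beta> Z \<theta> = density lborel (\<lambda>x. ennreal (exp (- \<beta> * d x powr \<theta>) / Z))"

text \<open>For \<open>\<theta> = 1\<close> the exponent is 0, and \<open>0 powr 0 = 0\<close>; this is harmless because of the factor \<open>x\<close>.\<close>

definition Phi :: "real \<Rightarrow> real \<Rightarrow> real" where
  "Phi \<theta> x = x * ln (1 + x) powr (2 * (\<theta> - 1) / \<theta>)"

text \<open>Real powers on \<open>[0,\<infinity>]\<close>, for exponents \<open>p > 0\<close>.\<close>

definition ennpowr :: "ennreal \<Rightarrow> real \<Rightarrow> ennreal" where
  "ennpowr a p = (if a = \<infinity> then \<infinity> else ennreal (enn2real a powr p))"

end

theory Submission
  imports Defs
begin

text \<open>For \<open>\<theta> = 1\<close> both sides of the entropy coincide. For \<open>\<theta> > 1\<close>, testing the bound on \<open>\<Delta>d\<close> with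
  \<open>f\<^sup>2 d\<^bsup>\<theta>-1\<^esup> e\<^bsup>-\<beta>d\<^sup>\<theta>\<^esup>\<close>, cut off near the unit ball and at infinity, gives the U-bound
  \<open>\<mu>(f\<^sup>2 d\<^bsup>2(\<theta>-1)\<^esup>) \<le> A \<mu>|\<nabla>f|\<^sup>2 + B \<mu>(f\<^sup>2)\<close>. The Sobolev inequality for \<open>g = f e\<^bsup>-\<beta>d\<^sup>\<theta>/2\<^esup> / \<surd>Z\<close>
  controls the integral of \<open>g\<^sup>2 log (1 + g\<^sup>2)\<close>, and the remaining part of \<open>(log (1 + f\<^sup>2))\<^sup>\<varsigma>\<close> is at most
  \<open>const + \<beta>\<^sup>\<varsigma> d\<^bsup>2(\<theta>-1)\<^esup>\<close>, which the U-bound absorbs. This yields the inequality with an additional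
  multiple of \<open>\<mu>(f\<^sup>2)\<close> on the right. A Rothaus-type argument applied to \<open>f - \<mu> f\<close> together with the
  Poincare inequality removes it.

  The calculus in \<open>classL\<close> rests on Friedrichs' commutator lemma: mollifying a continuous function
  commutes with a divergence-free field up to a locally uniformly small error.\<close>

section \<open>Smooth functions\<close>

text \<open>The exponents fit because \<varsigma>\<theta> = 2(\<theta>-1): the power \<varsigma> of
  the potential \<beta>d^\<theta> is a multiple of d^(2(\<theta>-1)), and so is the square of the
  logarithmic gradient of e^(-\<beta>d^\<theta>/2), up to |\<nabla>d|^2. The U-bound is therefore
  used twice, for the energy of g and for the logarithm of the density. It holds because
  differentiating the weight in the test function produces
  -\<beta>\<theta>d^(2(\<theta>-1))|\<nabla>d|^2, at most
  -(\<beta>\<theta>/\<sigma>^2)d^(2(\<theta>-1)), while the bound on \<Delta>d gives back only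
  \<beta>\<theta>\<epsilon>d^(2(\<theta>-1)); \<epsilon> < 1/\<sigma>^2 keeps the sum negative. Two
  obstacles shape the rest. The functions d and f have only locally bounded distributional
  derivatives, whereas the bound on \<Delta>d is given for smooth test functions supported in {d >
  1}; product rule, chain rule and the enlarged class of test functions all come from mollification.
  And Phi is not homogeneous, so f itself cannot be normalised: only f minus its mean is, and the
  comparison with Phi at the second moment is made pointwise.\<close>

lemma Ck_SucI:
  assumes "\<And>x. (f has_derivative f' x) (at x)" "\<And>v. Ck n (\<lambda>x. f' x v)"
  shows "Ck (Suc n) f"
proof -
  have "frechet_derivative f (at x) = f' x" for x
    using assms(1) by (metis frechet_derivative_at)
  with assms show ?thesis by (auto simp: differentiable_def)
qed

lemma Ck_SucD:
  assumes "Ck (Suc n) f"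
  shows "(f has_derivative frechet_derivative f (at x)) (at x)"
    and "Ck n (\<lambda>x. frechet_derivative f (at x) v)"
  using assms by (auto simp: frechet_derivative_works[symmetric])

lemma Ck_lower: "Ck (Suc n) f \<Longrightarrow> Ck n f"
proof (induction n arbitrary: f)
  case 0
  then show ?case
    by (auto intro!: continuous_at_imp_continuous_on differentiable_imp_continuous_within)
qed auto

lemma Ck_continuous: "Ck n f \<Longrightarrow> continuous_on UNIV f"
  by (induction n arbitrary: f) (auto dest: Ck_lower simp del: Ck.simps(2))

lemma Ck_const: "Ck n (\<lambda>x. c)"
proof (induction n arbitrary: c)
  case (Suc n)
  show ?case by (rule Ck_SucI[where f' = "\<lambda>_ _. 0"]) (auto intro: Suc)
qed auto

lemma Ck_add: "Ck n f \<Longrightarrow> Ck n g \<Longrightarrow> Ck n (\<lambda>x. f x + g x)"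
proof (induction n arbitrary: f g)
  case (Suc n)
  show ?case
    by (rule Ck_SucI[where f' = "\<lambda>x v. frechet_derivative f (at x) v + frechet_derivative g (at x) v"])
       (auto intro!: Suc.IH has_derivative_add Ck_SucD Suc.prems simp del: Ck.simps)
qed (auto intro: continuous_intros)

lemma Ck_sum: "(\<And>i. i \<in> I \<Longrightarrow> Ck n (f i)) \<Longrightarrow> Ck n (\<lambda>x. \<Sum>i\<in>I. f i x)"
  by (induction I rule: infinite_finite_induct) (auto simp: Ck_const intro!: Ck_add)

lemma Ck_mult:
  fixes f g :: "'a::euclidean_space \<Rightarrow> real"
  shows "Ck n f \<Longrightarrow> Ck n g \<Longrightarrow> Ck n (\<lambda>x. f x * g x)"
proof (induction n arbitrary: f g)
  case (Suc n)
  show ?case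
    by (rule Ck_SucI[where f' = "\<lambda>x v. f x * frechet_derivative g (at x) v + frechet_derivative f (at x) v * g x"])
       (auto intro!: Ck_add Suc.IH has_derivative_mult Ck_SucD Suc.prems Ck_lower[OF Suc.prems(1)] Ck_lower[OF Suc.prems(2)] simp del: Ck.simps)
qed (auto intro: continuous_intros)

lemma Ck_bounded_linear:
  assumes "bounded_linear L"
  shows "Ck n f \<Longrightarrow> Ck n (\<lambda>x. L (f x))"
proof (induction n arbitrary: f)
  case (Suc n)
  show ?case
    by (rule Ck_SucI[where f' = "\<lambda>x v. L (frechet_derivative f (at x) v)"])
       (auto intro!: Suc.IH Ck_SucD Suc.prems bounded_linear.has_derivative[OF assms] simp del: Ck.simps)
qed (simp add: linear_continuous_on_compose linear_continuous_on_compose assms bounded_linear.continuous_on)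

lemma Ck_compose_affine:
  assumes "bounded_linear L"
  shows "Ck n f \<Longrightarrow> Ck n (\<lambda>x. f (c + L x))"
proof (induction n arbitrary: f)
  case (Suc n)
  have "((\<lambda>x. f (c + L x)) has_derivative (\<lambda>v. frechet_derivative f (at (c + L x)) (L v))) (at x)" for x
    using bounded_linear.linear[OF assms]
    by (intro has_derivative_compose[where f = "\<lambda>x. c + L x", OF _ Ck_SucD(1)[OF Suc.prems]])
       (auto intro!: derivative_eq_intros bounded_linear_imp_has_derivative assms)
  moreover have "Ck n (\<lambda>x. frechet_derivative f (at (c + L x)) (L v))" for v
    by (intro Suc.IH Ck_SucD Suc.prems)
  ultimately show ?case by (rule Ck_SucI)
next
  case 0
  have "continuous_on UNIV (\<lambda>x. c + L x)"
    by (intro continuous_intros linear_continuous_on assms)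
  then show ?case using 0 by (auto intro: continuous_on_compose2)
qed

text \<open>Each function of the following family is flat at the origin, and the family is closed under
  differentiation because it allows an arbitrary polynomial factor.\<close>

definition flat_fun :: "real poly \<Rightarrow> real \<Rightarrow> real" where
  "flat_fun p t = (if t \<le> 0 then 0 else poly p (1 / t) * exp (- 1 / t))"

lemma poly_exp_tendsto_0: "((\<lambda>u. poly p u * exp (- u)) \<longlongrightarrow> (0::real)) at_top"
proof -
  have "((\<lambda>u. (\<Sum>i\<le>degree p. coeff p i * (u ^ i / exp u))) \<longlongrightarrow> (\<Sum>i\<le>degree p. coeff p i * 0)) at_top"
    by (intro tendsto_intros tendsto_power_div_exp_0)
  then show ?thesis
    by (simp add: poly_altdef exp_minus sum_distrib_left divide_inverse mult_ac)
qed

lemma flat_fun_tendsto_0: "(flat_fun p \<longlongrightarrow> 0) (at 0)"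
proof -
  have "filterlim (\<lambda>t::real. 1 / t) at_top (at_right 0)"
    by (simp add: filterlim_inverse_at_top_right divide_inverse)
  from filterlim_compose[OF poly_exp_tendsto_0 this]
  have "((\<lambda>t. poly p (1 / t) * exp (- 1 / t)) \<longlongrightarrow> 0) (at_right 0)" by simp
  then have "(flat_fun p \<longlongrightarrow> 0) (at_right 0)"
    by (rule Lim_transform_eventually) (auto simp: flat_fun_def eventually_at_filter)
  moreover have "(flat_fun p \<longlongrightarrow> 0) (at_left 0)"
    by (rule Lim_transform_eventually[of "\<lambda>_. 0"]) (auto simp: flat_fun_def eventually_at_filter)
  ultimately show ?thesis using filterlim_split_at by blast
qed

text \<open>In the variable s = 1/t the t-derivative of p(s) e^(-s) is s^2 (p(s) - p'(s)) e^(-s),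
  which has the same shape again.\<close>

lemma flat_fun_deriv:
  "(flat_fun p has_real_derivative flat_fun ([:0, 0, 1:] * (p - pderiv p)) t) (at t)"
proof -
  let ?q = "[:0, 0, 1:] * (p - pderiv p)"
  consider "t < 0" | "t = 0" | "t > 0" by linarith
  then show ?thesis
  proof cases
    case 1
    have "((\<lambda>_. 0) has_real_derivative 0) (at t)" by simp
    then have "(flat_fun p has_real_derivative 0) (at t)"
      by (rule has_field_derivative_transform_within_open[of _ _ _ "{..<0}"]) (use 1 in \<open>auto simp: flat_fun_def\<close>)
    then show ?thesis using 1 by (simp add: flat_fun_def)
  next
    case 2
    \<comment> \<open>Dividing by h multiplies p(1/h) by 1/h, that is, replaces p by
      \<open>pCons 0 p\<close>. The difference quotient at 0 is thus another member of the family
      and tends to 0.\<close>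
    have "(\<lambda>h. (flat_fun p (0 + h) - flat_fun p 0) / h) = flat_fun (pCons 0 p)"
      by (rule ext) (simp add: flat_fun_def)
    then have "(flat_fun p has_real_derivative 0) (at 0)"
      unfolding DERIV_def using flat_fun_tendsto_0[of "pCons 0 p"] by (simp only:)
    then show ?thesis using 2 by (simp add: flat_fun_def)
  next
    case 3
    have inv: "((\<lambda>t. 1 / t) has_real_derivative - (1 / t^2)) (at t)"
      using 3 by (auto intro!: derivative_eq_intros simp: power2_eq_square)
    have "((\<lambda>t. poly p (1 / t)) has_real_derivative poly (pderiv p) (1 / t) * (- (1 / t^2))) (at t)"
      by (rule DERIV_chain2[OF poly_DERIV inv])
    moreover have "((\<lambda>t. exp (- (1 / t))) has_real_derivative exp (- (1 / t)) * (1 / t^2)) (at t)"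
      using DERIV_chain2[OF DERIV_exp DERIV_minus[OF inv]] by simp
    ultimately have "((\<lambda>t. poly p (1 / t) * exp (- (1 / t))) has_real_derivative
        poly (pderiv p) (1 / t) * (- (1 / t^2)) * exp (- (1 / t)) + exp (- (1 / t)) * (1 / t^2) * poly p (1 / t)) (at t)"
      by (rule DERIV_mult)
    also have "poly (pderiv p) (1 / t) * (- (1 / t^2)) * exp (- (1 / t)) + exp (- (1 / t)) * (1 / t^2) * poly p (1 / t) = flat_fun ?q t"
      using 3 by (simp add: flat_fun_def field_simps power2_eq_square)
    finally have "((\<lambda>t. poly p (1 / t) * exp (- 1 / t)) has_real_derivative flat_fun ?q t) (at t)" by simp
    then show ?thesis
      by (rule has_field_derivative_transform_within_open[of _ _ _ "{0<..}"]) (use 3 in \<open>auto simp: flat_fun_def\<close>)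
  qed
qed

lemma Ck_flat_fun:
  fixes h :: "'a::euclidean_space \<Rightarrow> real"
  shows "smooth h \<Longrightarrow> Ck n (\<lambda>x. flat_fun p (h x))"
proof (induction n arbitrary: p)
  case 0
  have "isCont (flat_fun p) t" for t
    using flat_fun_deriv DERIV_isCont by blast
  then have "continuous_on UNIV (flat_fun p)"
    by (simp add: continuous_at_imp_continuous_on)
  moreover have "continuous_on UNIV h" using 0 Ck_continuous by (auto simp: smooth_def)
  ultimately show ?case by (auto intro: continuous_on_compose2)
next
  case (Suc n)
  let ?q = "[:0, 0, 1:] * (p - pderiv p)"
  have h: "Ck k h" for k using Suc.prems by (simp add: smooth_def)
  have "((\<lambda>x. flat_fun p (h x)) has_derivative (\<lambda>v. flat_fun ?q (h x) * frechet_derivative h (at x) v)) (at x)" for x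
    using has_derivative_compose[OF Ck_SucD(1)[OF h] has_field_derivative_imp_has_derivative[OF flat_fun_deriv]] .
  then show ?case
    by (rule Ck_SucI) (intro Ck_mult Suc Ck_SucD(2)[OF h])
qed

section \<open>Integration of compactly supported functions\<close>

text \<open>Measurability is enough: when one side is not integrable neither is the other, and both
  integrals are 0 by convention. The factor is what normalises the rescaled kernels below.\<close>

lemma lborel_integral_affine:
  fixes f :: "'a::euclidean_space \<Rightarrow> real" and c :: real
  assumes c: "c \<noteq> 0" and f: "f \<in> borel_measurable borel"
  shows "(LBINT x. f x) = \<bar>c\<bar> ^ DIM('a) * (LBINT x. f (t + c *\<^sub>R x))"
proof -
  have "(LBINT x. f x) =
      (\<integral>x. f x \<partial>density (distr lborel borel (\<lambda>x. t + c *\<^sub>R x)) (\<lambda>_. ennreal (\<bar>c\<bar> ^ DIM('a))))"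
    using lborel_affine[OF c, of t] by (simp add: ennreal_power)
  also have "\<dots> = (LBINT x. \<bar>c\<bar> ^ DIM('a) * f (t + c *\<^sub>R x))"
    using f by (subst integral_density) (simp_all add: integral_distr)
  finally show ?thesis by simp
qed

lemma lborel_integral_translate:
  fixes f :: "'a::euclidean_space \<Rightarrow> real"
  shows "f \<in> borel_measurable borel \<Longrightarrow> (LBINT x. f (x + t)) = (LBINT x. f x)"
  using lborel_integral_affine[of 1 f t] by (simp add: add.commute)

lemma lborel_integral_reflect:
  fixes f :: "'a::euclidean_space \<Rightarrow> real"
  shows "f \<in> borel_measurable borel \<Longrightarrow> (LBINT x. f (t - x)) = (LBINT x. f x)"
  using lborel_integral_affine[of "-1" f t] by simp

section \<open>Locally bounded functions: bounds on balls, algebra, integrability\<close>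

lemma Linf_locD:
  assumes "g \<in> Linf_loc"
  shows "g \<in> borel_measurable borel"
    and "bounded K \<Longrightarrow> \<exists>B\<ge>0. AE x in lborel. x \<in> K \<longrightarrow> \<bar>g x\<bar> \<le> B"
proof -
  show "g \<in> borel_measurable borel" using assms by (simp add: Linf_loc_def)
next
  assume "bounded K"
  then have "compact (closure K)" by (simp add: compact_closure)
  then obtain B where "AE x in lborel. x \<in> closure K \<longrightarrow> \<bar>g x\<bar> \<le> B"
    using assms unfolding Linf_loc_def by blast
  then have "AE x in lborel. x \<in> K \<longrightarrow> \<bar>g x\<bar> \<le> \<bar>B\<bar>"
    by (rule AE_mp) (use closure_subset in \<open>auto intro!: AE_I2\<close>)
  then show "\<exists>B\<ge>0. AE x in lborel. x \<in> K \<longrightarrow> \<bar>g x\<bar> \<le> B" by (intro exI[of _ "\<bar>B\<bar>"]) auto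
qed

lemma Linf_locI:
  assumes "g \<in> borel_measurable borel"
    and "\<And>r. \<exists>B. AE x in lborel. norm x \<le> r \<longrightarrow> \<bar>g x\<bar> \<le> B"
  shows "g \<in> Linf_loc"
proof -
  have "\<exists>B. AE x in lborel. x \<in> K \<longrightarrow> \<bar>g x\<bar> \<le> B" if "compact K" for K
  proof -
    obtain r where r: "\<And>x. x \<in> K \<Longrightarrow> norm x \<le> r"
      using \<open>compact K\<close> compact_imp_bounded bounded_iff by metis
    obtain B where "AE x in lborel. norm x \<le> r \<longrightarrow> \<bar>g x\<bar> \<le> B" using assms(2) by blast
    then have "AE x in lborel. x \<in> K \<longrightarrow> \<bar>g x\<bar> \<le> B" by (rule AE_mp) (use r in \<open>auto intro!: AE_I2\<close>)
    then show ?thesis ..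
  qed
  with assms(1) show ?thesis by (simp add: Linf_loc_def)
qed

lemma Linf_loc_cball: "g \<in> Linf_loc \<Longrightarrow> \<exists>B\<ge>0. AE x in lborel. norm x \<le> r \<longrightarrow> \<bar>g x\<bar> \<le> B"
  using Linf_locD(2)[of g "cball 0 r"] by simp

lemma continuous_bounded_on_compact:
  fixes f :: "'a::topological_space \<Rightarrow> real"
  assumes "continuous_on S f" "compact K" "K \<subseteq> S"
  shows "\<exists>B\<ge>0. \<forall>x\<in>K. \<bar>f x\<bar> \<le> B"
proof -
  have "compact (f ` K)" by (intro compact_continuous_image continuous_on_subset[OF assms(1)] assms)
  then obtain B where B: "\<And>y. y \<in> f ` K \<Longrightarrow> norm y \<le> B"
    using compact_imp_bounded bounded_iff by metis
  have "\<bar>f x\<bar> \<le> max 0 B" if "x \<in> K" for x using B[of "f x"] that by auto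
  then show ?thesis by (intro exI[of _ "max 0 B"]) auto
qed

lemma continuous_Linf_loc:
  fixes f :: "'a::euclidean_space \<Rightarrow> real"
  assumes "continuous_on UNIV f"
  shows "f \<in> Linf_loc"
proof (rule Linf_locI)
  show "f \<in> borel_measurable borel" using assms by (rule borel_measurable_continuous_onI)
  fix r
  obtain B where "\<forall>x\<in>cball 0 r. \<bar>f x\<bar> \<le> B"
    using continuous_bounded_on_compact[OF assms compact_cball subset_UNIV] by blast
  then show "\<exists>B. AE x in lborel. norm x \<le> r \<longrightarrow> \<bar>f x\<bar> \<le> B"
    by (intro exI[of _ B] AE_I2) auto
qed

lemma Linf_loc_add:
  assumes "f \<in> Linf_loc" "g \<in> Linf_loc" shows "(\<lambda>x. f x + g x) \<in> Linf_loc"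
proof (rule Linf_locI)
  fix r
  obtain A B where "AE x in lborel. norm x \<le> r \<longrightarrow> \<bar>f x\<bar> \<le> A" "AE x in lborel. norm x \<le> r \<longrightarrow> \<bar>g x\<bar> \<le> B"
    using Linf_loc_cball[OF assms(1), of r] Linf_loc_cball[OF assms(2), of r] by blast
  then have "AE x in lborel. norm x \<le> r \<longrightarrow> \<bar>f x + g x\<bar> \<le> A + B" by eventually_elim auto
  then show "\<exists>B. AE x in lborel. norm x \<le> r \<longrightarrow> \<bar>f x + g x\<bar> \<le> B" ..
qed (use assms Linf_locD in \<open>auto intro!: borel_measurable_add\<close>)

lemma Linf_loc_mult:
  assumes "f \<in> Linf_loc" "g \<in> Linf_loc" shows "(\<lambda>x. f x * g x) \<in> Linf_loc"
proof (rule Linf_locI)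
  fix r
  obtain A B where "A \<ge> 0" "AE x in lborel. norm x \<le> r \<longrightarrow> \<bar>f x\<bar> \<le> A" "AE x in lborel. norm x \<le> r \<longrightarrow> \<bar>g x\<bar> \<le> B"
    using Linf_loc_cball[OF assms(1), of r] Linf_loc_cball[OF assms(2), of r] by blast
  then have "AE x in lborel. norm x \<le> r \<longrightarrow> \<bar>f x * g x\<bar> \<le> A * B"
    by eventually_elim (auto simp: abs_mult intro!: mult_mono)
  then show "\<exists>B. AE x in lborel. norm x \<le> r \<longrightarrow> \<bar>f x * g x\<bar> \<le> B" ..
qed (use assms Linf_locD in \<open>auto intro!: borel_measurable_times borel_measurable_indicator\<close>)

lemma Linf_loc_sum:
  "(\<And>i. i \<in> I \<Longrightarrow> f i \<in> Linf_loc) \<Longrightarrow> (\<lambda>x. \<Sum>i\<in>I. f i x) \<in> Linf_loc"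
  by (induction I rule: infinite_finite_induct) (auto simp: continuous_Linf_loc intro!: Linf_loc_add)

lemma Linf_loc_const: "(\<lambda>x. c) \<in> Linf_loc"
  by (rule continuous_Linf_loc) auto

lemma Linf_loc_uminus: "f \<in> Linf_loc \<Longrightarrow> (\<lambda>x. - f x) \<in> Linf_loc"
  using Linf_loc_mult[OF Linf_loc_const[of "-1"], of f] by simp

lemma Linf_loc_diff: "f \<in> Linf_loc \<Longrightarrow> g \<in> Linf_loc \<Longrightarrow> (\<lambda>x. f x - g x) \<in> Linf_loc"
  using Linf_loc_add[OF _ Linf_loc_uminus, of f g] by simp

lemma Linf_loc_abs: "f \<in> Linf_loc \<Longrightarrow> (\<lambda>x. \<bar>f x\<bar>) \<in> Linf_loc"
  unfolding Linf_loc_def by (auto intro: borel_measurable_abs)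

lemma Linf_loc_integrable_cball:
  assumes "g \<in> Linf_loc"
  shows "integrable lborel (\<lambda>x. indicator (cball 0 r) x * g x)"
proof -
  obtain B where B: "B \<ge> 0" "AE x in lborel. norm x \<le> r \<longrightarrow> \<bar>g x\<bar> \<le> B"
    using Linf_loc_cball[OF assms, of r] by blast
  show ?thesis
  proof (rule Bochner_Integration.integrable_bound)
    show "integrable lborel (\<lambda>x. indicator (cball 0 r) x * B)"
      using emeasure_compact_finite[OF compact_cball, of 0 r]
      by (intro integrable_mult_left integrable_real_indicator) auto
    show "AE x in lborel. norm (indicator (cball 0 r) x * g x) \<le> norm (indicator (cball 0 r) x * B)"
      using B(2) by eventually_elim (auto simp: indicator_def)
  qed (use Linf_locD(1)[OF assms] in \<open>auto intro!: borel_measurable_times borel_measurable_indicator\<close>)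
qed

lemma Linf_loc_integrable:
  assumes "g \<in> Linf_loc" "\<And>x. r < norm x \<Longrightarrow> g x = 0"
  shows "integrable lborel g"
proof -
  have "(\<lambda>x. indicator (cball 0 r) x * g x) = g"
    using assms(2) by (fastforce simp: indicator_def)
  then show ?thesis using Linf_loc_integrable_cball[OF assms(1), of r] by simp
qed

section \<open>Compactly supported functions: uniform estimates and integrals of derivatives\<close>

lemma continuous_cpt_bounded:
  fixes f :: "'a::euclidean_space \<Rightarrow> real"
  assumes "continuous_on UNIV f" "\<And>x. r < norm x \<Longrightarrow> f x = 0"
  shows "\<exists>B\<ge>0. \<forall>x. \<bar>f x\<bar> \<le> B"
proof -
  obtain B where "B \<ge> 0" "\<forall>x\<in>cball 0 r. \<bar>f x\<bar> \<le> B"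
    using continuous_bounded_on_compact[OF assms(1) compact_cball subset_UNIV] by blast
  moreover from this have "\<bar>f x\<bar> \<le> B" for x
    using assms(2)[of x] by (cases "norm x \<le> r") auto
  ultimately show ?thesis by blast
qed

text \<open>A margin of 1 suffices: points closer than 1 either both lie in the ball of radius r +
  1, where compactness applies, or both lie where the function vanishes.\<close>

lemma continuous_cpt_uniformly_continuous:
  fixes f :: "'a::euclidean_space \<Rightarrow> real"
  assumes "continuous_on UNIV f" "\<And>x. r < norm x \<Longrightarrow> f x = 0"
  shows "uniformly_continuous_on UNIV f"
proof -
  have "uniformly_continuous_on (cball 0 (r + 1)) f"
    by (intro compact_uniformly_continuous continuous_on_subset[OF assms(1)]) auto
  then have u: "\<And>e. e > 0 \<Longrightarrow> \<exists>d>0. \<forall>x\<in>cball 0 (r+1). \<forall>y\<in>cball 0 (r+1). dist y x < d \<longrightarrow> dist (f y) (f x) < e"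
    unfolding uniformly_continuous_on_def by blast
  show ?thesis unfolding uniformly_continuous_on_def
  proof (intro allI impI)
    fix e :: real assume "e > 0"
    with u obtain d where d: "d > 0"
      "\<And>x y. norm x \<le> r + 1 \<Longrightarrow> norm y \<le> r + 1 \<Longrightarrow> dist y x < d \<Longrightarrow> dist (f y) (f x) < e"
      by (metis mem_cball_0)
    have "dist (f y) (f x) < e" if "dist y x < min d 1" for x y
    proof (cases "norm x \<le> r + 1 \<and> norm y \<le> r + 1")
      case False
      have "norm x \<le> norm y + dist y x" "norm y \<le> norm x + dist y x"
        unfolding dist_norm using norm_triangle_sub[of x y] norm_triangle_sub[of y x] by (auto simp: norm_minus_commute)
      with False that have "norm x > r" "norm y > r" by auto
      then show ?thesis using assms(2) \<open>e > 0\<close> by simp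
    qed (use d that in auto)
    then show "\<exists>d>0. \<forall>x\<in>UNIV. \<forall>y\<in>UNIV. dist y x < d \<longrightarrow> dist (f y) (f x) < e"
      using d(1) by (intro exI[of _ "min d 1"]) auto
  qed
qed

lemma frechet_derivative_outside:
  assumes "\<And>x. r < norm x \<Longrightarrow> f x = 0" "r < norm x"
  shows "frechet_derivative f (at x) v = 0"
proof -
  have "open {x::'a. r < norm x}" by (intro open_Collect_less continuous_intros)
  then have "(f has_derivative (\<lambda>_. 0)) (at x)"
    by (rule has_derivative_transform_within_open[OF has_derivative_const[of 0]]) (use assms in auto)
  then show ?thesis by (metis frechet_derivative_at)
qed

lemma frechet_derivative_sum_Basis:
  fixes f :: "'a::euclidean_space \<Rightarrow> real"
  assumes "f differentiable (at x)"
  shows "frechet_derivative f (at x) v = (\<Sum>b\<in>Basis. (v \<bullet> b) * frechet_derivative f (at x) b)"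
proof -
  have "linear (frechet_derivative f (at x))" by (rule linear_frechet_derivative[OF assms])
  then have "frechet_derivative f (at x) (\<Sum>b\<in>Basis. (v \<bullet> b) *\<^sub>R b) = (\<Sum>b\<in>Basis. (v \<bullet> b) * frechet_derivative f (at x) b)"
    by (simp add: linear_sum linear_scale)
  then show ?thesis by (simp add: euclidean_representation)
qed

lemma mean_value_line:
  fixes f :: "'a::euclidean_space \<Rightarrow> real"
  assumes "\<And>x. f differentiable (at x)"
  shows "\<exists>t\<in>{0<..<1}. f (x + h) - f x = frechet_derivative f (at (x + t *\<^sub>R h)) h"
proof -
  have "((\<lambda>t. f (x + t *\<^sub>R h)) has_derivative (\<lambda>s. frechet_derivative f (at (x + t *\<^sub>R h)) (s *\<^sub>R h))) (at t within {0..1})" for t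
    by (rule has_derivative_compose[where f = "\<lambda>t. x + t *\<^sub>R h"])
       (auto intro!: derivative_eq_intros simp: assms frechet_derivative_works[symmetric])
  from mvt_simple[OF _ this] obtain t where "t \<in> {0<..<1}"
    "f (x + 1 *\<^sub>R h) - f (x + 0 *\<^sub>R h) = frechet_derivative f (at (x + t *\<^sub>R h)) ((1 - 0) *\<^sub>R h)" by auto
  then show ?thesis by auto
qed

text \<open>Uniformity in the base point z is needed because the estimate is inserted under an
  integral over all z = x - y. The mean value theorem reduces it to uniform continuity of the
  finitely many partial derivatives.\<close>

lemma C1_cpt_uniformly_differentiable:
  fixes k :: "'a::euclidean_space \<Rightarrow> real"
  assumes "Ck 1 k" "\<And>x. r < norm x \<Longrightarrow> k x = 0" "e > 0"
  shows "\<exists>d>0. \<forall>z h. norm h < d \<longrightarrow> \<bar>k (z + h) - k z - frechet_derivative k (at z) h\<bar> \<le> e * norm h"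
proof -
  let ?D = "\<lambda>b x. frechet_derivative k (at x) b"
  have diff: "k differentiable (at x)" for x using assms(1) by simp
  define e' where "e' = e / DIM('a)"
  have e': "e' > 0" using \<open>e > 0\<close> by (simp add: e'_def)
  have "uniformly_continuous_on UNIV (?D b)" for b
    by (rule continuous_cpt_uniformly_continuous[of _ r])
       (use assms(1) frechet_derivative_outside[of r k] assms(2) in auto)
  then have "\<forall>b. \<exists>d. d > 0 \<and> (\<forall>x y. dist y x < d \<longrightarrow> dist (?D b y) (?D b x) < e')"
    using e' by (simp add: uniformly_continuous_on_def)
  from choice[OF this] obtain d where
    d: "\<And>b. d b > 0" "\<And>b x y. dist y x < d b \<Longrightarrow> dist (?D b y) (?D b x) < e'"
    by blast
  define \<delta> where "\<delta> = Min (d ` Basis)"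
  have \<delta>: "\<delta> > 0" "\<And>b. b \<in> Basis \<Longrightarrow> \<delta> \<le> d b"
    using d(1) by (auto simp: \<delta>_def)
  have "\<bar>k (z + h) - k z - frechet_derivative k (at z) h\<bar> \<le> e * norm h" if h: "norm h < \<delta>" for z h
  proof -
    obtain t where t: "t \<in> {0<..<1}" "k (z + h) - k z = frechet_derivative k (at (z + t *\<^sub>R h)) h"
      using mean_value_line[of k z h] diff by blast
    have "norm (t *\<^sub>R h) \<le> norm h" using t(1) by (simp add: mult_left_le_one_le)
    then have close: "\<bar>?D b (z + t *\<^sub>R h) - ?D b z\<bar> \<le> e'" if "b \<in> Basis" for b
      using d(2)[of "z + t *\<^sub>R h" z b] \<delta>(2)[OF that] h by (auto simp: dist_norm)
    have "k (z + h) - k z - frechet_derivative k (at z) h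
        = (\<Sum>b\<in>Basis. (h \<bullet> b) * (?D b (z + t *\<^sub>R h) - ?D b z))"
      unfolding t(2) by (subst (1 2) frechet_derivative_sum_Basis[OF diff]) (simp add: sum_subtractf right_diff_distrib)
    also have "\<bar>\<dots>\<bar> \<le> (\<Sum>b\<in>Basis. \<bar>(h \<bullet> b) * (?D b (z + t *\<^sub>R h) - ?D b z)\<bar>)" by (rule sum_abs)
    also have "\<dots> \<le> (\<Sum>b\<in>(Basis::'a set). norm h * e')"
      by (intro sum_mono) (auto simp: abs_mult Basis_le_norm intro!: mult_mono close)
    also have "\<dots> = e * norm h" by (simp add: e'_def)
    finally show ?thesis .
  qed
  with \<delta>(1) show ?thesis by blast
qed

text \<open>Translation invariance makes the integral of every difference quotient 0, and the mean
  value theorem dominates the quotients; no iterated integration is involved.\<close>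

lemma integral_frechet_derivative_cpt:
  fixes f :: "'a::euclidean_space \<Rightarrow> real"
  assumes C1: "Ck 1 f" and supp: "\<And>x. r < norm x \<Longrightarrow> f x = 0"
  shows "(LBINT x. frechet_derivative f (at x) v) = 0"
proof -
  let ?D = "\<lambda>x. frechet_derivative f (at x) v"
  have diff: "\<And>x. f differentiable (at x)" and contD: "continuous_on UNIV ?D" using C1 by auto
  have contf: "continuous_on UNIV f" by (rule Ck_continuous[OF C1])
  have mf: "f \<in> borel_measurable borel" by (rule borel_measurable_continuous_onI[OF contf])
  obtain B where B: "B \<ge> 0" "\<And>x. \<bar>?D x\<bar> \<le> B"
    using continuous_cpt_bounded[of ?D r] contD frechet_derivative_outside[of r f] supp by blast
  define s where "s n x = real (Suc n) * (f (x + (1 / real (Suc n)) *\<^sub>R v) - f x)" for n x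
  have int: "integrable lborel f" by (rule Linf_loc_integrable[OF continuous_Linf_loc[OF contf] supp])
  have int': "integrable lborel (\<lambda>x. f (x + w))" for w :: 'a
  proof (rule Linf_loc_integrable[of _ "r + norm w"])
    show "(\<lambda>x. f (x + w)) \<in> Linf_loc"
      by (intro continuous_Linf_loc continuous_on_compose2[OF contf]) (auto intro: continuous_intros)
    fix x :: 'a assume "r + norm w < norm x"
    then have "r < norm (x + w)" using norm_triangle_ineq4[of "x + w" w] by simp
    then show "f (x + w) = 0" by (rule supp)
  qed
  have s0: "(LBINT x. s n x) = 0" for n
    unfolding s_def using int int' lborel_integral_translate[OF mf] by simp
  have "(\<lambda>n. LBINT x. s n x) \<longlonglongrightarrow> (LBINT x. ?D x)"
  proof (rule integral_dominated_convergence[where w = "\<lambda>x. indicator (cball 0 (r + norm v)) x * B"])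
    show "integrable lborel (\<lambda>x. indicator (cball 0 (r + norm v)) x * B)"
      by (intro Linf_loc_integrable_cball Linf_loc_const)
    show "AE x in lborel. (\<lambda>n. s n x) \<longlonglongrightarrow> ?D x"
    proof (rule AE_I2)
      fix x
      have "((\<lambda>t. f (x + t *\<^sub>R v)) has_derivative (\<lambda>s. frechet_derivative f (at (x + 0 *\<^sub>R v)) (s *\<^sub>R v))) (at 0)"
        by (rule has_derivative_compose[where f = "\<lambda>t. x + t *\<^sub>R v"])
           (auto intro!: derivative_eq_intros simp: diff frechet_derivative_works[symmetric])
      then have "((\<lambda>t. f (x + t *\<^sub>R v)) has_real_derivative ?D x) (at 0)"
        unfolding has_field_derivative_def
        by (rule has_derivative_eq_rhs)
           (simp add: linear_scale[OF linear_frechet_derivative[OF diff]] fun_eq_iff mult.commute)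
      then have "((\<lambda>t. (f (x + t *\<^sub>R v) - f x) / t) \<longlongrightarrow> ?D x) (at 0)"
        by (simp add: DERIV_def)
      moreover have "filterlim (\<lambda>n. 1 / real (Suc n)) (at 0) sequentially"
        using LIMSEQ_Suc[OF lim_1_over_n] by (auto simp: filterlim_at intro!: always_eventually)
      ultimately show "(\<lambda>n. s n x) \<longlonglongrightarrow> ?D x"
        by (auto dest: filterlim_compose simp: s_def mult.commute)
    qed
    show "AE x in lborel. norm (s n x) \<le> indicator (cball 0 (r + norm v)) x * B" for n
    proof (rule AE_I2)
      fix x
      let ?h = "(1 / real (Suc n)) *\<^sub>R v"
      \<comment> \<open>The increments 1 / (n + 1) never exceed 1, so all quotients vanish outside
        the ball of radius r + norm v, on which the dominating function is constant.\<close>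
      have nh: "norm ?h \<le> norm v" by (simp add: divide_le_eq mult_ge1_I mult_le_cancel_left1)
      obtain t where t: "f (x + ?h) - f x = frechet_derivative f (at (x + t *\<^sub>R ?h)) ?h"
        using mean_value_line[of f x ?h] diff by blast
      also have "\<dots> = ?D (x + t *\<^sub>R ?h) / real (Suc n)"
        by (subst linear_scale[OF linear_frechet_derivative[OF diff]]) simp
      finally have "s n x = ?D (x + t *\<^sub>R ?h)" by (simp add: s_def)
      then have "\<bar>s n x\<bar> \<le> B" using B(2) by simp
      moreover have "s n x = 0" if "r + norm v < norm x"
      proof -
        have "r < norm (x + ?h)" using norm_triangle_ineq4[of "x + ?h" ?h] that nh by simp
        moreover have "r < norm x" using that by (smt (verit) norm_ge_zero)
        ultimately show ?thesis by (simp add: s_def supp)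
      qed
      ultimately show "norm (s n x) \<le> indicator (cball 0 (r + norm v)) x * B"
        by (cases "r + norm v < norm x") (auto simp: indicator_def)
    qed
    show "?D \<in> borel_measurable lborel"
      using borel_measurable_continuous_onI[OF contD] by simp
    show "s n \<in> borel_measurable lborel" for n
    proof -
      have "(\<lambda>x. f (x + w)) \<in> borel_measurable lborel" for w :: 'a
        using int' by auto
      then show ?thesis unfolding s_def using mf by measurable
    qed
  qed
  then show ?thesis by (simp add: s0 LIMSEQ_const_iff)
qed

section \<open>Mollifying kernels and convolution\<close>

lemma smooth_Ck: "smooth f \<Longrightarrow> Ck n f"
  by (simp add: smooth_def)

lemma smooth_diff: "smooth f \<Longrightarrow> f differentiable (at x)"
  using smooth_Ck[of f 1] by simp

lemma smooth_frechet_derivative: "smooth f \<Longrightarrow> smooth (\<lambda>x. frechet_derivative f (at x) v)"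
  unfolding smooth_def using Ck_SucD(2) by blast

lemma smooth_continuous: "smooth f \<Longrightarrow> continuous_on UNIV f"
  using smooth_Ck[of f 0] by simp

lemma test_fun_UNIV_iff: "test_fun UNIV \<phi> \<longleftrightarrow> smooth \<phi> \<and> (\<exists>r. \<forall>x. r < norm x \<longrightarrow> \<phi> x = 0)"
proof -
  have "compact (closure {x. \<phi> x \<noteq> 0}) \<longleftrightarrow> (\<exists>r. \<forall>x. r < norm x \<longrightarrow> \<phi> x = 0)"
    unfolding compact_closure bounded_iff by (auto simp: linorder_not_less[symmetric])
  then show ?thesis by (auto simp: test_fun_def)
qed

lemma test_funI: "smooth \<phi> \<Longrightarrow> (\<And>x. r < norm x \<Longrightarrow> \<phi> x = 0) \<Longrightarrow> test_fun UNIV \<phi>"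
  by (auto simp: test_fun_UNIV_iff)

lemma smooth_vf_deriv:
  fixes \<phi> :: "'a::euclidean_space \<Rightarrow> real"
  assumes "smooth X" "smooth \<phi>"
  shows "smooth (vf_deriv X \<phi>)"
proof -
  have "vf_deriv X \<phi> = (\<lambda>x. \<Sum>b\<in>Basis. (X x \<bullet> b) * frechet_derivative \<phi> (at x) b)"
    unfolding vf_deriv_def by (rule ext, rule frechet_derivative_sum_Basis[OF smooth_diff[OF assms(2)]])
  then show ?thesis
    unfolding smooth_def
    using smooth_Ck[OF assms(1)] smooth_Ck[OF smooth_frechet_derivative[OF assms(2)]]
    by (auto intro!: Ck_sum Ck_mult Ck_bounded_linear[OF bounded_linear_inner_left])
qed

lemma vf_deriv_outside:
  "(\<And>x. r < norm x \<Longrightarrow> \<phi> x = 0) \<Longrightarrow> r < norm x \<Longrightarrow> vf_deriv X \<phi> x = 0"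
  unfolding vf_deriv_def by (rule frechet_derivative_outside)

lemma test_fun_vf_deriv:
  "smooth X \<Longrightarrow> test_fun UNIV \<phi> \<Longrightarrow> test_fun UNIV (vf_deriv X \<phi>)"
  unfolding test_fun_UNIV_iff using smooth_vf_deriv[of X \<phi>] vf_deriv_outside[of _ \<phi>] by blast

text \<open>The divergence theorem: X\<phi> = div(\<phi>X) - \<phi> div X, the last term is 0, and
  each coordinate of \<phi>X has compact support. Only C1 regularity of \<phi> is asked for, since
  the lemma is later applied to products F(f_n)\<phi> with F merely C1.\<close>

lemma integral_vf_deriv_eq_0:
  fixes X :: "'a::euclidean_space \<Rightarrow> 'a"
  assumes X: "smooth X" "\<And>x. divergence X x = 0"
    and C1: "Ck 1 \<phi>" and supp: "\<And>x. r < norm x \<Longrightarrow> \<phi> x = 0"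
  shows "(LBINT x. vf_deriv X \<phi> x) = 0"
proof -
  let ?F = "\<lambda>b x. (X x \<bullet> b) * \<phi> x"
  have dX: "(X has_derivative frechet_derivative X (at x)) (at x)" for x
    using smooth_diff[OF X(1)] by (simp add: frechet_derivative_works[symmetric])
  have d\<phi>: "\<phi> differentiable (at x)" "(\<phi> has_derivative frechet_derivative \<phi> (at x)) (at x)" for x
    using C1 by (auto simp: frechet_derivative_works[symmetric])
  have F: "Ck 1 (?F b)" for b
    by (intro Ck_mult Ck_bounded_linear[OF bounded_linear_inner_left] smooth_Ck[OF X(1)] C1)
  have Fsupp: "?F b x = 0" if "r < norm x" for b x using supp[OF that] by simp
  have dF: "frechet_derivative (?F b) (at x) v
      = (X x \<bullet> b) * frechet_derivative \<phi> (at x) v + (frechet_derivative X (at x) v \<bullet> b) * \<phi> x" for b x v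
  proof -
    have "(?F b has_derivative (\<lambda>v. (X x \<bullet> b) * frechet_derivative \<phi> (at x) v + (frechet_derivative X (at x) v \<bullet> b) * \<phi> x)) (at x)"
      by (rule has_derivative_mult[OF has_derivative_inner_left[OF dX] d\<phi>(2)])
    then show ?thesis by (subst frechet_derivative_at[symmetric]) auto
  qed
  have "vf_deriv X \<phi> x = (\<Sum>b\<in>Basis. frechet_derivative (?F b) (at x) b)" for x
  proof -
    have "(\<Sum>b\<in>Basis. frechet_derivative (?F b) (at x) b) = vf_deriv X \<phi> x + divergence X x * \<phi> x"
      unfolding dF vf_deriv_def divergence_def frechet_derivative_sum_Basis[OF d\<phi>(1), of x "X x"]
      by (simp add: sum.distrib sum_distrib_right)
    then show ?thesis by (simp add: X(2))
  qed
  moreover have "integrable lborel (\<lambda>x. frechet_derivative (?F b) (at x) b)" for b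
    by (rule Linf_loc_integrable[OF continuous_Linf_loc frechet_derivative_outside[OF Fsupp]])
       (use F[of b] in auto)
  ultimately have "(LBINT x. vf_deriv X \<phi> x)
      = (\<Sum>b\<in>Basis. LBINT x. frechet_derivative (?F b) (at x) b)"
    by simp
  also have "\<dots> = 0"
    using integral_frechet_derivative_cpt[OF F Fsupp] by simp
  finally show ?thesis .
qed

section \<open>The standard kernel and its rescalings\<close>

definition bump :: "'a::euclidean_space \<Rightarrow> real" where
  "bump z = flat_fun 1 (1 - z \<bullet> z)"

lemma smooth_bump: "smooth bump"
proof -
  have "Ck n (\<lambda>z::'a. 1 + (\<Sum>b\<in>Basis. (- 1) * ((z \<bullet> b) * (z \<bullet> b))))" for n
  proof -
    have "Ck n (\<lambda>z::'a. z)" for n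
    proof (cases n)
      case (Suc m)
      then show ?thesis
        using Ck_SucI[where f = "\<lambda>z::'a. z" and f' = "\<lambda>_ v. v" and n = m] by (simp add: Ck_const)
    qed auto
    then show ?thesis
      by (intro Ck_add Ck_sum Ck_mult Ck_const Ck_bounded_linear[OF bounded_linear_inner_left])
  qed
  then have "smooth (\<lambda>z::'a. 1 - z \<bullet> z)"
    unfolding smooth_def by (subst euclidean_inner) (simp add: sum_negf)
  from Ck_flat_fun[OF this] show ?thesis unfolding smooth_def bump_def[abs_def] by blast
qed

lemma bump_nonneg: "0 \<le> bump z"
  by (simp add: bump_def flat_fun_def)

lemma bump_eq_0: "1 \<le> norm z \<Longrightarrow> bump z = 0"
  using power_mono[of 1 "norm z" 2] by (simp add: bump_def flat_fun_def dot_square_norm)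

lemma bump_minus: "bump (- z) = bump z"
  by (simp add: bump_def)

lemma integral_bump_pos: "0 < (LBINT z. bump (z::'a::euclidean_space))"
proof -
  let ?c = "bump (0::'a) / 2"
  have pos: "bump (0::'a) > 0" by (simp add: bump_def flat_fun_def)
  have cont: "continuous_on UNIV (bump :: 'a \<Rightarrow> real)" by (rule smooth_continuous[OF smooth_bump])
  have int: "integrable lborel (bump :: 'a \<Rightarrow> real)"
    by (rule Linf_loc_integrable[OF continuous_Linf_loc[OF cont], of 1]) (simp add: bump_eq_0)
  have "open {z::'a. ?c < bump z}" by (intro open_Collect_less continuous_intros cont)
  moreover have "0 \<in> {z::'a. ?c < bump z}" using pos by simp
  ultimately obtain e where e: "e > 0" "ball 0 e \<subseteq> {z::'a. ?c < bump z}"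
    by (rule openE)
  have "0 < ?c * measure lborel (ball (0::'a) e)"
    using pos e(1) content_ball_pos[of e "0::'a"] by simp
  also have "\<dots> = (LBINT z. indicator (ball 0 e) (z::'a) * ?c)" by simp
  also have "\<dots> \<le> (LBINT z. bump (z::'a))"
    using e(2) by (intro integral_mono int integrable_mult_left integrable_real_indicator)
      (auto simp: indicator_def bump_nonneg emeasure_bounded_finite[OF bounded_ball, unfolded infinity_ennreal_def] subset_iff less_imp_le)
  finally show ?thesis .
qed

text \<open>Scaling by \<open>Suc n\<close> instead of n puts every kernel inside the unit ball.
  Mollification then enlarges supports by at most 1 for all n at once, which explains the radii r +
  1 from here on.\<close>

definition eta :: "nat \<Rightarrow> 'a::euclidean_space \<Rightarrow> real" where
  "eta n z = real (Suc n) ^ DIM('a) / (LBINT z. bump (z::'a)) * bump (real (Suc n) *\<^sub>R z)"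

lemma eta_nonneg: "0 \<le> eta n z"
  using integral_bump_pos[where 'a='a] by (simp add: eta_def bump_nonneg)

lemma eta_minus: "eta n (- z) = eta n z"
  by (simp add: eta_def bump_minus)

lemma eta_eq_0:
  assumes "1 / real (Suc n) \<le> norm z" shows "eta n z = 0"
proof -
  have "bump (real (Suc n) *\<^sub>R z) = 0" by (rule bump_eq_0) (use assms in \<open>simp add: field_simps del: of_nat_Suc\<close>)
  then show ?thesis unfolding eta_def by (simp only: mult_zero_right)
qed

lemma eta_eq_0': "1 \<le> norm z \<Longrightarrow> eta n z = 0"
  by (rule eta_eq_0) (smt (verit) divide_le_eq_1 of_nat_0_less_iff of_nat_Suc of_nat_0_le_iff)

lemma smooth_eta: "smooth (eta n)"
  using Ck_mult[OF Ck_const Ck_compose_affine[OF bounded_linear_scaleR_right, of _ bump 0]] smooth_Ck[OF smooth_bump]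
  unfolding smooth_def eta_def[abs_def] by (metis (no_types, lifting) add_0 ext)

lemma integral_eta: "(LBINT z. eta n z) = 1"
  using lborel_integral_affine[of "real (Suc n)" "bump :: 'a \<Rightarrow> real" 0]
    borel_measurable_continuous_onI[OF smooth_continuous[OF smooth_bump]] integral_bump_pos[where 'a='a]
  unfolding eta_def by (simp add: field_simps)

text \<open>The growth rate is the point: a derivative of the kernel costs a factor n + 1 in L1,
  which the increment of a smooth field over the support of the kernel, of order 1 / (n + 1), will
  cancel.\<close>

lemma integral_abs_eta_deriv:
  fixes v :: "'a::euclidean_space"
  shows "\<exists>C\<ge>0. \<forall>n. (LBINT z. \<bar>frechet_derivative (eta n) (at z) v\<bar>) \<le> C * real (Suc n)"
proof -
  let ?I = "LBINT z. bump (z::'a)"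
  let ?J = "LBINT z. \<bar>frechet_derivative bump (at z) v\<bar>"
  have d: "frechet_derivative (eta n) (at z) v
      = real (Suc n) ^ DIM('a) / ?I * (real (Suc n) * frechet_derivative bump (at (real (Suc n) *\<^sub>R z)) v)" for n z
  proof -
    let ?N = "real (Suc n)"
    have bd: "bump differentiable (at (?N *\<^sub>R z))" by (rule smooth_diff[OF smooth_bump])
    have "((\<lambda>z. bump (?N *\<^sub>R z)) has_derivative (\<lambda>v. frechet_derivative bump (at (?N *\<^sub>R z)) (?N *\<^sub>R v))) (at z)"
      by (rule has_derivative_compose[where f = "\<lambda>z. ?N *\<^sub>R z" and g = bump,
            OF _ frechet_derivative_works[THEN iffD1, OF bd]])
         (rule bounded_linear_imp_has_derivative[OF bounded_linear_scaleR_right])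
    then have "(eta n has_derivative (\<lambda>v. ?N ^ DIM('a) / ?I * frechet_derivative bump (at (?N *\<^sub>R z)) (?N *\<^sub>R v))) (at z)"
      unfolding eta_def[abs_def] by (rule has_derivative_mult_right)
    then have "frechet_derivative (eta n) (at z) v = ?N ^ DIM('a) / ?I * frechet_derivative bump (at (?N *\<^sub>R z)) (?N *\<^sub>R v)"
      by (subst frechet_derivative_at[symmetric]) auto
    then show ?thesis by (simp add: linear_scale[OF linear_frechet_derivative[OF bd]] del: of_nat_Suc)
  qed
  have "(LBINT z. \<bar>frechet_derivative (eta n) (at z) v\<bar>) = ?J / ?I * real (Suc n)" for n
  proof -
    let ?N = "real (Suc n)"
    have m: "(\<lambda>z. \<bar>frechet_derivative bump (at z) v\<bar>) \<in> borel_measurable borel"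
      by (intro borel_measurable_abs borel_measurable_continuous_onI smooth_continuous smooth_frechet_derivative smooth_bump)
    have "(LBINT z. \<bar>frechet_derivative (eta n) (at z) v\<bar>)
        = (LBINT z. ?N ^ DIM('a) / ?I * ?N * \<bar>frechet_derivative bump (at (?N *\<^sub>R z)) v\<bar>)"
      unfolding d using integral_bump_pos[where 'a='a] by (simp add: abs_mult)
    also have "\<dots> = ?N / ?I * (?N ^ DIM('a) * (LBINT z. \<bar>frechet_derivative bump (at (?N *\<^sub>R z)) v\<bar>))"
      by simp
    also have "?N ^ DIM('a) * (LBINT z. \<bar>frechet_derivative bump (at (?N *\<^sub>R z)) v\<bar>) = ?J"
      using lborel_integral_affine[of ?N "\<lambda>z. \<bar>frechet_derivative bump (at z) v\<bar>" 0] m by simp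
    finally show ?thesis by simp
  qed
  moreover have "0 \<le> ?J / ?I" using integral_bump_pos[where 'a='a] by (simp add: less_imp_le)
  ultimately show ?thesis by (intro exI[of _ "?J / ?I"]) auto
qed

section \<open>Convolution of locally bounded functions with compactly supported kernels\<close>

definition conv :: "('a::euclidean_space \<Rightarrow> real) \<Rightarrow> ('a \<Rightarrow> real) \<Rightarrow> 'a \<Rightarrow> real" where
  "conv f k x = (LBINT y. f y * k (x - y))"

lemma continuous_shift_reflect:
  "continuous_on UNIV k \<Longrightarrow> continuous_on UNIV (\<lambda>y::'a::real_normed_vector. k (x - y))"
  by (rule continuous_on_compose2[of UNIV k]) (auto intro: continuous_intros)

lemma conv_integrable:
  fixes f k :: "'a::euclidean_space \<Rightarrow> real"
  assumes "f \<in> Linf_loc" "continuous_on UNIV k" "\<And>x. r < norm x \<Longrightarrow> k x = 0"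
  shows "integrable lborel (\<lambda>y. f y * k (x - y))"
proof (rule Linf_loc_integrable[of _ "norm x + r"])
  show "(\<lambda>y. f y * k (x - y)) \<in> Linf_loc"
    by (intro Linf_loc_mult assms continuous_Linf_loc continuous_shift_reflect)
  fix y :: 'a assume "norm x + r < norm y"
  then have "r < norm (x - y)" using norm_triangle_ineq2[of y x] by (simp add: norm_minus_commute)
  then show "f y * k (x - y) = 0" using assms(3) by simp
qed

text \<open>The derivative falls on the kernel, so f need only be locally bounded. The first-order
  Taylor error of k, uniform in the base point, is integrated against |f| over a fixed ball.\<close>

lemma conv_has_derivative:
  fixes f k :: "'a::euclidean_space \<Rightarrow> real"
  assumes f: "f \<in> Linf_loc" and k: "Ck 1 k" and supp: "\<And>x. r < norm x \<Longrightarrow> k x = 0"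
  shows "(conv f k has_derivative (\<lambda>v. conv f (\<lambda>z. frechet_derivative k (at z) v) x)) (at x)"
proof -
  let ?D = "\<lambda>v z. frechet_derivative k (at z) v"
  have diff: "k differentiable (at z)" and contD: "continuous_on UNIV (?D v)" for z v using k by auto
  have contk: "continuous_on UNIV k" by (rule Ck_continuous[OF k])
  have intk: "integrable lborel (\<lambda>y. f y * k (x - y))" for x
    by (rule conv_integrable[OF f contk supp])
  have intD: "integrable lborel (\<lambda>y. f y * ?D v (x - y))" for v
    by (rule conv_integrable[OF f contD frechet_derivative_outside[OF supp]])
  have lin: "linear (frechet_derivative k (at z))" for z by (rule linear_frechet_derivative[OF diff])
  have "linear (\<lambda>v. conv f (?D v) x)"
    using intD unfolding conv_def
    by (intro linearI) (simp_all add: linear_add[OF lin] linear_scale[OF lin] distrib_left mult.left_commute)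
  then have bl: "bounded_linear (\<lambda>v. conv f (?D v) x)" by (rule linear_conv_bounded_linear[THEN iffD1])
  define A where "A = (LBINT y. indicator (cball 0 (norm x + r + 1)) y * \<bar>f y\<bar>)"
  have A: "A \<ge> 0" unfolding A_def by (intro integral_nonneg_AE) auto
  have "\<exists>d>0. \<forall>y. norm (y - x) < d \<longrightarrow> norm (conv f k y - conv f k x - conv f (?D (y - x)) x) \<le> e * norm (y - x)"
    if "e > 0" for e
  proof -
    define e' where "e' = e / (A + 1)"
    have "e' > 0" using that A by (simp add: e'_def)
    then obtain d where d: "d > 0" "\<And>z h. norm h < d \<Longrightarrow> \<bar>k (z + h) - k z - ?D h z\<bar> \<le> e' * norm h"
      using C1_cpt_uniformly_differentiable[OF k supp] by blast
    have "norm (conv f k (x + h) - conv f k x - conv f (?D h) x) \<le> e * norm h" if h: "norm h < min d 1" for h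
    proof -
      let ?g = "\<lambda>y. f y * (k (x - y + h) - k (x - y) - ?D h (x - y))"
      have ig: "integrable lborel ?g"
        using Bochner_Integration.integrable_diff[OF Bochner_Integration.integrable_diff[OF intk[of "x + h"] intk[of x]] intD[of h]]
        by (simp add: right_diff_distrib algebra_simps)
      have eq: "conv f k (x + h) - conv f k x - conv f (?D h) x = (LBINT y. ?g y)"
        unfolding conv_def using intk[of "x + h"] intk[of x] intD[of h]
        by (simp add: right_diff_distrib add_diff_eq[symmetric] add.commute diff_add_eq)
      have "norm (conv f k (x + h) - conv f k x - conv f (?D h) x) \<le> (LBINT y. norm (?g y))"
        unfolding eq by (rule integral_norm_bound)
      also have "\<dots> \<le> (LBINT y. (e' * norm h) * (indicator (cball 0 (norm x + r + 1)) y * \<bar>f y\<bar>))"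
      proof (rule integral_mono)
        show "integrable lborel (\<lambda>y. norm (?g y))" using ig by (rule integrable_norm)
        show "integrable lborel (\<lambda>y. (e' * norm h) * (indicator (cball 0 (norm x + r + 1)) y * \<bar>f y\<bar>))"
          by (intro integrable_mult_right Linf_loc_integrable_cball Linf_loc_abs f)
        fix y :: 'a
        show "norm (?g y) \<le> (e' * norm h) * (indicator (cball 0 (norm x + r + 1)) y * \<bar>f y\<bar>)"
        proof (cases "norm y \<le> norm x + r + 1")
          case True
          have "\<bar>f y\<bar> * \<bar>k (x - y + h) - k (x - y) - ?D h (x - y)\<bar> \<le> \<bar>f y\<bar> * (e' * norm h)"
            using h by (intro mult_left_mono d(2)) auto
          then show ?thesis using True by (simp add: abs_mult mult.commute)
        next
          case False
          have "r + 1 < norm (x - y)" using norm_triangle_ineq2[of y x] False by (simp add: norm_minus_commute)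
          moreover have "norm (x - y) \<le> norm (x - y + h) + norm h"
            using norm_triangle_ineq4[of "x - y + h" h] by simp
          ultimately have "r < norm (x - y)" "r < norm (x - y + h)" using h by auto
          then show ?thesis using supp frechet_derivative_outside[of r k, OF supp] False by simp
        qed
      qed
      also have "\<dots> = e' * norm h * A" by (simp add: A_def)
      also have "\<dots> \<le> e * norm h"
      proof -
        have "A / (A + 1) \<le> 1" using A by simp
        then have "e * (A / (A + 1)) \<le> e * 1" using \<open>e > 0\<close> by (intro mult_left_mono) auto
        then have "(e' * A) * norm h \<le> e * norm h" unfolding e'_def by (intro mult_right_mono) auto
        then show ?thesis by (simp add: mult_ac)
      qed
      finally show ?thesis .
    qed
    from this[of "y - x" for y] show ?thesis using d(1) by (intro exI[of _ "min d 1"]) auto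
  qed
  with bl show ?thesis unfolding has_derivative_at_alt by blast
qed

lemma Ck_conv:
  assumes "f \<in> Linf_loc" "smooth k" "\<And>x. r < norm x \<Longrightarrow> k x = 0"
  shows "Ck n (conv f k)"
  using assms(2,3)
proof (induction n arbitrary: k)
  case 0
  have "conv f k differentiable (at x)" for x
    using conv_has_derivative[OF assms(1) smooth_Ck[OF 0(1)] 0(2)] unfolding differentiable_def by blast
  then show ?case
    by (auto intro!: continuous_at_imp_continuous_on differentiable_imp_continuous_within)
next
  case (Suc n)
  show ?case
    by (rule Ck_SucI[OF conv_has_derivative[OF assms(1) smooth_Ck[OF Suc.prems(1)] Suc.prems(2)]])
       (auto intro: Suc.IH smooth_frechet_derivative[OF Suc.prems(1)] frechet_derivative_outside[OF Suc.prems(2)])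
qed

lemma smooth_conv:
  "f \<in> Linf_loc \<Longrightarrow> smooth k \<Longrightarrow> (\<And>x. r < norm x \<Longrightarrow> k x = 0) \<Longrightarrow> smooth (conv f k)"
  using Ck_conv unfolding smooth_def by blast

lemma conv_outside:
  assumes "\<And>y. R < norm y \<Longrightarrow> f y = 0" "\<And>z. r < norm z \<Longrightarrow> k z = 0" "R + r < norm x"
  shows "conv f k x = 0"
proof -
  have "f y * k (x - y) = 0" for y
  proof (cases "R < norm y")
    case False
    then have "r < norm (x - y)" using norm_triangle_ineq2[of x y] assms(3) by simp
    then show ?thesis using assms(2) by simp
  qed (simp add: assms(1))
  then have "(\<lambda>y. f y * k (x - y)) = (\<lambda>_. 0)" by (rule ext)
  then show ?thesis by (simp add: conv_def)
qed

section \<open>Mollification: locally uniform and weak convergence\<close>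

abbreviation mollify :: "nat \<Rightarrow> ('a::euclidean_space \<Rightarrow> real) \<Rightarrow> 'a \<Rightarrow> real" where
  "mollify n f \<equiv> conv f (eta n)"

lemma eta_outside: "1 < norm z \<Longrightarrow> eta n z = 0"
  by (rule eta_eq_0') simp

lemma smooth_mollify: "f \<in> Linf_loc \<Longrightarrow> smooth (mollify n f)"
  by (rule smooth_conv[OF _ smooth_eta eta_outside])

lemma mollify_outside: "(\<And>y. r < norm y \<Longrightarrow> f y = 0) \<Longrightarrow> r + 1 < norm x \<Longrightarrow> mollify n f x = 0"
  by (rule conv_outside[OF _ eta_outside])

lemma mollify_nonneg: "(\<And>x. 0 \<le> f x) \<Longrightarrow> 0 \<le> mollify n f x"
  unfolding conv_def by (intro integral_nonneg_AE AE_I2 mult_nonneg_nonneg eta_nonneg) auto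

lemma integrable_mollify_integrand: "f \<in> Linf_loc \<Longrightarrow> integrable lborel (\<lambda>y. f y * eta n (x - y))"
  by (rule conv_integrable[OF _ smooth_continuous[OF smooth_eta] eta_outside])

lemma measurable_eta: "eta n \<in> borel_measurable borel"
  by (intro borel_measurable_continuous_onI smooth_continuous smooth_eta)

lemma integral_eta_shift: "(LBINT y. eta n (x - y)) = 1"
  using lborel_integral_reflect[OF measurable_eta] integral_eta by metis

lemma integrable_eta_shift: "integrable lborel (\<lambda>y. eta n (x - y))"
  using integrable_mollify_integrand[OF Linf_loc_const[of 1], of n x] by simp

lemma inverse_Suc_small: "(e::real) > 0 \<Longrightarrow> \<exists>N. \<forall>n\<ge>N. 1 / real (Suc n) < e"
proof -
  assume "e > 0"
  moreover have "(\<lambda>n. 1 / real (Suc n)) \<longlonglongrightarrow> 0" using LIMSEQ_Suc[OF lim_1_over_n] by simp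
  ultimately have "\<forall>\<^sub>F n in sequentially. 1 / real (Suc n) < e" by (auto dest: order_tendstoD)
  then show ?thesis by (simp add: eventually_sequentially)
qed

lemma continuous_uniform_on_cball:
  fixes f :: "'a::euclidean_space \<Rightarrow> real"
  assumes "continuous_on UNIV f" "e > 0"
  shows "\<exists>d>0. \<forall>x y. norm x \<le> r \<longrightarrow> norm (x - y) < d \<longrightarrow> \<bar>f y - f x\<bar> < e"
proof -
  have "uniformly_continuous_on (cball 0 (r + 1)) f"
    by (intro compact_uniformly_continuous continuous_on_subset[OF assms(1)]) auto
  then obtain d where d: "d > 0"
    "\<And>x y. x \<in> cball 0 (r + 1) \<Longrightarrow> y \<in> cball 0 (r + 1) \<Longrightarrow> dist y x < d \<Longrightarrow> dist (f y) (f x) < e"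
    using assms(2) unfolding uniformly_continuous_on_def by blast
  have "\<bar>f y - f x\<bar> < e" if "norm x \<le> r" "norm (x - y) < min d 1" for x y
  proof -
    have "norm y \<le> r + 1" using norm_triangle_ineq2[of y x] that by (simp add: norm_minus_commute)
    then show ?thesis using d(2)[of x y] that by (simp add: dist_norm norm_minus_commute)
  qed
  then show ?thesis using d(1) by (intro exI[of _ "min d 1"]) auto
qed

lemma mollify_uniform:
  fixes f :: "'a::euclidean_space \<Rightarrow> real"
  assumes f: "continuous_on UNIV f" and "e > 0"
  shows "\<exists>N. \<forall>n\<ge>N. \<forall>x. norm x \<le> r \<longrightarrow> \<bar>mollify n f x - f x\<bar> \<le> e"
proof -
  obtain d where d: "d > 0" "\<And>x y. norm x \<le> r \<Longrightarrow> norm (x - y) < d \<Longrightarrow> \<bar>f y - f x\<bar> < e"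
    using continuous_uniform_on_cball[OF assms] by blast
  obtain N where N: "\<And>n. n \<ge> N \<Longrightarrow> 1 / real (Suc n) < d" using inverse_Suc_small[OF d(1)] by blast
  have "\<bar>mollify n f x - f x\<bar> \<le> e" if "n \<ge> N" "norm x \<le> r" for n x
  proof -
    have fL: "f \<in> Linf_loc" by (rule continuous_Linf_loc[OF f])
    have "mollify n f x - f x = (LBINT y. f y * eta n (x - y) - f x * eta n (x - y))"
      unfolding conv_def
      by (subst Bochner_Integration.integral_diff)
         (auto simp: integral_eta_shift intro!: integrable_mollify_integrand fL integrable_eta_shift)
    then have "\<bar>mollify n f x - f x\<bar> \<le> (LBINT y. norm (f y * eta n (x - y) - f x * eta n (x - y)))"
      using integral_norm_bound[of lborel "\<lambda>y. f y * eta n (x - y) - f x * eta n (x - y)"] by simp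
    also have "\<dots> \<le> (LBINT y. e * eta n (x - y))"
    proof (rule integral_mono)
      fix y
      show "norm (f y * eta n (x - y) - f x * eta n (x - y)) \<le> e * eta n (x - y)"
      proof (cases "norm (x - y) < d")
        case True
        then have "\<bar>f y - f x\<bar> * eta n (x - y) \<le> e * eta n (x - y)"
          using d(2)[OF that(2), of y] by (intro mult_right_mono) (auto simp: eta_nonneg)
        then show ?thesis by (simp add: left_diff_distrib[symmetric] abs_mult eta_nonneg)
      next
        case False
        then have "eta n (x - y) = 0" using N[OF that(1)] by (intro eta_eq_0) simp
        then show ?thesis by simp
      qed
    qed (intro integrable_norm Bochner_Integration.integrable_diff integrable_mult_right
        integrable_mollify_integrand fL integrable_eta_shift)+
    also have "\<dots> = e" by (simp add: integral_eta_shift)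
    finally show ?thesis .
  qed
  then show ?thesis by blast
qed

lemma mollify_tendsto:
  "continuous_on UNIV f \<Longrightarrow> (\<lambda>n. mollify n f x) \<longlonglongrightarrow> f x"
  using mollify_uniform[of f _ "norm x"] unfolding LIMSEQ_def dist_real_def
  by (metis field_lbound_gt_zero le_less_trans order_refl)

lemma mollify_bound:
  fixes g :: "'a::euclidean_space \<Rightarrow> real"
  assumes g: "g \<in> Linf_loc" and B: "AE x in lborel. norm x \<le> r + 1 \<longrightarrow> \<bar>g x\<bar> \<le> B" and "norm x \<le> r"
  shows "\<bar>mollify n g x\<bar> \<le> B"
proof -
  have "\<bar>mollify n g x\<bar> \<le> (LBINT y. norm (g y * eta n (x - y)))"
    using integral_norm_bound[of lborel "\<lambda>y. g y * eta n (x - y)"] by (simp add: conv_def)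
  also have "\<dots> \<le> (LBINT y. B * eta n (x - y))"
  proof (rule integral_mono_AE)
    show "AE y in lborel. norm (g y * eta n (x - y)) \<le> B * eta n (x - y)"
      using B
    proof eventually_elim
      case (elim y)
      show ?case
      proof (cases "norm y \<le> r + 1")
        case True
        then show ?thesis using elim by (simp add: abs_mult eta_nonneg mult_right_mono)
      next
        case False
        then have "1 < norm (x - y)" using norm_triangle_ineq2[of y x] assms(3) by (simp add: norm_minus_commute)
        then show ?thesis using eta_outside[of "x - y" n] by simp
      qed
    qed
  qed (auto intro!: integrable_mollify_integrand g integrable_eta_shift)
  also have "\<dots> = B" by (simp add: integral_eta_shift)
  finally show ?thesis .
qed

lemma mollify_Linf_loc: "g \<in> Linf_loc \<Longrightarrow> mollify n g \<in> Linf_loc"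
  by (rule continuous_Linf_loc[OF smooth_continuous[OF smooth_mollify]])

text \<open>Fubini and evenness of the kernel. The compact support of b makes the double integrand
  integrable although g is only locally bounded.\<close>

lemma mollify_adjoint:
  fixes b g :: "'a::euclidean_space \<Rightarrow> real"
  assumes b: "b \<in> Linf_loc" and supp: "\<And>x. r < norm x \<Longrightarrow> b x = 0" and g: "g \<in> Linf_loc"
  shows "(LBINT x. b x * mollify n g x) = (LBINT x. mollify n b x * g x)"
proof -
  let ?F = "\<lambda>x y. b x * (g y * eta n (x - y))"
  have [measurable]: "b \<in> borel_measurable borel" "g \<in> borel_measurable borel" "eta n \<in> borel_measurable borel"
    using b g Linf_locD(1) measurable_eta by auto
  have "integrable (lborel \<Otimes>\<^sub>M lborel) (case_prod ?F)"
  proof (rule lborel_pair.Fubini_integrable)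
    show "case_prod ?F \<in> borel_measurable (lborel \<Otimes>\<^sub>M lborel)" by measurable
    have "(LBINT y. norm (case_prod ?F (x, y))) = \<bar>b x\<bar> * mollify n (\<lambda>y. \<bar>g y\<bar>) x" for x
      by (simp add: conv_def abs_mult eta_nonneg)
    moreover have "integrable lborel (\<lambda>x. \<bar>b x\<bar> * mollify n (\<lambda>y. \<bar>g y\<bar>) x)"
      by (rule Linf_loc_integrable[of _ r]) (auto intro!: Linf_loc_mult Linf_loc_abs mollify_Linf_loc b g simp: supp)
    ultimately show "integrable lborel (\<lambda>x. LBINT y. norm (case_prod ?F (x, y)))" by simp
    show "AE x in lborel. integrable lborel (\<lambda>y. case_prod ?F (x, y))"
      by (rule AE_I2) (auto intro!: integrable_mult_right integrable_mollify_integrand g)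
  qed
  from lborel_pair.Fubini_integral[OF this]
  have "(LBINT x. LBINT y. ?F x y) = (LBINT y. LBINT x. ?F x y)" by simp
  also have "\<dots> = (LBINT y. LBINT x. g y * (b x * eta n (y - x)))"
    by (intro Bochner_Integration.integral_cong refl)
       (metis eta_minus minus_diff_eq mult.left_commute)
  finally show ?thesis by (simp add: conv_def mult.commute)
qed

text \<open>Density of continuous functions in L1, with control of the support. Almost everywhere
  approximation by continuous functions becomes L1 approximation after clamping to [-B, B] and
  cutting off, which supplies an integrable majorant.\<close>

lemma approx_by_continuous:
  fixes b :: "'a::euclidean_space \<Rightarrow> real"
  assumes b: "b \<in> Linf_loc" and supp: "\<And>x. r < norm x \<Longrightarrow> b x = 0" and e: "e > 0"
  shows "\<exists>c. continuous_on UNIV c \<and> (\<forall>x. r + 1 < norm x \<longrightarrow> c x = 0) \<and> (LBINT x. \<bar>b x - c x\<bar>) < e"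
proof -
  have mb[measurable]: "b \<in> borel_measurable borel" using b Linf_locD(1) by blast
  obtain B where B: "B \<ge> 0" "AE x in lborel. norm x \<le> r \<longrightarrow> \<bar>b x\<bar> \<le> B" using Linf_loc_cball[OF b, of r] by blast
  have "b \<in> borel_measurable lebesgue" by (rule measurable_completion) simp
  then have "b measurable_on UNIV" using measurable_on_iff_borel_measurable[of UNIV b] by simp
  then obtain N g where N: "negligible N" "\<And>n. continuous_on UNIV (g n)"
      "\<And>x. x \<notin> N \<Longrightarrow> (\<lambda>n. g n x) \<longlonglongrightarrow> b x"
    unfolding measurable_on_def by auto
  have "AE x in lebesgue. x \<notin> N" using N(1) by (simp add: negligible_iff_null_sets AE_not_in)
  then have AEN: "AE x in lborel. x \<notin> N" by (simp add: AE_completion_iff)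
  \<comment> \<open>Equal to 1 on the ball of radius r, where b may be nonzero, and to 0 beyond r +
    1.\<close>
  define cut :: "'a \<Rightarrow> real" where "cut x = max 0 (min 1 (r + 1 - norm x))" for x
  define c where "c n x = cut x * max (- B) (min B (g n x))" for n x
  have cutc: "continuous_on UNIV cut" unfolding cut_def by (intro continuous_intros)
  have cc: "continuous_on UNIV (c n)" for n
    unfolding c_def by (intro continuous_intros cutc N(2))
  have c0: "c n x = 0" if "r + 1 < norm x" for n x using that by (simp add: c_def cut_def)
  have cB: "\<bar>c n x\<bar> \<le> B" for n x
  proof -
    have "\<bar>cut x\<bar> * \<bar>max (- B) (min B (g n x))\<bar> \<le> 1 * B"
      using B(1) by (intro mult_mono) (auto simp: cut_def)
    then show ?thesis by (simp add: c_def abs_mult)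
  qed
  have "(\<lambda>n. LBINT x. \<bar>b x - c n x\<bar>) \<longlonglongrightarrow> (\<integral>x. 0 \<partial>(lborel :: 'a measure))"
  proof (rule integral_dominated_convergence[where w = "\<lambda>x. indicator (cball 0 (r + 1)) x * (2 * B)"])
    show "integrable lborel (\<lambda>x. indicator (cball (0::'a) (r + 1)) x * (2 * B))"
      by (intro Linf_loc_integrable_cball Linf_loc_const)
    show "AE x in lborel. (\<lambda>n. \<bar>b x - c n x\<bar>) \<longlonglongrightarrow> 0"
      using AEN B(2)
    proof eventually_elim
      case (elim x)
      have "(\<lambda>n. c n x) \<longlonglongrightarrow> cut x * max (- B) (min B (b x))"
        unfolding c_def by (intro tendsto_intros N(3) elim)
      also have "cut x * max (- B) (min B (b x)) = b x"
        using elim supp[of x] B(1) by (cases "norm x \<le> r") (auto simp: cut_def)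
      finally have "(\<lambda>n. \<bar>b x - c n x\<bar>) \<longlonglongrightarrow> \<bar>b x - b x\<bar>" by (intro tendsto_intros)
      then show ?case by simp
    qed
    show "AE x in lborel. norm \<bar>b x - c n x\<bar> \<le> indicator (cball 0 (r + 1)) x * (2 * B)" for n
      using B(2)
    proof eventually_elim
      case (elim x)
      show ?case
      proof (cases "norm x \<le> r + 1")
        case True
        have "\<bar>b x\<bar> \<le> B" using elim supp[of x] B(1) by (cases "norm x \<le> r") auto
        then have "\<bar>b x - c n x\<bar> \<le> 2 * B" using cB[of n x] by linarith
        then show ?thesis using True by simp
      next
        case False
        then show ?thesis using supp[of x] c0[of x n] by simp
      qed
    qed
    show "(\<lambda>x. \<bar>b x - c n x\<bar>) \<in> borel_measurable lborel" for n
      using borel_measurable_continuous_onI[OF cc[of n]] by simp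
  qed simp
  then have "\<forall>\<^sub>F n in sequentially. (LBINT x. \<bar>b x - c n x\<bar>) < e"
    using e by (auto dest: order_tendstoD)
  then obtain n where "(LBINT x. \<bar>b x - c n x\<bar>) < e"
    by (auto simp: eventually_sequentially)
  with cc c0 show ?thesis by blast
qed

lemma mollify_weak_tendsto:
  fixes b g :: "'a::euclidean_space \<Rightarrow> real"
  assumes b: "b \<in> Linf_loc" and supp: "\<And>x. r < norm x \<Longrightarrow> b x = 0" and g: "g \<in> Linf_loc"
  shows "(\<lambda>n. LBINT x. b x * mollify n g x) \<longlonglongrightarrow> (LBINT x. b x * g x)"
proof (rule LIMSEQ_I)
  fix e :: real assume e: "e > 0"
  \<comment> \<open>Radius r + 2: c is supported in radius r + 1, and mollifying there looks one
    unit further.\<close>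
  obtain G where G: "G \<ge> 0" "AE x in lborel. norm x \<le> r + 2 \<longrightarrow> \<bar>g x\<bar> \<le> G"
    using Linf_loc_cball[OF g] by blast
  define e1 where "e1 = e / (3 * (G + 1))"
  have e1: "e1 > 0" "e1 * G \<le> e / 3"
    using e G(1) by (auto simp: e1_def field_simps)
  obtain c where c: "continuous_on UNIV c" "\<And>x. r + 1 < norm x \<Longrightarrow> c x = 0" "(LBINT x. \<bar>b x - c x\<bar>) < e1"
    using approx_by_continuous[OF b supp e1(1)] by blast
  have cL: "c \<in> Linf_loc" by (rule continuous_Linf_loc[OF c(1)])
  have dL: "(\<lambda>x. b x - c x) \<in> Linf_loc" by (intro Linf_loc_diff b cL)
  have d0: "b x - c x = 0" if "r + 1 < norm x" for x using supp[of x] c(2)[OF that] that by simp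
  define A where "A = (LBINT x. indicator (cball 0 (r + 2)) x * \<bar>g x\<bar>)"
  have A: "A \<ge> 0" unfolding A_def by (intro integral_nonneg_AE) auto
  \<comment> \<open>The factor 4 makes the third error strictly smaller than e / 3; the other two
    are only known to be at most e / 3.\<close>
  define e2 where "e2 = e / (4 * (A + 1))"
  have e2: "e2 > 0" "e2 * A < e / 3" using e A by (auto simp: e2_def field_simps intro!: add_nonneg_pos)
  obtain N where N: "\<And>n x. n \<ge> N \<Longrightarrow> norm x \<le> r + 2 \<Longrightarrow> \<bar>mollify n c x - c x\<bar> \<le> e2"
    using mollify_uniform[OF c(1) e2(1)] by blast
  have small: "\<bar>LBINT x. (b x - c x) * h x\<bar> \<le> e / 3"
    if h: "h \<in> Linf_loc" "AE x in lborel. norm x \<le> r + 1 \<longrightarrow> \<bar>h x\<bar> \<le> G" for h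
  proof -
    have "\<bar>LBINT x. (b x - c x) * h x\<bar> \<le> (LBINT x. norm ((b x - c x) * h x))"
      using integral_norm_bound[of lborel "\<lambda>x. (b x - c x) * h x"] by simp
    also have "\<dots> \<le> (LBINT x. \<bar>b x - c x\<bar> * G)"
    proof (rule integral_mono_AE)
      show "integrable lborel (\<lambda>x. norm ((b x - c x) * h x))"
        by (intro integrable_norm Linf_loc_integrable[of _ "r + 1"] Linf_loc_mult dL h) (simp add: d0)
      show "integrable lborel (\<lambda>x. \<bar>b x - c x\<bar> * G)"
        by (intro integrable_mult_left integrable_abs Linf_loc_integrable[of _ "r + 1"] dL) (simp add: d0)
      show "AE x in lborel. norm ((b x - c x) * h x) \<le> \<bar>b x - c x\<bar> * G"
        using h(2)
      proof eventually_elim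
        case (elim x)
        show ?case
          using elim d0[of x] by (cases "norm x \<le> r + 1") (auto simp: abs_mult intro!: mult_left_mono)
      qed
    qed
    also have "\<dots> \<le> e1 * G" using c(3) G(1) by (auto intro!: mult_right_mono)
    finally show ?thesis using e1(2) by simp
  qed
  have "norm ((LBINT x. b x * mollify n g x) - (LBINT x. b x * g x)) < e" if "n \<ge> N" for n
  proof -
    have mL: "mollify n g \<in> Linf_loc" "mollify n c \<in> Linf_loc" by (intro mollify_Linf_loc g cL)+
    have ints: "integrable lborel (\<lambda>x. b x * mollify n g x)" "integrable lborel (\<lambda>x. c x * mollify n g x)"
      "integrable lborel (\<lambda>x. b x * g x)" "integrable lborel (\<lambda>x. c x * g x)"
      by (auto intro!: Linf_loc_integrable[of _ "r + 1"] Linf_loc_mult mL b g cL simp: supp c(2))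
    have intm: "integrable lborel (\<lambda>x. mollify n c x * g x)"
      by (rule Linf_loc_integrable[of _ "r + 2"]) (auto intro!: Linf_loc_mult mL g mollify_outside[of "r + 1"] simp: c(2))
    have "\<bar>LBINT x. (b x - c x) * mollify n g x\<bar> \<le> e / 3"
    proof (rule small[OF mL(1)], rule AE_I2, rule impI)
      fix x :: 'a assume "norm x \<le> r + 1"
      moreover have "AE x in lborel. norm x \<le> r + 1 + 1 \<longrightarrow> \<bar>g x\<bar> \<le> G" using G(2) by (simp add: add.assoc)
      ultimately show "\<bar>mollify n g x\<bar> \<le> G" by (intro mollify_bound[OF g])
    qed
    moreover have "\<bar>LBINT x. (b x - c x) * g x\<bar> \<le> e / 3"
    proof (rule small[OF g])
      show "AE x in lborel. norm x \<le> r + 1 \<longrightarrow> \<bar>g x\<bar> \<le> G" using G(2) by eventually_elim auto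
    qed
    moreover have "\<bar>LBINT x. (mollify n c x - c x) * g x\<bar> \<le> e2 * A"
    proof -
      have "\<bar>LBINT x. (mollify n c x - c x) * g x\<bar> \<le> (LBINT x. norm ((mollify n c x - c x) * g x))"
        using integral_norm_bound[of lborel "\<lambda>x. (mollify n c x - c x) * g x"] by simp
      also have "\<dots> \<le> (LBINT x. e2 * (indicator (cball 0 (r + 2)) x * \<bar>g x\<bar>))"
      proof (rule integral_mono)
        show "integrable lborel (\<lambda>x. norm ((mollify n c x - c x) * g x))"
          using integrable_norm[OF Bochner_Integration.integrable_diff[OF intm ints(4)]] by (simp add: left_diff_distrib)
        show "integrable lborel (\<lambda>x. e2 * (indicator (cball 0 (r + 2)) x * \<bar>g x\<bar>))"
          by (intro integrable_mult_right Linf_loc_integrable_cball Linf_loc_abs g)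
        fix x :: 'a
        show "norm ((mollify n c x - c x) * g x) \<le> e2 * (indicator (cball 0 (r + 2)) x * \<bar>g x\<bar>)"
          using N[OF that, of x] mollify_outside[of "r + 1" c x n] c(2)
          by (cases "norm x \<le> r + 2") (auto simp: abs_mult intro!: mult_right_mono)
      qed
      finally show ?thesis by (simp add: A_def)
    qed
    moreover have "(LBINT x. b x * mollify n g x) - (LBINT x. b x * g x)
        = (LBINT x. (b x - c x) * mollify n g x) - (LBINT x. (b x - c x) * g x)
          + (LBINT x. (mollify n c x - c x) * g x)"
      using ints intm mollify_adjoint[where n = n, OF cL c(2) g] by (simp add: left_diff_distrib)
    ultimately show ?thesis using e2(2) unfolding real_norm_def by linarith
  qed
  then show "\<exists>N. \<forall>n\<ge>N. norm ((LBINT x. b x * mollify n g x) - (LBINT x. b x * g x)) < e" by blast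
qed

lemma C1_locally_lipschitz:
  fixes f :: "'a::euclidean_space \<Rightarrow> real"
  assumes "Ck 1 f"
  shows "\<exists>L\<ge>0. \<forall>x h. norm x \<le> r \<longrightarrow> norm h \<le> 1 \<longrightarrow> \<bar>f (x + h) - f x\<bar> \<le> L * norm h"
proof -
  let ?D = "\<lambda>b x. frechet_derivative f (at x) b"
  have diff: "f differentiable (at x)" and cont: "continuous_on UNIV (?D b)" for x b using assms by auto
  have "\<exists>B. B \<ge> 0 \<and> (\<forall>x. norm x \<le> r + 1 \<longrightarrow> \<bar>?D b x\<bar> \<le> B)" for b
    using continuous_bounded_on_compact[OF cont compact_cball[of 0 "r + 1"] subset_UNIV, of b] by (simp add: Ball_def)
  then obtain B where B: "\<And>b. B b \<ge> 0" "\<And>b x. norm x \<le> r + 1 \<Longrightarrow> \<bar>?D b x\<bar> \<le> B b"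
    using choice[of "\<lambda>b B. B \<ge> 0 \<and> (\<forall>x. norm x \<le> r + 1 \<longrightarrow> \<bar>?D b x\<bar> \<le> B)"] by blast
  have "\<bar>f (x + h) - f x\<bar> \<le> (\<Sum>b\<in>Basis. B b) * norm h" if "norm x \<le> r" "norm h \<le> 1" for x h
  proof -
    obtain t where t: "t \<in> {0<..<1}" "f (x + h) - f x = frechet_derivative f (at (x + t *\<^sub>R h)) h"
      using mean_value_line[of f x h] diff by blast
    have "norm (t *\<^sub>R h) \<le> norm h" using t(1) by (simp add: mult_left_le_one_le)
    then have n: "norm (x + t *\<^sub>R h) \<le> r + 1" using norm_triangle_ineq[of x "t *\<^sub>R h"] that by linarith
    have "\<bar>f (x + h) - f x\<bar> \<le> (\<Sum>b\<in>Basis. \<bar>(h \<bullet> b) * ?D b (x + t *\<^sub>R h)\<bar>)"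
      unfolding t(2) frechet_derivative_sum_Basis[OF diff, of _ h] by (rule sum_abs)
    also have "\<dots> \<le> (\<Sum>b\<in>Basis. norm h * B b)"
      by (intro sum_mono) (auto simp: abs_mult Basis_le_norm intro!: mult_mono B n)
    finally show ?thesis by (simp add: sum_distrib_left mult.commute)
  qed
  then show ?thesis using B(1) by (intro exI[of _ "\<Sum>b\<in>Basis. B b"]) (auto intro: sum_nonneg)
qed

section \<open>Distributional derivatives along divergence-free fields\<close>

lemma test_fun_eta_shift:
  fixes x :: "'a::euclidean_space"
  shows "test_fun UNIV (\<lambda>y. eta n (x - y))"
proof (rule test_funI)
  have "Ck m (\<lambda>y. eta n (x + - y))" for m
    by (rule Ck_compose_affine[OF _ smooth_Ck[OF smooth_eta]]) (intro bounded_linear_minus bounded_linear_ident)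
  then show "smooth (\<lambda>y. eta n (x - y))" by (simp add: smooth_def)
  fix y :: 'a assume "norm x + 1 < norm y"
  then show "eta n (x - y) = 0"
    using norm_triangle_ineq2[of y x] by (intro eta_outside) (simp add: norm_minus_commute)
qed

lemma vf_deriv_eta_shift:
  "vf_deriv X (\<lambda>y. eta n (x - y)) y = - frechet_derivative (eta n) (at (x - y)) (X y)"
proof -
  have d: "eta n differentiable (at (x - y))" by (rule smooth_diff[OF smooth_eta])
  have "((\<lambda>y. eta n (x - y)) has_derivative (\<lambda>w. frechet_derivative (eta n) (at (x - y)) (- w))) (at y)"
    by (rule has_derivative_compose[where f = "\<lambda>y. x - y" and g = "eta n", OF _ frechet_derivative_works[THEN iffD1, OF d]])
       (auto intro!: derivative_eq_intros)
  then have "frechet_derivative (\<lambda>y. eta n (x - y)) (at y) (X y) = frechet_derivative (eta n) (at (x - y)) (- X y)"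
    by (subst frechet_derivative_at[symmetric]) auto
  then show ?thesis by (simp add: vf_deriv_def linear_neg[OF linear_frechet_derivative[OF d]])
qed

lemma integrable_Linf_test:
  assumes "h \<in> Linf_loc" "test_fun UNIV \<phi>"
  shows "integrable lborel (\<lambda>y. h y * \<phi> y)"
proof -
  obtain r where "smooth \<phi>" and r: "\<And>x. r < norm x \<Longrightarrow> \<phi> x = 0" using assms(2) by (auto simp: test_fun_UNIV_iff)
  then have "\<phi> \<in> Linf_loc" by (intro continuous_Linf_loc smooth_continuous)
  then show ?thesis using r by (intro Linf_loc_integrable[of _ r] Linf_loc_mult assms(1)) auto
qed

text \<open>Since \<open>X\<close> is divergence free, \<open>f\<close> may be replaced by \<open>f - f x\<close> in Friedrichs' commutator. For
  continuous \<open>f\<close> this gains the modulus of continuity, whereas the factor \<open>X x - X y\<close> only balances the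
  derivative of the kernel.\<close>

lemma mollify_commutator:
  fixes X :: "'a::euclidean_space \<Rightarrow> 'a"
  assumes X: "smooth X" "\<And>x. divergence X x = 0"
    and f: "continuous_on UNIV f" and g: "g \<in> Linf_loc" "has_distr_deriv X f g"
  shows "vf_deriv X (mollify n f) x - mollify n g x
    = (LBINT y. (f y - f x) * frechet_derivative (eta n) (at (x - y)) (X x - X y))"
proof -
  let ?D = "\<lambda>z w. frechet_derivative (eta n) (at z) w"
  have fL: "f \<in> Linf_loc" by (rule continuous_Linf_loc[OF f])
  have lin: "linear (?D z)" for z by (rule linear_frechet_derivative[OF smooth_diff[OF smooth_eta]])
  have tf: "test_fun UNIV (\<lambda>y. eta n (x - y))" by (rule test_fun_eta_shift)
  have DX: "?D (x - y) (X y) = - vf_deriv X (\<lambda>y. eta n (x - y)) y" for y by (simp add: vf_deriv_eta_shift)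
  have tfX: "test_fun UNIV (vf_deriv X (\<lambda>y. eta n (x - y)))" by (rule test_fun_vf_deriv[OF X(1) tf])
  have out: "?D z w = 0" if "1 < norm z" for z w by (rule frechet_derivative_outside[OF eta_outside that])
  have contD: "continuous_on UNIV (\<lambda>z. ?D z w)" for w
    by (intro smooth_continuous smooth_frechet_derivative smooth_eta)
  have i1: "integrable lborel (\<lambda>y. f y * ?D (x - y) (X x))"
    by (rule conv_integrable[OF fL contD out])
  have i3: "integrable lborel (\<lambda>y. ?D (x - y) (X x))"
    using conv_integrable[OF Linf_loc_const[of 1] contD out] by simp
  have i2: "integrable lborel (\<lambda>y. f y * ?D (x - y) (X y))"
    unfolding DX using integrable_Linf_test[OF fL tfX] by simp
  have i4: "integrable lborel (\<lambda>y. ?D (x - y) (X y))"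
    unfolding DX using integrable_Linf_test[OF Linf_loc_const[of 1] tfX] by simp
  have I1: "vf_deriv X (mollify n f) x = (LBINT y. f y * ?D (x - y) (X x))"
    using conv_has_derivative[where x = x, OF fL smooth_Ck[OF smooth_eta] eta_outside]
    unfolding vf_deriv_def by (subst frechet_derivative_at[symmetric]) (auto simp: conv_def)
  \<comment> \<open>The minus sign from differentiating \<open>eta n (x - y)\<close> in y cancels
    the one in \<open>has_distr_deriv\<close>.\<close>
  have I2: "mollify n g x = (LBINT y. f y * ?D (x - y) (X y))"
    using g(2) tf unfolding has_distr_deriv_def conv_def DX by simp
  have I3: "(LBINT y. ?D (x - y) (X x)) = 0"
    using lborel_integral_reflect[OF borel_measurable_continuous_onI[OF contD]]
      integral_frechet_derivative_cpt[OF smooth_Ck[OF smooth_eta] eta_outside] by metis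
  have I4: "(LBINT y. ?D (x - y) (X y)) = 0"
  proof -
    obtain r where "\<And>y. r < norm y \<Longrightarrow> eta n (x - y) = 0" using tf unfolding test_fun_UNIV_iff by blast
    from integral_vf_deriv_eq_0[OF X smooth_Ck this] tf show ?thesis
      unfolding DX by (simp add: test_fun_UNIV_iff)
  qed
  have "(LBINT y. (f y - f x) * ?D (x - y) (X x - X y))
      = (LBINT y. (f y * ?D (x - y) (X x) - f y * ?D (x - y) (X y)) - (f x * ?D (x - y) (X x) - f x * ?D (x - y) (X y)))"
    by (simp add: linear_diff[OF lin] algebra_simps)
  also have "\<dots> = ((LBINT y. f y * ?D (x - y) (X x)) - (LBINT y. f y * ?D (x - y) (X y)))
       - (f x * (LBINT y. ?D (x - y) (X x)) - f x * (LBINT y. ?D (x - y) (X y)))"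
    using i1 i2 i3 i4 by simp
  finally show ?thesis by (simp add: I1 I2 I3 I4)
qed

text \<open>The orders in n cancel: L b / (n + 1) bounds the increment of the field over the support
  of the kernel, and C b * (n + 1) bounds the L1 norm of the derivative of the kernel. What remains
  is A times the oscillation w of f, which is small by continuity, with no rate required.\<close>

lemma mollify_commutator_uniform:
  fixes X :: "'a::euclidean_space \<Rightarrow> 'a"
  assumes X: "smooth X" "\<And>x. divergence X x = 0"
    and f: "continuous_on UNIV f" and g: "g \<in> Linf_loc" "has_distr_deriv X f g" and e: "e > 0"
  shows "\<exists>N. \<forall>n\<ge>N. \<forall>x. norm x \<le> r \<longrightarrow> \<bar>vf_deriv X (mollify n f) x - mollify n g x\<bar> \<le> e"
proof -
  have "\<exists>C. C \<ge> 0 \<and> (\<forall>n. (LBINT z. \<bar>frechet_derivative (eta n) (at z) b\<bar>) \<le> C * real (Suc n))" for b :: 'a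
    using integral_abs_eta_deriv[of b] by blast
  then obtain C where C: "\<And>b::'a. C b \<ge> 0"
    "\<And>n b::'a. (LBINT z. \<bar>frechet_derivative (eta n) (at z) b\<bar>) \<le> C b * real (Suc n)"
    using choice[of "\<lambda>b C. C \<ge> 0 \<and> (\<forall>n. (LBINT z. \<bar>frechet_derivative (eta n) (at z) (b::'a)\<bar>) \<le> C * real (Suc n))"]
    by blast
  have "Ck 1 (\<lambda>x. X x \<bullet> b)" for b
    by (rule Ck_bounded_linear[OF bounded_linear_inner_left smooth_Ck[OF X(1)]])
  then have "\<exists>L. L \<ge> 0 \<and> (\<forall>x h. norm x \<le> r \<longrightarrow> norm h \<le> 1 \<longrightarrow> \<bar>X (x + h) \<bullet> b - X x \<bullet> b\<bar> \<le> L * norm h)" for b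
    using C1_locally_lipschitz[of "\<lambda>x. X x \<bullet> b" r] by blast
  then obtain L where L: "\<And>b::'a. L b \<ge> 0"
    "\<And>b x h. norm x \<le> r \<Longrightarrow> norm h \<le> 1 \<Longrightarrow> \<bar>X (x + h) \<bullet> b - X x \<bullet> b\<bar> \<le> L b * norm h"
    using choice[of "\<lambda>b L. L \<ge> 0 \<and> (\<forall>x h. norm x \<le> r \<longrightarrow> norm h \<le> 1 \<longrightarrow> \<bar>X (x + h) \<bullet> b - X x \<bullet> b\<bar> \<le> L * norm h)"]
    by blast
  define A where "A = (\<Sum>b\<in>(Basis::'a set). L b * C b)"
  have A: "A \<ge> 0" unfolding A_def using C(1) L(1) by (intro sum_nonneg mult_nonneg_nonneg)
  define w where "w = e / (A + 1)"
  have w: "w > 0" "w * A \<le> e" using e A by (auto simp: w_def field_simps)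
  obtain \<delta> where \<delta>: "\<delta> > 0" "\<And>x y. norm x \<le> r \<Longrightarrow> norm (x - y) < \<delta> \<Longrightarrow> \<bar>f y - f x\<bar> < w"
    using continuous_uniform_on_cball[OF f w(1)] by blast
  obtain N where N: "\<And>n. n \<ge> N \<Longrightarrow> 1 / real (Suc n) < \<delta>" using inverse_Suc_small[OF \<delta>(1)] by blast
  have "\<bar>vf_deriv X (mollify n f) x - mollify n g x\<bar> \<le> e" if "n \<ge> N" "norm x \<le> r" for n x
  proof -
    let ?D = "\<lambda>z w. frechet_derivative (eta n) (at z) w"
    let ?N = "real (Suc n)"
    let ?G = "\<lambda>y. \<Sum>b\<in>Basis. w * (L b / ?N) * \<bar>?D (x - y) b\<bar>"
    have contD: "continuous_on UNIV (\<lambda>z. \<bar>?D z b\<bar>)" for b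
      by (intro continuous_intros smooth_continuous smooth_frechet_derivative smooth_eta)
    have iD: "integrable lborel (\<lambda>y. \<bar>?D (x - y) b\<bar>)" for b
    proof -
      have "\<bar>?D z b\<bar> = 0" if "1 < norm z" for z
        using frechet_derivative_outside[OF eta_outside that] by simp
      from conv_integrable[OF Linf_loc_const[of 1] contD this] show ?thesis by simp
    qed
    have iDv: "(LBINT y. \<bar>?D (x - y) b\<bar>) = (LBINT z. \<bar>?D z b\<bar>)" for b
      by (rule lborel_integral_reflect[OF borel_measurable_continuous_onI[OF contD]])
    have pw: "\<bar>(f y - f x) * ?D (x - y) (X x - X y)\<bar> \<le> ?G y" for y
    proof (cases "1 / ?N < norm (x - y)")
      case True
      have "?D (x - y) v = 0" for v
        by (rule frechet_derivative_outside[OF _ True]) (auto intro: eta_eq_0)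
      then show ?thesis by simp
    next
      case False
      have small: "norm (y - x) \<le> 1 / ?N" "norm (x - y) < \<delta>"
        using False N[OF that(1)] by (auto simp: norm_minus_commute)
      have le1: "1 / ?N \<le> 1" by simp
      have "\<bar>?D (x - y) (X x - X y)\<bar> \<le> (\<Sum>b\<in>Basis. \<bar>((X x - X y) \<bullet> b) * ?D (x - y) b\<bar>)"
        unfolding frechet_derivative_sum_Basis[OF smooth_diff[OF smooth_eta], of _ _ "X x - X y"] by (rule sum_abs)
      also have "\<dots> \<le> (\<Sum>b\<in>Basis. (L b / ?N) * \<bar>?D (x - y) b\<bar>)"
      proof (rule sum_mono)
        fix b :: 'a
        have "\<bar>(X x - X y) \<bullet> b\<bar> = \<bar>X (x + (y - x)) \<bullet> b - X x \<bullet> b\<bar>" by (simp add: inner_diff_left)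
        also have "\<dots> \<le> L b * norm (y - x)" using small(1) le1 by (intro L(2) that) linarith
        also have "\<dots> \<le> L b * (1 / ?N)" using small(1) L(1) by (intro mult_left_mono)
        finally show "\<bar>((X x - X y) \<bullet> b) * ?D (x - y) b\<bar> \<le> (L b / ?N) * \<bar>?D (x - y) b\<bar>"
          unfolding abs_mult by (intro mult_right_mono) auto
      qed
      finally have "\<bar>f y - f x\<bar> * \<bar>?D (x - y) (X x - X y)\<bar> \<le> w * (\<Sum>b\<in>Basis. (L b / ?N) * \<bar>?D (x - y) b\<bar>)"
        using \<delta>(2)[OF that(2) small(2)] w(1) by (intro mult_mono) auto
      then show ?thesis by (simp add: abs_mult sum_distrib_left mult.assoc)
    qed
    have "\<bar>vf_deriv X (mollify n f) x - mollify n g x\<bar>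
        \<le> (LBINT y. norm ((f y - f x) * ?D (x - y) (X x - X y)))"
      unfolding mollify_commutator[OF X f g] real_norm_def[symmetric] by (rule integral_norm_bound)
    also have "\<dots> \<le> (LBINT y. ?G y)"
    proof (rule integral_mono')
      show "integrable lborel ?G" by (intro Bochner_Integration.integrable_sum integrable_mult_right iD)
      fix y :: 'a
      show "norm ((f y - f x) * ?D (x - y) (X x - X y)) \<le> ?G y" using pw by simp
      show "0 \<le> ?G y" by (rule order_trans[OF abs_ge_zero pw])
    qed
    also have "\<dots> = (\<Sum>b\<in>Basis. w * (L b / ?N) * (LBINT z. \<bar>?D z b\<bar>))"
      using iD by (simp add: iDv)
    also have "\<dots> \<le> (\<Sum>b\<in>(Basis::'a set). w * (L b / ?N) * (C b * ?N))"
      using w(1) L(1) by (intro sum_mono mult_left_mono C(2)) auto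
    also have "\<dots> = w * A" by (simp add: A_def sum_distrib_left mult.assoc)
    finally show ?thesis using w(2) by simp
  qed
  then show ?thesis by blast
qed

text \<open>A relation rather than the chosen representative \<open>distr_deriv\<close>, so that
  product and chain rules can be stated with explicit derivatives. Uniqueness almost everywhere
  transfers them to \<open>distr_deriv\<close> afterwards.\<close>

definition loc_deriv :: "('a::euclidean_space \<Rightarrow> 'a) \<Rightarrow> ('a \<Rightarrow> real) \<Rightarrow> ('a \<Rightarrow> real) \<Rightarrow> bool" where
  "loc_deriv X f g \<longleftrightarrow> g \<in> Linf_loc \<and> has_distr_deriv X f g"

lemma loc_deriv_add:
  assumes "smooth X" "continuous_on UNIV f" "continuous_on UNIV f'" "loc_deriv X f g" "loc_deriv X f' g'"
  shows "loc_deriv X (\<lambda>x. f x + f' x) (\<lambda>x. g x + g' x)"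
  using assms unfolding loc_deriv_def has_distr_deriv_def
  by (auto simp: Linf_loc_add distrib_right integrable_Linf_test test_fun_vf_deriv continuous_Linf_loc)

lemma loc_deriv_cmult:
  assumes "loc_deriv X f g"
  shows "loc_deriv X (\<lambda>x. c * f x) (\<lambda>x. c * g x)"
  using assms Linf_loc_mult[OF Linf_loc_const[of c]] unfolding loc_deriv_def has_distr_deriv_def
  by (auto simp: mult.assoc)

lemma continuous_bounded_Icc:
  fixes F :: "real \<Rightarrow> real"
  assumes "continuous_on UNIV F"
  shows "\<exists>C\<ge>0. \<forall>t. \<bar>t\<bar> \<le> B \<longrightarrow> \<bar>F t\<bar> \<le> C"
proof -
  obtain C where "C \<ge> 0" "\<forall>t\<in>{- B..B}. \<bar>F t\<bar> \<le> C"
    using continuous_bounded_on_compact[OF assms compact_Icc subset_UNIV] by blast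
  then show ?thesis by (intro exI[of _ C]) (auto simp: abs_le_iff)
qed

text \<open>For F(f_n) with f_n = \<open>mollify n f\<close> the integration by parts is classical.
  In the limit X f_n is compared with \<open>mollify n g\<close> by the commutator estimate,
  uniformly on balls, and \<open>mollify n g\<close> is passed to the limit only weakly, against the
  fixed continuous function F'(f)\<phi>.\<close>

lemma loc_deriv_compose:
  fixes X :: "'a::euclidean_space \<Rightarrow> 'a"
  assumes X: "smooth X" "\<And>x. divergence X x = 0"
    and f: "continuous_on UNIV f" and g: "loc_deriv X f g"
    and F: "\<And>t. (F has_real_derivative F' t) (at t)" and F': "continuous_on UNIV F'"
  shows "loc_deriv X (\<lambda>x. F (f x)) (\<lambda>x. F' (f x) * g x)"
proof -
  have gL: "g \<in> Linf_loc" and gd: "has_distr_deriv X f g" using g by (auto simp: loc_deriv_def)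
  have fL: "f \<in> Linf_loc" by (rule continuous_Linf_loc[OF f])
  have Fc: "continuous_on UNIV F" using F DERIV_isCont by (auto intro!: continuous_at_imp_continuous_on)
  have F'f: "continuous_on UNIV (\<lambda>x. F' (f x))" by (rule continuous_on_compose2[OF F' f]) auto
  have "(LBINT x. (F' (f x) * g x) * \<phi> x) = - (LBINT x. F (f x) * vf_deriv X \<phi> x)"
    if test: "test_fun UNIV \<phi>" for \<phi>
  proof -
    obtain r where \<phi>: "smooth \<phi>" and r: "\<And>x. r < norm x \<Longrightarrow> \<phi> x = 0"
      using test unfolding test_fun_UNIV_iff by blast
    have c\<phi>: "continuous_on UNIV \<phi>" by (rule smooth_continuous[OF \<phi>])
    have cX\<phi>: "continuous_on UNIV (vf_deriv X \<phi>)" by (rule smooth_continuous[OF smooth_vf_deriv[OF X(1) \<phi>]])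
    have rX: "vf_deriv X \<phi> x = 0" if "r < norm x" for x by (rule vf_deriv_outside[OF r that])
    let ?f = "\<lambda>n. mollify n f" and ?g = "\<lambda>n. mollify n g"
    have sf: "smooth (?f n)" for n by (rule smooth_mollify[OF fL])
    have cf: "continuous_on UNIV (?f n)" for n by (rule smooth_continuous[OF sf])
    have cXf: "continuous_on UNIV (vf_deriv X (?f n))" for n
      by (rule smooth_continuous[OF smooth_vf_deriv[OF X(1) sf]])
    have cg: "continuous_on UNIV (?g n)" for n by (rule smooth_continuous[OF smooth_mollify[OF gL]])
    have cFf: "continuous_on UNIV (\<lambda>x. F (?f n x))" for n by (rule continuous_on_compose2[OF Fc cf]) auto
    have cF'f: "continuous_on UNIV (\<lambda>x. F' (?f n x))" for n by (rule continuous_on_compose2[OF F' cf]) auto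
    have ibp: "(LBINT x. F (?f n x) * vf_deriv X \<phi> x)
        = - (LBINT x. F' (?f n x) * vf_deriv X (?f n) x * \<phi> x)" for n
    proof -
      let ?h = "\<lambda>x. F (?f n x)"
      have hd: "(?h has_derivative (\<lambda>v. F' (?f n x) * frechet_derivative (?f n) (at x) v)) (at x)" for x
        using has_derivative_compose[OF Ck_SucD(1)[OF smooth_Ck[OF sf]] has_field_derivative_imp_has_derivative[OF F]] .
      have Ckh: "Ck 1 ?h"
        unfolding One_nat_def
        by (rule Ck_SucI[OF hd]) (simp, intro continuous_on_mult cF'f smooth_continuous[OF smooth_frechet_derivative[OF sf]])
      have d\<phi>: "(\<phi> has_derivative frechet_derivative \<phi> (at x)) (at x)" for x
        using smooth_diff[OF \<phi>] by (simp add: frechet_derivative_works[symmetric])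
      have prod: "vf_deriv X (\<lambda>x. ?h x * \<phi> x) x = F (?f n x) * vf_deriv X \<phi> x + F' (?f n x) * vf_deriv X (?f n) x * \<phi> x" for x
        unfolding vf_deriv_def using has_derivative_mult[OF hd d\<phi>, of x]
        by (subst frechet_derivative_at[symmetric]) auto
      have "(LBINT x. vf_deriv X (\<lambda>x. ?h x * \<phi> x) x) = 0"
        by (rule integral_vf_deriv_eq_0[OF X Ck_mult[OF Ckh smooth_Ck[OF \<phi>]], of r]) (simp add: r)
      moreover have "integrable lborel (\<lambda>x. F (?f n x) * vf_deriv X \<phi> x)"
        by (rule Linf_loc_integrable[of _ r]) (auto intro!: continuous_Linf_loc continuous_intros cFf cX\<phi> simp: rX)
      moreover have "integrable lborel (\<lambda>x. F' (?f n x) * vf_deriv X (?f n) x * \<phi> x)"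
        by (rule Linf_loc_integrable[of _ r]) (auto intro!: continuous_Linf_loc continuous_intros cF'f cXf c\<phi> simp: r)
      ultimately show ?thesis unfolding prod by simp
    qed
    obtain B where B: "AE x in lborel. norm x \<le> r + 1 \<longrightarrow> \<bar>f x\<bar> \<le> B" using Linf_loc_cball[OF fL] by blast
    obtain G where G: "G \<ge> 0" "AE x in lborel. norm x \<le> r + 1 \<longrightarrow> \<bar>g x\<bar> \<le> G" using Linf_loc_cball[OF gL] by blast
    have fB: "\<bar>?f n x\<bar> \<le> B" if "norm x \<le> r" for n x by (rule mollify_bound[OF fL B that])
    have fB': "\<bar>f x\<bar> \<le> B" if "norm x \<le> r" for x
      by (rule LIMSEQ_le_const2[OF tendsto_rabs[OF mollify_tendsto[OF f]]]) (use fB[OF that] in auto)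
    have gB: "\<bar>?g n x\<bar> \<le> G" if "norm x \<le> r" for n x by (rule mollify_bound[OF gL G(2) that])
    obtain CF where CF: "CF \<ge> 0" "\<And>t. \<bar>t\<bar> \<le> B \<Longrightarrow> \<bar>F t\<bar> \<le> CF" using continuous_bounded_Icc[OF Fc] by blast
    obtain CF' where CF': "CF' \<ge> 0" "\<And>t. \<bar>t\<bar> \<le> B \<Longrightarrow> \<bar>F' t\<bar> \<le> CF'" using continuous_bounded_Icc[OF F'] by blast
    obtain P where P: "P \<ge> 0" "\<And>x. \<bar>\<phi> x\<bar> \<le> P" using continuous_cpt_bounded[OF c\<phi> r] by blast
    obtain PX where PX: "PX \<ge> 0" "\<And>x. \<bar>vf_deriv X \<phi> x\<bar> \<le> PX" using continuous_cpt_bounded[OF cX\<phi> rX] by blast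
    have limF: "(\<lambda>n. F (?f n x)) \<longlonglongrightarrow> F (f x)" "(\<lambda>n. F' (?f n x)) \<longlonglongrightarrow> F' (f x)" for x
      using Fc F' by (auto intro!: isCont_tendsto_compose[OF _ mollify_tendsto[OF f]] simp: continuous_on_eq_continuous_at)
    have lim1: "(\<lambda>n. LBINT x. F (?f n x) * vf_deriv X \<phi> x) \<longlonglongrightarrow> (LBINT x. F (f x) * vf_deriv X \<phi> x)"
    proof (rule integral_dominated_convergence[where w = "\<lambda>x. indicator (cball 0 r) x * (CF * PX)"])
      show "integrable lborel (\<lambda>x. indicator (cball (0::'a) r) x * (CF * PX))"
        by (intro Linf_loc_integrable_cball Linf_loc_const)
      show "AE x in lborel. (\<lambda>n. F (?f n x) * vf_deriv X \<phi> x) \<longlonglongrightarrow> F (f x) * vf_deriv X \<phi> x"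
        by (intro AE_I2 tendsto_intros limF)
      show "AE x in lborel. norm (F (?f n x) * vf_deriv X \<phi> x) \<le> indicator (cball 0 r) x * (CF * PX)" for n
      proof (rule AE_I2)
        fix x :: 'a
        show "norm (F (?f n x) * vf_deriv X \<phi> x) \<le> indicator (cball 0 r) x * (CF * PX)"
        proof (cases "norm x \<le> r")
          case True
          then show ?thesis by (auto simp: abs_mult intro!: mult_mono CF PX fB)
        qed (simp add: rX)
      qed
    qed (auto intro!: borel_measurable_continuous_onI continuous_intros cFf cX\<phi> continuous_on_compose2[OF Fc f])
    \<comment> \<open>The remainder after replacing X f_n by \<open>mollify n g\<close> and F'(f_n)
      by F'(f). It tends to 0 pointwise: the first replacement is uniformly small, and the second
      multiplies a null sequence by the locally bounded \<open>mollify n g\<close>.\<close>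
    let ?u = "\<lambda>n x. F' (?f n x) * vf_deriv X (?f n) x * \<phi> x - F' (f x) * \<phi> x * ?g n x"
    \<comment> \<open>Shifting the sequence by N makes the commutator at most 1 from the start, as
      the dominating function requires.\<close>
    obtain N where N: "\<And>n x. n \<ge> N \<Longrightarrow> norm x \<le> r \<Longrightarrow> \<bar>vf_deriv X (?f n) x - ?g n x\<bar> \<le> 1"
      using mollify_commutator_uniform[OF X f gL gd, of 1 r] by auto
    have lim2: "(\<lambda>n. LBINT x. ?u (n + N) x) \<longlonglongrightarrow> (\<integral>x. 0 \<partial>(lborel :: 'a measure))"
    proof (rule integral_dominated_convergence[where w = "\<lambda>x. indicator (cball 0 r) x * (CF' * P + (2 * CF') * P * G)"])
      show "integrable lborel (\<lambda>x. indicator (cball (0::'a) r) x * (CF' * P + (2 * CF') * P * G))"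
        by (intro Linf_loc_integrable_cball Linf_loc_const)
      have u_eq: "?u n x = F' (?f n x) * \<phi> x * (vf_deriv X (?f n) x - ?g n x) + (F' (?f n x) - F' (f x)) * \<phi> x * ?g n x" for n x
        by (simp add: algebra_simps)
      show "AE x in lborel. (\<lambda>n. ?u (n + N) x) \<longlonglongrightarrow> 0"
      proof (rule AE_I2)
        fix x :: 'a
        show "(\<lambda>n. ?u (n + N) x) \<longlonglongrightarrow> 0"
        proof (cases "norm x \<le> r")
          case True
          have c0: "(\<lambda>n. vf_deriv X (?f n) x - ?g n x) \<longlonglongrightarrow> 0"
            unfolding LIMSEQ_def dist_real_def
          proof (intro allI impI)
            fix e :: real assume "e > 0"
            then obtain M where "\<forall>n\<ge>M. \<forall>x. norm x \<le> r \<longrightarrow> \<bar>vf_deriv X (?f n) x - ?g n x\<bar> \<le> e / 2"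
              using mollify_commutator_uniform[OF X f gL gd, of "e / 2" r] by auto
            then show "\<exists>no. \<forall>n\<ge>no. \<bar>vf_deriv X (?f n) x - ?g n x - 0\<bar> < e"
              using True \<open>e > 0\<close> by (intro exI[of _ M]) (smt (verit) field_sum_of_halves)
          qed
          have "(\<lambda>n. F' (?f n x) * \<phi> x * (vf_deriv X (?f n) x - ?g n x)) \<longlonglongrightarrow> F' (f x) * \<phi> x * 0"
            by (intro tendsto_intros limF c0)
          moreover have "(\<lambda>n. ((F' (?f n x) - F' (f x)) * \<phi> x) * ?g n x) \<longlonglongrightarrow> 0"
          proof (rule tendsto_0_le)
            have "(\<lambda>n. (F' (?f n x) - F' (f x)) * \<phi> x) \<longlonglongrightarrow> (F' (f x) - F' (f x)) * \<phi> x"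
              by (intro tendsto_intros limF)
            then show "(\<lambda>n. (F' (?f n x) - F' (f x)) * \<phi> x) \<longlonglongrightarrow> 0" by simp
            show "\<forall>\<^sub>F n in sequentially. norm (((F' (?f n x) - F' (f x)) * \<phi> x) * ?g n x)
                \<le> norm ((F' (?f n x) - F' (f x)) * \<phi> x) * G"
              by (rule always_eventually) (auto simp: abs_mult intro!: mult_left_mono gB True)
          qed
          ultimately have "(\<lambda>n. ?u n x) \<longlonglongrightarrow> F' (f x) * \<phi> x * 0 + 0" unfolding u_eq by (rule tendsto_add)
          then show ?thesis using LIMSEQ_ignore_initial_segment[of "\<lambda>n. ?u n x" 0 N] by simp
        qed (simp add: r)
      qed
      show "AE x in lborel. norm (?u (n + N) x) \<le> indicator (cball 0 r) x * (CF' * P + (2 * CF') * P * G)" for n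
      proof (rule AE_I2)
        fix x :: 'a
        show "norm (?u (n + N) x) \<le> indicator (cball 0 r) x * (CF' * P + (2 * CF') * P * G)"
        proof (cases "norm x \<le> r")
          case True
          let ?n = "n + N"
          have "\<bar>F' (?f ?n x)\<bar> * \<bar>\<phi> x\<bar> * \<bar>vf_deriv X (?f ?n) x - ?g ?n x\<bar> \<le> CF' * P * 1"
            by (intro mult_mono CF' P fB True N mult_nonneg_nonneg) auto
          moreover have "\<bar>F' (?f ?n x) - F' (f x)\<bar> \<le> 2 * CF'"
            using CF'(2)[OF fB[OF True, of ?n]] CF'(2)[OF fB'[OF True]] by linarith
          then have "\<bar>F' (?f ?n x) - F' (f x)\<bar> * \<bar>\<phi> x\<bar> * \<bar>?g ?n x\<bar> \<le> (2 * CF') * P * G"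
            using CF' P by (intro mult_mono gB True mult_nonneg_nonneg) auto
          ultimately have "\<bar>?u ?n x\<bar> \<le> CF' * P + (2 * CF') * P * G"
            unfolding u_eq abs_mult[symmetric] by linarith
          then show ?thesis using True by simp
        qed (simp add: r)
      qed
    qed (auto intro!: borel_measurable_continuous_onI continuous_intros cF'f cXf cg c\<phi> F'f)
    have lim3: "(\<lambda>n. LBINT x. F' (f x) * \<phi> x * ?g n x) \<longlonglongrightarrow> (LBINT x. F' (f x) * \<phi> x * g x)"
      by (rule mollify_weak_tendsto[of _ r]) (auto intro!: continuous_Linf_loc continuous_intros F'f c\<phi> gL simp: r)
    have int_a: "integrable lborel (\<lambda>x. F' (?f n x) * vf_deriv X (?f n) x * \<phi> x)" for n
      by (rule Linf_loc_integrable[of _ r]) (auto intro!: continuous_Linf_loc continuous_intros cF'f cXf c\<phi> simp: r)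
    have int_b: "integrable lborel (\<lambda>x. F' (f x) * \<phi> x * ?g n x)" for n
      by (rule Linf_loc_integrable[of _ r]) (auto intro!: continuous_Linf_loc continuous_intros F'f cg c\<phi> simp: r)
    have "(\<lambda>n. (LBINT x. ?u (n + N) x) + (LBINT x. F' (f x) * \<phi> x * ?g (n + N) x))
        \<longlonglongrightarrow> 0 + (LBINT x. F' (f x) * \<phi> x * g x)"
      using lim2 LIMSEQ_ignore_initial_segment[OF lim3, of N] by (intro tendsto_add) simp_all
    then have "(\<lambda>n. - (LBINT x. F (?f (n + N) x) * vf_deriv X \<phi> x)) \<longlonglongrightarrow> (LBINT x. F' (f x) * \<phi> x * g x)"
      unfolding ibp using int_a int_b by simp
    moreover have "(\<lambda>n. - (LBINT x. F (?f (n + N) x) * vf_deriv X \<phi> x)) \<longlonglongrightarrow> - (LBINT x. F (f x) * vf_deriv X \<phi> x)"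
      using LIMSEQ_ignore_initial_segment[OF lim1, of N] by (rule tendsto_minus)
    ultimately have "(LBINT x. F' (f x) * \<phi> x * g x) = - (LBINT x. F (f x) * vf_deriv X \<phi> x)"
      by (rule LIMSEQ_unique)
    then show ?thesis by (simp only: mult_ac)
  qed
  moreover have "(\<lambda>x. F' (f x) * g x) \<in> Linf_loc" by (intro Linf_loc_mult gL continuous_Linf_loc F'f)
  ultimately show ?thesis by (simp add: loc_deriv_def has_distr_deriv_def)
qed

text \<open>Polarisation: fg is a quarter of (f + g)^2 - (f - g)^2, and squares are covered by the
  chain rule.\<close>

lemma loc_deriv_mult:
  fixes X :: "'a::euclidean_space \<Rightarrow> 'a"
  assumes X: "smooth X" "\<And>x. divergence X x = 0"
    and f: "continuous_on UNIV f" "loc_deriv X f f'" and g: "continuous_on UNIV g" "loc_deriv X g g'"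
  shows "loc_deriv X (\<lambda>x. f x * g x) (\<lambda>x. f' x * g x + f x * g' x)"
proof -
  let ?p = "\<lambda>x. f x + g x" and ?m = "\<lambda>x. f x + (-1) * g x"
  have sq: "((\<lambda>t. t^2 :: real) has_real_derivative 2 * t) (at t)" for t
    by (auto intro!: derivative_eq_intros)
  have cm: "continuous_on UNIV (\<lambda>x. (-1) * g x)" by (intro continuous_intros g)
  have c: "continuous_on UNIV ?p" "continuous_on UNIV ?m" by (intro continuous_intros f g)+
  have "loc_deriv X (\<lambda>x. (?p x)^2) (\<lambda>x. 2 * ?p x * (f' x + g' x))"
    by (rule loc_deriv_compose[OF X c(1) loc_deriv_add[OF X(1) f(1) g(1) f(2) g(2)] sq]) (intro continuous_intros)
  moreover have "loc_deriv X (\<lambda>x. (?m x)^2) (\<lambda>x. 2 * ?m x * (f' x + (-1) * g' x))"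
    by (rule loc_deriv_compose[OF X c(2) loc_deriv_add[OF X(1) f(1) cm f(2) loc_deriv_cmult[OF g(2)]] sq]) (intro continuous_intros)
  ultimately have "loc_deriv X (\<lambda>x. 1 / 4 * (?p x)^2 + (- 1 / 4) * (?m x)^2)
      (\<lambda>x. 1 / 4 * (2 * ?p x * (f' x + g' x)) + (- 1 / 4) * (2 * ?m x * (f' x + (-1) * g' x)))"
    by (intro loc_deriv_add loc_deriv_cmult X(1) continuous_intros f g)
  moreover have "1 / 4 * (?p x)^2 + (- 1 / 4) * (?m x)^2 = f x * g x" for x
    by (simp add: power2_eq_square algebra_simps)
  moreover have "1 / 4 * (2 * ?p x * (f' x + g' x)) + (- 1 / 4) * (2 * ?m x * (f' x + (-1) * g' x)) = f' x * g x + f x * g' x" for x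
    by (simp add: algebra_simps)
  ultimately show ?thesis by simp
qed

lemma loc_deriv_const:
  fixes X :: "'a::euclidean_space \<Rightarrow> 'a"
  assumes X: "smooth X" "\<And>x. divergence X x = 0"
  shows "loc_deriv X (\<lambda>x. c) (\<lambda>x. 0)"
proof -
  have "(LBINT x. c * vf_deriv X \<phi> x) = 0" if "test_fun UNIV \<phi>" for \<phi>
    using integral_vf_deriv_eq_0[OF X smooth_Ck, of \<phi>] that unfolding test_fun_UNIV_iff by auto
  then show ?thesis by (simp add: loc_deriv_def has_distr_deriv_def Linf_loc_const)
qed

text \<open>The difference h of the two derivatives mollifies to 0, since the shifted kernels are
  test functions. Weak convergence tested against h restricted to a ball then shows that the
  integral of h^2 over that ball is 0.\<close>

lemma loc_deriv_unique:
  fixes X :: "'a::euclidean_space \<Rightarrow> 'a"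
  assumes "loc_deriv X f g" "loc_deriv X f g'"
  shows "AE x in lborel. g x = g' x"
proof -
  let ?h = "\<lambda>x. g x - g' x"
  have gL: "g \<in> Linf_loc" "g' \<in> Linf_loc" and hL: "?h \<in> Linf_loc"
    using assms by (auto simp: loc_deriv_def intro: Linf_loc_diff)
  have m0: "mollify n ?h x = 0" for n x
    using assms test_fun_eta_shift[of n x] integrable_mollify_integrand[OF gL(1), of n x] integrable_mollify_integrand[OF gL(2), of n x]
    unfolding conv_def loc_deriv_def has_distr_deriv_def by (simp add: left_diff_distrib)
  have "AE x in lborel. norm x \<le> real k \<longrightarrow> g x = g' x" for k
  proof -
    let ?b = "\<lambda>x. indicator (cball 0 (real k)) x * ?h x"
    have b0: "?b x = 0" if "real k < norm x" for x using that by simp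
    have bL: "?b \<in> Linf_loc"
    proof (rule Linf_locI)
      show "?b \<in> borel_measurable borel"
        using Linf_locD(1)[OF hL] by (auto intro!: borel_measurable_times borel_measurable_indicator)
      fix r
      obtain B where "B \<ge> 0" "AE x in lborel. norm x \<le> r \<longrightarrow> \<bar>?h x\<bar> \<le> B" using Linf_loc_cball[OF hL] by blast
      then have "AE x in lborel. norm x \<le> r \<longrightarrow> \<bar>?b x\<bar> \<le> B" by eventually_elim (auto simp: indicator_def)
      then show "\<exists>B. AE x in lborel. norm x \<le> r \<longrightarrow> \<bar>?b x\<bar> \<le> B" ..
    qed
    have "(\<lambda>n. LBINT x. ?b x * mollify n ?h x) \<longlonglongrightarrow> (LBINT x. ?b x * ?h x)"
      by (rule mollify_weak_tendsto[OF bL b0 hL])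
    then have "(LBINT x. ?b x * ?h x) = 0" by (simp add: m0 LIMSEQ_const_iff)
    moreover have "integrable lborel (\<lambda>x. ?b x * ?h x)"
      by (rule Linf_loc_integrable[of _ "real k"]) (auto intro!: Linf_loc_mult bL hL)
    ultimately have "AE x in lborel. ?b x * ?h x = 0"
      by (subst (asm) integral_nonneg_eq_0_iff_AE) (auto simp: mult.assoc)
    then show ?thesis by eventually_elim (auto simp: indicator_def)
  qed
  then have "AE x in lborel. \<forall>k. norm x \<le> real k \<longrightarrow> g x = g' x" unfolding AE_all_countable by blast
  then show ?thesis by eventually_elim (meson real_arch_simple)
qed

section \<open>The class \<open>classL\<close> and its gradient norm\<close>

lemma classL_iff:
  "f \<in> classL X \<longleftrightarrow> continuous_on UNIV f \<and> (\<forall>i. \<exists>g. loc_deriv (X i) f g)"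
  by (auto simp: classL_def loc_deriv_def)

lemma classL_continuous: "f \<in> classL X \<Longrightarrow> continuous_on UNIV f"
  by (simp add: classL_iff)

lemma loc_deriv_distr_deriv:
  "f \<in> classL X \<Longrightarrow> loc_deriv (X i) f (distr_deriv (X i) f)"
  unfolding classL_iff loc_deriv_def distr_deriv_def 
  by (rule someI_ex[where P = "\<lambda>g. g \<in> Linf_loc \<and> has_distr_deriv (X i) f g"]) blast

lemma loc_deriv_Linf_loc: "loc_deriv X f g \<Longrightarrow> g \<in> Linf_loc"
  by (simp add: loc_deriv_def)

lemma grad_norm_sq: "(grad_norm X f x)\<^sup>2 = (\<Sum>i\<in>UNIV. (distr_deriv (X i) f x)\<^sup>2)"
  unfolding grad_norm_def by (simp add: sum_nonneg)

lemma grad_norm_nonneg: "0 \<le> grad_norm X f x"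
  unfolding grad_norm_def by (simp add: sum_nonneg)

text \<open>Lets |\<nabla>f|^2 be computed from any explicit representatives, in particular from
  those delivered by the product and chain rules.\<close>

lemma grad_norm_sq_AE:
  fixes X :: "'i::finite \<Rightarrow> 'a::euclidean_space \<Rightarrow> 'a"
  assumes "continuous_on UNIV f" "\<And>i. loc_deriv (X i) f (G i)"
  shows "AE x in lborel. (grad_norm X f x)\<^sup>2 = (\<Sum>i\<in>UNIV. (G i x)\<^sup>2)"
proof -
  have "f \<in> classL X" using assms by (auto simp: classL_iff)
  from loc_deriv_unique[OF loc_deriv_distr_deriv[OF this] assms(2)]
  have "AE x in lborel. \<forall>i. distr_deriv (X i) f x = G i x"
    by (simp add: AE_all_countable)
  then show ?thesis by eventually_elim (simp add: grad_norm_sq)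
qed

lemma measurable_grad_norm_sq:
  "f \<in> classL X \<Longrightarrow> (\<lambda>x. (grad_norm X f x)\<^sup>2) \<in> borel_measurable borel"
  unfolding grad_norm_sq
  by (intro borel_measurable_sum borel_measurable_power Linf_locD(1) loc_deriv_Linf_loc[OF loc_deriv_distr_deriv])

lemma Linf_loc_restrict:
  assumes "h \<in> Linf_loc" shows "(\<lambda>x. indicator (cball 0 R) x * h x) \<in> Linf_loc"
proof (rule Linf_locI)
  show "(\<lambda>x. indicator (cball 0 R) x * h x) \<in> borel_measurable borel"
    using Linf_locD(1)[OF assms] by (auto intro!: borel_measurable_times borel_measurable_indicator)
  fix r
  obtain B where "B \<ge> 0" "AE x in lborel. norm x \<le> r \<longrightarrow> \<bar>h x\<bar> \<le> B" using Linf_loc_cball[OF assms] by blast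
  then have "AE x in lborel. norm x \<le> r \<longrightarrow> \<bar>indicator (cball 0 R) x * h x\<bar> \<le> B"
    by eventually_elim (auto simp: indicator_def)
  then show "\<exists>B. AE x in lborel. norm x \<le> r \<longrightarrow> \<bar>indicator (cball 0 R) x * h x\<bar> \<le> B" ..
qed

text \<open>The weak form of the Laplacian bound, for test functions of exactly the regularity that
  u^2 G(d) has. Mollification makes them admissible, and the gap between the levels a and a' leaves
  room for it; the limit is taken as in the chain rule.\<close>

lemma weak_laplacian_bound:
  fixes X :: "'i::finite \<Rightarrow> 'a::euclidean_space \<Rightarrow> 'a"
  assumes X: "\<And>i. smooth (X i)" "\<And>i x. divergence (X i) x = 0"
    and d: "continuous_on UNIV d" "\<And>i. loc_deriv (X i) d (E i)"
    and lap: "distr_laplacian_le X {x. a < d x} d h" and h: "h \<in> Linf_loc"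
    and \<phi>: "continuous_on UNIV \<phi>" "\<And>x. 0 \<le> \<phi> x" "\<And>x. r < norm x \<Longrightarrow> \<phi> x = 0"
      "\<And>x. d x \<le> a' \<Longrightarrow> \<phi> x = 0" "a < a'"
    and P: "\<And>i. loc_deriv (X i) \<phi> (P i)" "\<And>i x. r < norm x \<Longrightarrow> P i x = 0"
  shows "0 \<le> (LBINT x. h x * \<phi> x + (\<Sum>i\<in>UNIV. E i x * P i x))"
proof -
  let ?\<phi> = "\<lambda>n. mollify n \<phi>"
  have \<phi>L: "\<phi> \<in> Linf_loc" by (rule continuous_Linf_loc[OF \<phi>(1)])
  have PL: "P i \<in> Linf_loc" and EL: "E i \<in> Linf_loc" for i using P(1) d(2) by (auto simp: loc_deriv_def)
  have s\<phi>: "smooth (?\<phi> n)" for n by (rule smooth_mollify[OF \<phi>L])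
  have r\<phi>: "?\<phi> n x = 0" if "r + 1 < norm x" for n x by (rule mollify_outside[OF \<phi>(3) that])
  have rP: "mollify n (P i) x = 0" if "r + 1 < norm x" for n x i by (rule mollify_outside[OF P(2) that])
  have rX: "vf_deriv (X i) (?\<phi> n) x = 0" if "r + 1 < norm x" for n i x by (rule vf_deriv_outside[OF r\<phi> that])
  have t\<phi>: "test_fun UNIV (?\<phi> n)" for n by (rule test_funI[OF s\<phi> r\<phi>])
  have XL: "vf_deriv (X i) (?\<phi> n) \<in> Linf_loc" for i n
    by (rule continuous_Linf_loc[OF smooth_continuous[OF smooth_vf_deriv[OF X(1) s\<phi>]]])
  \<comment> \<open>A level strictly between a and a'. For large n the mollified function is
    supported in the closed set {c \<le> d}, which lies in {a < d}.\<close>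
  define c where "c = (a + a') / 2"
  have c: "a < c" "c < a'" using \<phi>(5) by (auto simp: c_def)
  obtain \<delta> where \<delta>: "\<delta> > 0" "\<And>x y. norm x \<le> r \<Longrightarrow> norm (x - y) < \<delta> \<Longrightarrow> \<bar>d y - d x\<bar> < a' - c"
    using continuous_uniform_on_cball[OF d(1), of "a' - c" r] c(2) unfolding diff_gt_0_iff_gt by blast
  obtain N where N: "\<And>n. n \<ge> N \<Longrightarrow> 1 / real (Suc n) < \<delta>" using inverse_Suc_small[OF \<delta>(1)] by blast
  have supp: "?\<phi> n x = 0" if "n \<ge> N" "d x < c" for n x
  proof -
    have "\<phi> y * eta n (x - y) = 0" for y
    proof (rule ccontr)
      assume nz: "\<phi> y * eta n (x - y) \<noteq> 0"
      then have "norm y \<le> r" "d y > a'" using \<phi>(3,4)[of y] by (auto simp: linorder_not_le[symmetric])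
      moreover have "norm (y - x) < \<delta>"
        using nz eta_eq_0[of n "x - y"] N[OF that(1)] by (force simp: norm_minus_commute linorder_not_le[symmetric])
      ultimately show False using \<delta>(2)[of y x] that(2) by auto
    qed
    then have "(\<lambda>y. \<phi> y * eta n (x - y)) = (\<lambda>_. 0)" by (rule ext)
    then show ?thesis by (simp add: conv_def)
  qed
  have testU: "test_fun {x. a < d x} (?\<phi> n)" if "n \<ge> N" for n
  proof -
    have "closure {x. ?\<phi> n x \<noteq> 0} \<subseteq> {x. c \<le> d x}"
      using supp[OF that] by (intro closure_minimal closed_Collect_le continuous_on_const d(1)) (auto simp: linorder_not_less[symmetric])
    then show ?thesis using t\<phi>[of n] c(1) unfolding test_fun_def by fastforce
  qed
  have ineq: "0 \<le> (LBINT x. h x * ?\<phi> n x) + (\<Sum>i\<in>UNIV. LBINT x. E i x * vf_deriv (X i) (?\<phi> n) x)"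
    if "n \<ge> N" for n
  proof -
    have tX: "test_fun UNIV (vf_deriv (X i) (?\<phi> n))" for i by (rule test_fun_vf_deriv[OF X(1) t\<phi>])
    have dL: "d \<in> Linf_loc" by (rule continuous_Linf_loc[OF d(1)])
    \<comment> \<open>X_i applied to the mollified function is again a test function, so one of the
      two derivatives can be moved onto d.\<close>
    have "(LBINT x. d x * vf_laplacian X (?\<phi> n) x)
        = (\<Sum>i\<in>UNIV. LBINT x. d x * vf_deriv (X i) (vf_deriv (X i) (?\<phi> n)) x)"
      unfolding vf_laplacian_def sum_distrib_left
      by (intro Bochner_Integration.integral_sum integrable_Linf_test dL test_fun_vf_deriv X(1) tX)
    also have "\<dots> = (\<Sum>i\<in>UNIV. - (LBINT x. E i x * vf_deriv (X i) (?\<phi> n) x))"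
      using d(2) tX unfolding loc_deriv_def has_distr_deriv_def by (intro sum.cong) auto
    finally show ?thesis
      using lap testU[OF that] mollify_nonneg[of \<phi> n, OF \<phi>(2)] unfolding distr_laplacian_le_def
      by (auto simp: sum_negf)
  qed
  have lim_h: "(\<lambda>n. LBINT x. h x * ?\<phi> n x) \<longlonglongrightarrow> (LBINT x. h x * \<phi> x)"
  proof -
    \<comment> \<open>Restriction to a ball turns h into a compactly supported weight, as weak
      convergence requires, and leaves the integrals unchanged.\<close>
    let ?h = "\<lambda>x. indicator (cball 0 (r + 1)) x * h x"
    have "(\<lambda>n. LBINT x. ?h x * ?\<phi> n x) \<longlonglongrightarrow> (LBINT x. ?h x * \<phi> x)"
      by (rule mollify_weak_tendsto[OF Linf_loc_restrict[OF h] _ \<phi>L, of "r + 1"]) auto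
    moreover have "(\<lambda>x. ?h x * ?\<phi> n x) = (\<lambda>x. h x * ?\<phi> n x)" for n
      using r\<phi> by (force simp: indicator_def)
    moreover have "(\<lambda>x. ?h x * \<phi> x) = (\<lambda>x. h x * \<phi> x)"
      using \<phi>(3) by (force simp: indicator_def)
    ultimately show ?thesis by simp
  qed
  have lim_E: "(\<lambda>n. LBINT x. E i x * vf_deriv (X i) (?\<phi> n) x) \<longlonglongrightarrow> (LBINT x. E i x * P i x)" for i
  proof -
    let ?E = "\<lambda>x. indicator (cball 0 (r + 1)) x * E i x"
    let ?v = "\<lambda>n. vf_deriv (X i) (?\<phi> n)" and ?m = "\<lambda>n. mollify n (P i)"
    have E'L: "?E \<in> Linf_loc" by (rule Linf_loc_restrict[OF EL])
    have lim1: "(\<lambda>n. LBINT x. ?E x * ?m n x) \<longlonglongrightarrow> (LBINT x. ?E x * P i x)"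
      by (rule mollify_weak_tendsto[OF E'L _ PL, of "r + 1"]) auto
    have int1: "integrable lborel (\<lambda>x. ?E x * ?m n x)" "integrable lborel (\<lambda>x. ?E x * ?v n x)" for n
      by (rule Linf_loc_integrable[of _ "r + 1"]; force intro!: Linf_loc_mult E'L mollify_Linf_loc PL XL)+
    define A where "A = (LBINT x. \<bar>?E x\<bar>)"
    have A: "A \<ge> 0" unfolding A_def by (intro integral_nonneg_AE) auto
    have "(\<lambda>n. (LBINT x. ?E x * ?v n x) - (LBINT x. ?E x * ?m n x)) \<longlonglongrightarrow> 0"
    proof (rule LIMSEQ_I)
      fix e :: real assume e: "e > 0"
      define e' where "e' = e / (2 * (A + 1))"
      have e': "e' > 0" "e' * A < e" using e A by (auto simp: e'_def field_simps intro!: add_nonneg_pos)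
      have Pd: "has_distr_deriv (X i) \<phi> (P i)" using P(1) by (simp add: loc_deriv_def)
      obtain M where M: "\<And>n x. n \<ge> M \<Longrightarrow> norm x \<le> r + 1 \<Longrightarrow> \<bar>?v n x - ?m n x\<bar> \<le> e'"
        using mollify_commutator_uniform[OF X(1) X(2) \<phi>(1) PL Pd e'(1), of "r + 1"] by blast
      have "norm ((LBINT x. ?E x * ?v n x) - (LBINT x. ?E x * ?m n x) - 0) < e" if "n \<ge> M" for n
      proof -
        have "norm ((LBINT x. ?E x * ?v n x) - (LBINT x. ?E x * ?m n x) - 0)
            = norm (LBINT x. ?E x * ?v n x - ?E x * ?m n x)"
          using int1[of n] by simp
        also have "\<dots> \<le> (LBINT x. norm (?E x * ?v n x - ?E x * ?m n x))" by (rule integral_norm_bound)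
        also have "\<dots> \<le> (LBINT x. e' * \<bar>?E x\<bar>)"
        proof (rule integral_mono)
          show "integrable lborel (\<lambda>x. norm (?E x * ?v n x - ?E x * ?m n x))"
            by (intro integrable_norm Bochner_Integration.integrable_diff int1)
          show "integrable lborel (\<lambda>x. e' * \<bar>?E x\<bar>)"
            by (intro integrable_mult_right integrable_abs Linf_loc_integrable_cball EL)
          fix x :: 'a
          show "norm (?E x * ?v n x - ?E x * ?m n x) \<le> e' * \<bar>?E x\<bar>"
          proof (cases "norm x \<le> r + 1")
            case True
            have "\<bar>E i x\<bar> * \<bar>?v n x - ?m n x\<bar> \<le> \<bar>E i x\<bar> * e'" by (intro mult_left_mono M that True) auto
            then show ?thesis using True by (simp add: right_diff_distrib[symmetric] abs_mult mult.commute)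
          qed simp
        qed
        also have "\<dots> = e' * A" by (simp add: A_def)
        also have "\<dots> < e" by (rule e'(2))
        finally show ?thesis .
      qed
      then show "\<exists>M. \<forall>n\<ge>M. norm ((LBINT x. ?E x * ?v n x) - (LBINT x. ?E x * ?m n x) - 0) < e" by blast
    qed
    from tendsto_add[OF this lim1]
    have "(\<lambda>n. LBINT x. ?E x * ?v n x) \<longlonglongrightarrow> (LBINT x. ?E x * P i x)" by simp
    moreover have "(\<lambda>x. ?E x * ?v n x) = (\<lambda>x. E i x * ?v n x)" for n
      using rX by (force simp: indicator_def)
    moreover have "(\<lambda>x. ?E x * P i x) = (\<lambda>x. E i x * P i x)"
      using P(2) by (force simp: indicator_def)
    ultimately show ?thesis by simp
  qed
  have "(\<lambda>n. (LBINT x. h x * ?\<phi> n x) + (\<Sum>i\<in>UNIV. LBINT x. E i x * vf_deriv (X i) (?\<phi> n) x))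
      \<longlonglongrightarrow> (LBINT x. h x * \<phi> x) + (\<Sum>i\<in>UNIV. LBINT x. E i x * P i x)"
    by (intro tendsto_intros lim_h lim_E)
  then have "0 \<le> (LBINT x. h x * \<phi> x) + (\<Sum>i\<in>UNIV. LBINT x. E i x * P i x)"
    by (rule LIMSEQ_le_const) (use ineq in blast)
  moreover have "integrable lborel (\<lambda>x. h x * \<phi> x)"
    by (rule Linf_loc_integrable[OF Linf_loc_mult[OF h \<phi>L], of r]) (simp add: \<phi>(3))
  moreover have "integrable lborel (\<lambda>x. E i x * P i x)" for i
    by (rule Linf_loc_integrable[OF Linf_loc_mult[OF EL PL], of r]) (simp add: P(2))
  ultimately show ?thesis by simp
qed

text \<open>The chain rule asks for a C1 function on the whole line. For a > 1 the power of the
  positive part is one, and it agrees with the ordinary power at nonnegative arguments; at 0 the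
  difference quotient is at most |h|^(a-1).\<close>

lemma has_derivative_pos_part_powr:
  assumes "1 < a"
  shows "((\<lambda>t. max 0 t powr a) has_real_derivative a * max 0 t powr (a - 1)) (at t)"
proof -
  consider "t < 0" | "t = 0" | "t > 0" by linarith
  then show ?thesis
  proof cases
    case 1
    have "((\<lambda>_. 0) has_real_derivative 0) (at t)" by simp
    then have "((\<lambda>t. max 0 t powr a) has_real_derivative 0) (at t)"
      by (rule has_field_derivative_transform_within_open[of _ _ _ "{..<0}"]) (use 1 in auto)
    then show ?thesis using 1 by simp
  next
    case 2
    have "((\<lambda>h. (max 0 h powr a) / h) \<longlongrightarrow> 0) (at 0)"
    proof (rule tendsto_0_le[where f = "\<lambda>h::real. \<bar>h\<bar> powr (a - 1)" and K = 1])
      have "((\<lambda>h::real. \<bar>h\<bar> powr (a - 1)) \<longlongrightarrow> \<bar>0\<bar> powr (a - 1)) (at 0)"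
        by (rule tendsto_powr'[OF _ tendsto_const]) (use assms in \<open>auto intro!: tendsto_eq_intros\<close>)
      then show "((\<lambda>h::real. \<bar>h\<bar> powr (a - 1)) \<longlongrightarrow> 0) (at 0)" by simp
      show "\<forall>\<^sub>F h in at 0. norm (max 0 h powr a / h) \<le> norm (\<bar>h\<bar> powr (a - 1)) * 1"
        by (rule always_eventually) (auto simp: max_def powr_diff divide_le_0_iff)
    qed
    then show ?thesis using 2 by (simp add: DERIV_def)
  next
    case 3
    have "((\<lambda>t. t powr a) has_real_derivative a * t powr (a - 1)) (at t)"
      using 3 by (rule has_real_derivative_powr)
    then have "((\<lambda>t. max 0 t powr a) has_real_derivative a * t powr (a - 1)) (at t)"
      by (rule has_field_derivative_transform_within_open[of _ _ _ "{0<..}"]) (use 3 in auto)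
    then show ?thesis using 3 by simp
  qed
qed

lemma continuous_pos_part_powr: "0 < a \<Longrightarrow> continuous_on UNIV (\<lambda>t::real. max 0 t powr a)"
  by (intro continuous_on_powr' continuous_intros) auto

lemma has_derivative_pos_part_sq:
  "((\<lambda>t::real. (max 0 t)\<^sup>2) has_real_derivative 2 * max 0 t) (at t)"
  using has_derivative_pos_part_powr[of 2 t] by simp

section \<open>The U-bound\<close>

text \<open>The Laplacian bound is available on {d > 1} only; starting at 2 leaves the gap that
  mollifying the test function consumes. A rational function of the squared positive part is C1 and
  its derivative decays fast enough for \<open>cutoff'_mult_le\<close>.\<close>

definition cutoff :: "real \<Rightarrow> real" where
  "cutoff t = (max 0 (t - 2))\<^sup>2 / (1 + (max 0 (t - 2))\<^sup>2)"

definition cutoff' :: "real \<Rightarrow> real" where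
  "cutoff' t = 2 * max 0 (t - 2) / (1 + (max 0 (t - 2))\<^sup>2)\<^sup>2"

lemma cutoff_deriv: "(cutoff has_real_derivative cutoff' t) (at t)"
proof -
  have sq: "((\<lambda>t. (max 0 (t - 2))\<^sup>2) has_real_derivative 2 * max 0 (t - 2)) (at t)"
  proof -
    have "((\<lambda>t. t - 2) has_real_derivative 1) (at t)" by (auto intro!: derivative_eq_intros)
    from DERIV_chain2[OF has_derivative_pos_part_sq this] show ?thesis by simp
  qed
  have pos: "1 + (max 0 (t - 2))\<^sup>2 \<noteq> 0" by (smt (verit) zero_le_power2)
  have "((\<lambda>t. (max 0 (t - 2))\<^sup>2 / (1 + (max 0 (t - 2))\<^sup>2)) has_real_derivative
      (2 * max 0 (t - 2) * (1 + (max 0 (t - 2))\<^sup>2) - (max 0 (t - 2))\<^sup>2 * (0 + 2 * max 0 (t - 2)))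
        / ((1 + (max 0 (t - 2))\<^sup>2) * (1 + (max 0 (t - 2))\<^sup>2))) (at t)"
    by (intro DERIV_divide DERIV_add DERIV_const sq pos)
  then show ?thesis
    unfolding cutoff_def[abs_def] cutoff'_def by (rule DERIV_cong) (simp add: power2_eq_square algebra_simps)
qed

lemma cutoff'_continuous: "continuous_on UNIV cutoff'"
  unfolding cutoff'_def[abs_def]
  by (intro continuous_intros) (smt (verit) zero_le_power2 power2_eq_square no_zero_divisors)

lemma cutoff_bounds: "0 \<le> cutoff t" "cutoff t \<le> 1" "t \<le> 2 \<Longrightarrow> cutoff t = 0" "t \<le> 2 \<Longrightarrow> cutoff' t = 0"
    "0 \<le> cutoff' t"
  by (auto simp: cutoff_def cutoff'_def divide_le_eq intro: add_nonneg_nonneg) (smt (verit) zero_le_power2)+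

lemma cutoff_ge_half: "3 \<le> t \<Longrightarrow> 1 / 2 \<le> cutoff t"
proof -
  assume t: "3 \<le> t"
  then have "1 \<le> (t - 2)\<^sup>2" using power_mono[of 1 "t - 2" 2] by simp
  then show ?thesis using t by (simp add: cutoff_def field_simps add_pos_nonneg)
qed

text \<open>Needed because the cutoff is multiplied by d^(\<theta>-1), which may be of the order of
  d, so its derivative has to decay at least like 1/t. With r = t - 2 this amounts to 2r(r + 2)
  \<le> 4(1 + r^2).\<close>

lemma cutoff'_mult_le: "cutoff' t * t \<le> 4"
proof (cases "t \<le> 2")
  case False
  let ?r = "t - 2" let ?q = "1 + ?r\<^sup>2"
  have q: "1 \<le> ?q" by simp
  have "0 \<le> (?r - 1)\<^sup>2" by simp
  then have "2 * ?r \<le> ?q" by (simp add: power2_eq_square algebra_simps)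
  then have "2 * ?r * t \<le> 4 * ?q" using False by (simp add: power2_eq_square algebra_simps)
  also have "\<dots> \<le> 4 * ?q\<^sup>2" using q self_le_power[of ?q 2] by simp
  finally show ?thesis using False q by (simp add: cutoff'_def divide_le_eq)
qed (simp add: cutoff_bounds)

text \<open>Strictly \<open>1 < \<theta>\<close>: then the power with exponent \<theta> of the
  positive part is C1 at 0, and the exponent of the logarithm is positive. The remaining case is
  split off in the final theorem.\<close>

locale drift_setting =
  fixes X :: "'k::finite \<Rightarrow> 'a::euclidean_space \<Rightarrow> 'a"
    and d :: "'a \<Rightarrow> real"
    and \<theta> \<beta> \<sigma> K \<epsilon> :: real
  assumes X_smooth: "\<And>i. smooth (X i)"
    and X_div: "\<And>i x. divergence (X i) x = 0"
    and d_nonneg: "\<And>x. 0 \<le> d x"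
    and d_L: "d \<in> classL X"
    and balls: "\<And>R. compact {x. d x \<le> R}"
    and theta: "1 < \<theta>" "\<theta> \<le> 2"
    and beta: "0 < \<beta>"
    and sigma: "1 \<le> \<sigma>"
    and grad_d: "AE x in lborel. 1 / \<sigma> \<le> grad_norm X d x \<and> grad_norm X d x \<le> 1"
    and K: "0 \<le> K"
    and eps: "0 \<le> \<epsilon>" "\<epsilon> < 1 / \<sigma>\<^sup>2"
    and lap_d: "distr_laplacian_le X {x. d x > 1} d
                  (\<lambda>x. K + \<beta> * \<theta> * \<epsilon> * d x powr (\<theta> - 1))"
begin

definition weight :: "real \<Rightarrow> real" where
  "weight t = exp (- \<beta> * t powr \<theta>)"

text \<open>The profile of the test function \<open>u\<^sup>2 G(d)\<close> behind the U-bound.\<close>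

definition G :: "real \<Rightarrow> real" where
  "G t = cutoff t * (t powr (\<theta> - 1) * weight t)"

definition G' :: "real \<Rightarrow> real" where
  "G' t = (cutoff' t * t powr (\<theta> - 1) + cutoff t * ((\<theta> - 1) * t powr (\<theta> - 2)
      - \<beta> * \<theta> * (t powr (\<theta> - 1))\<^sup>2)) * weight t"

lemma weight_deriv:
  assumes "t > 0"
  shows "(weight has_real_derivative - \<beta> * \<theta> * t powr (\<theta> - 1) * weight t) (at t)"
proof -
  have "((\<lambda>t. - \<beta> * t powr \<theta>) has_real_derivative - \<beta> * (\<theta> * t powr (\<theta> - 1))) (at t)"
    by (rule DERIV_cmult[OF has_real_derivative_powr[OF assms]])
  from DERIV_chain2[OF DERIV_exp this] show ?thesis
    unfolding weight_def[abs_def] by (simp add: mult_ac)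
qed

lemma weight_continuous: "continuous_on {1<..} weight"
  unfolding weight_def[abs_def] by (intro continuous_intros) auto

text \<open>The powers of t need not be differentiable at 0, but the cutoff vanishes there; the
  product rule is applied only for t \<ge> 2.\<close>

lemma G_deriv: "(G has_real_derivative G' t) (at t)"
proof (cases "t < 2")
  case True
  have "((\<lambda>_. 0) has_real_derivative 0) (at t)" by simp
  then have "(G has_real_derivative 0) (at t)"
    by (rule has_field_derivative_transform_within_open[of _ _ _ "{..<2}"])
       (use True in \<open>auto simp: G_def cutoff_bounds\<close>)
  then show ?thesis using True by (simp add: G'_def cutoff_bounds)
next
  case False
  then have "t > 0" by simp
  note p = has_real_derivative_powr[OF this, of "\<theta> - 1"]
  have "((\<lambda>t. cutoff t * (t powr (\<theta> - 1) * weight t)) has_real_derivative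
      cutoff' t * (t powr (\<theta> - 1) * weight t) +
      ((\<theta> - 1) * t powr (\<theta> - 1 - 1) * weight t + - \<beta> * \<theta> * t powr (\<theta> - 1) * weight t * t powr (\<theta> - 1)) * cutoff t) (at t)"
    by (rule DERIV_mult[OF cutoff_deriv DERIV_mult[OF p weight_deriv[OF \<open>t > 0\<close>]]])
  then show ?thesis unfolding G_def[abs_def]
    by (rule DERIV_cong) (simp add: G'_def power2_eq_square algebra_simps)
qed

text \<open>Two overlapping open pieces avoid the powers near 0: on the left one G' is 0, on the
  right one it is built from continuous expressions.\<close>

lemma G'_continuous: "continuous_on UNIV G'"
proof -
  have 1: "continuous_on {..<2} G'"
    by (rule continuous_on_eq[of _ "\<lambda>_. 0"]) (auto simp: G'_def cutoff_bounds)
  have cutc: "continuous_on S cutoff" for S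
    using cutoff_deriv DERIV_isCont by (blast intro: continuous_at_imp_continuous_on)
  have 2: "continuous_on {1<..} G'"
    unfolding G'_def[abs_def]
    by (intro continuous_intros cutc weight_continuous continuous_on_subset[OF cutoff'_continuous]) auto
  have "{..<2::real} \<union> {1<..} = UNIV" by auto
  then show ?thesis using continuous_on_open_Un[OF _ _ 1 2] by simp
qed

abbreviation "dp x \<equiv> d x powr (\<theta> - 1)"
abbreviation "dw x \<equiv> weight (d x)"

lemma d_cont: "continuous_on UNIV d"
  by (rule classL_continuous[OF d_L])

lemma dp_cont: "continuous_on UNIV dp"
  using d_nonneg theta by (intro continuous_on_powr' continuous_intros d_cont) auto

lemma dw_cont: "continuous_on UNIV dw"
  unfolding weight_def using d_nonneg theta by (intro continuous_intros continuous_on_powr' d_cont) auto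

lemma dw_pos: "0 < dw x"
  by (simp add: weight_def)

definition \<delta> :: real where "\<delta> = \<beta> * \<theta> * (1 / \<sigma>\<^sup>2 - \<epsilon>)"

lemma \<delta>_pos: "0 < \<delta>"
  using beta theta eps by (simp add: \<delta>_def)

text \<open>The pointwise estimate for the integrand obtained by testing the Laplacian bound with \<open>u\<^sup>2 G(d)\<close>;
  \<open>s\<close>, \<open>n\<close> and \<open>c\<close> stand for \<open>|\<nabla>d|\<^sup>2\<close>, \<open>|\<nabla>u|\<close> and \<open>\<nabla>d \<cdot> \<nabla>u\<close>.\<close>

lemma U_bound_pointwise:
  fixes s n c u t :: real
  assumes t: "0 \<le> t" and s: "1 / \<sigma>\<^sup>2 \<le> s" "s \<le> 1" and n: "0 \<le> n" and c: "\<bar>c\<bar> \<le> n"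
  shows "(K + \<beta> * \<theta> * \<epsilon> * t powr (\<theta> - 1)) * (u\<^sup>2 * G t) + (2 * u * G t * c + u\<^sup>2 * G' t * s)
      \<le> weight t * (- (\<delta> / 2) * (cutoff t * (t powr (\<theta> - 1))\<^sup>2 * u\<^sup>2) + 4 / \<delta> * n\<^sup>2 + (K\<^sup>2 / \<delta> + 5) * u\<^sup>2)"
proof -
  let ?p = "t powr (\<theta> - 1)" and ?k = "cutoff t" and ?w = "weight t"
  have k: "0 \<le> ?k" "?k \<le> 1" by (auto simp: cutoff_bounds)
  have p: "0 \<le> ?p" by simp
  have s0: "0 \<le> s" using s(1) by (meson order_trans zero_le_divide_1_iff zero_le_power2)
  have d: "\<delta> > 0" by (rule \<delta>_pos)
  \<comment> \<open>\<open>A\<close> and \<open>B\<close> are Young inequalities, each charging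
    \<delta>/4 of the coercive term. Of the margin \<delta> that \<open>D\<close> leaves against the
    \<epsilon>-term, half survives.\<close>
  have A: "?k * (K * ?p) * u\<^sup>2 \<le> (\<delta> / 4 * (?k * ?p\<^sup>2) + K\<^sup>2 / \<delta>) * u\<^sup>2"
  proof (rule mult_right_mono)
    have "0 \<le> (\<delta> / 2 * ?p - K)\<^sup>2" by simp
    then have "\<delta> * (K * ?p) \<le> \<delta>\<^sup>2 / 4 * ?p\<^sup>2 + K\<^sup>2" by (simp add: power2_eq_square algebra_simps)
    then have "K * ?p \<le> \<delta> / 4 * ?p\<^sup>2 + K\<^sup>2 / \<delta>" using d by (simp add: field_simps power2_eq_square)
    then have "?k * (K * ?p) \<le> ?k * (\<delta> / 4 * ?p\<^sup>2 + K\<^sup>2 / \<delta>)" using k by (intro mult_left_mono)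
    also have "\<dots> \<le> \<delta> / 4 * (?k * ?p\<^sup>2) + 1 * (K\<^sup>2 / \<delta>)"
      using mult_right_mono[OF k(2), of "K\<^sup>2 / \<delta>"] d by (simp add: algebra_simps)
    finally show "?k * (K * ?p) \<le> \<delta> / 4 * (?k * ?p\<^sup>2) + K\<^sup>2 / \<delta>" by simp
  qed simp
  have B: "2 * u * (?k * ?p) * c \<le> \<delta> / 4 * (?k * ?p\<^sup>2) * u\<^sup>2 + 4 / \<delta> * n\<^sup>2"
  proof -
    have "0 \<le> (\<delta> / 2 * (?p * \<bar>u\<bar>) - 2 * n)\<^sup>2" by simp
    then have "\<delta> * (2 * \<bar>u\<bar> * ?p * n) \<le> \<delta>\<^sup>2 / 4 * (?p\<^sup>2 * u\<^sup>2) + 4 * n\<^sup>2"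
      by (simp add: power2_diff power_mult_distrib power_divide algebra_simps)
    then have *: "2 * \<bar>u\<bar> * ?p * n \<le> \<delta> / 4 * (?p\<^sup>2 * u\<^sup>2) + 4 / \<delta> * n\<^sup>2"
      using d by (simp add: field_simps power2_eq_square)
    have "u * c \<le> \<bar>u\<bar> * \<bar>c\<bar>" using abs_ge_self[of "u * c"] by (simp add: abs_mult)
    also have "\<dots> \<le> \<bar>u\<bar> * n" using c by (rule mult_left_mono) simp
    finally have "u * c \<le> \<bar>u\<bar> * n" .
    then have "2 * u * (?k * ?p) * c \<le> ?k * (2 * \<bar>u\<bar> * ?p * n)"
      using mult_left_mono[of "u * c" "\<bar>u\<bar> * n" "2 * (?k * ?p)"] k p by (simp add: mult_ac)
    also have "\<dots> \<le> ?k * (\<delta> / 4 * (?p\<^sup>2 * u\<^sup>2) + 4 / \<delta> * n\<^sup>2)" using * k by (intro mult_left_mono)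
    also have "\<dots> \<le> \<delta> / 4 * (?k * ?p\<^sup>2) * u\<^sup>2 + 1 * (4 / \<delta> * n\<^sup>2)"
      using mult_right_mono[OF k(2), of "4 / \<delta> * n\<^sup>2"] d by (simp add: algebra_simps)
    finally show ?thesis by simp
  qed
  \<comment> \<open>5 = 4 + 1. For t > 2 and \<theta> \<le> 2 the power t^(\<theta>-1) is at most t,
    so the first summand is bounded by \<open>cutoff'_mult_le\<close>, and (\<theta>-1)
    t^(\<theta>-2) is at most 1. For t \<le> 2 everything vanishes.\<close>
  have C: "u\<^sup>2 * (cutoff' t * ?p + ?k * ((\<theta> - 1) * t powr (\<theta> - 2))) * s \<le> 5 * u\<^sup>2"
  proof -
    have "cutoff' t * ?p \<le> 4 \<and> ?k * ((\<theta> - 1) * t powr (\<theta> - 2)) \<le> 1"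
    proof (cases "t \<le> 2")
      case False
      have "?p \<le> t powr 1" using False theta by (intro powr_mono) auto
      then have "cutoff' t * ?p \<le> cutoff' t * t" using False by (intro mult_left_mono cutoff_bounds) auto
      moreover have "t powr (\<theta> - 2) \<le> t powr 0" using False theta by (intro powr_mono) auto
      then have "?k * ((\<theta> - 1) * t powr (\<theta> - 2)) \<le> 1 * (1 * 1)"
        using k theta False by (intro mult_mono mult_nonneg_nonneg) auto
      ultimately show ?thesis using cutoff'_mult_le[of t] by auto
    qed (simp add: cutoff_bounds)
    then have le5: "cutoff' t * ?p + ?k * ((\<theta> - 1) * t powr (\<theta> - 2)) \<le> 5" by simp
    have "0 \<le> cutoff' t * ?p + ?k * ((\<theta> - 1) * t powr (\<theta> - 2))"
      using theta by (intro add_nonneg_nonneg mult_nonneg_nonneg cutoff_bounds) auto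
    then have "(cutoff' t * ?p + ?k * ((\<theta> - 1) * t powr (\<theta> - 2))) * s \<le> 5 * 1"
      using le5 s s0 by (intro mult_mono) auto
    from mult_left_mono[OF this, of "u\<^sup>2"] show ?thesis by (simp add: mult_ac)
  qed
  \<comment> \<open>This term carries a minus sign, so it is the lower bound on |\<nabla>d|^2 that
    counts.\<close>
  have D: "- (\<beta> * \<theta> * (?k * ?p\<^sup>2 * u\<^sup>2) * s) \<le> - (\<beta> * \<theta> / \<sigma>\<^sup>2 * (?k * ?p\<^sup>2 * u\<^sup>2))"
    using mult_left_mono[OF s(1), of "\<beta> * \<theta> * (?k * ?p\<^sup>2 * u\<^sup>2)"] beta theta k by simp
  have "(K + \<beta> * \<theta> * \<epsilon> * ?p) * (u\<^sup>2 * G t) + (2 * u * G t * c + u\<^sup>2 * G' t * s)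
      = ?w * (?k * (K * ?p) * u\<^sup>2 + \<beta> * \<theta> * \<epsilon> * (?k * ?p\<^sup>2 * u\<^sup>2) + 2 * u * (?k * ?p) * c
        + u\<^sup>2 * (cutoff' t * ?p + ?k * ((\<theta> - 1) * t powr (\<theta> - 2))) * s - \<beta> * \<theta> * (?k * ?p\<^sup>2 * u\<^sup>2) * s)"
    by (simp add: G_def G'_def power2_eq_square algebra_simps)
  also have "\<dots> \<le> ?w * (- (\<delta> / 2) * (?k * ?p\<^sup>2 * u\<^sup>2) + 4 / \<delta> * n\<^sup>2 + (K\<^sup>2 / \<delta> + 5) * u\<^sup>2)"
  proof (rule mult_left_mono)
    have "\<beta> * \<theta> * \<epsilon> * (?k * ?p\<^sup>2 * u\<^sup>2) - \<beta> * \<theta> / \<sigma>\<^sup>2 * (?k * ?p\<^sup>2 * u\<^sup>2) = - \<delta> * (?k * ?p\<^sup>2 * u\<^sup>2)"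
      by (simp add: \<delta>_def algebra_simps)
    then show "?k * (K * ?p) * u\<^sup>2 + \<beta> * \<theta> * \<epsilon> * (?k * ?p\<^sup>2 * u\<^sup>2) + 2 * u * (?k * ?p) * c
        + u\<^sup>2 * (cutoff' t * ?p + ?k * ((\<theta> - 1) * t powr (\<theta> - 2))) * s - \<beta> * \<theta> * (?k * ?p\<^sup>2 * u\<^sup>2) * s
      \<le> - (\<delta> / 2) * (?k * ?p\<^sup>2 * u\<^sup>2) + 4 / \<delta> * n\<^sup>2 + (K\<^sup>2 / \<delta> + 5) * u\<^sup>2"
      using A B C D unfolding distrib_right by (simp add: mult.assoc)
  qed (simp add: weight_def)
  finally show ?thesis .
qed

end

lemma DERIV_continuous_on_UNIV:
  "(\<And>t. (F has_real_derivative F' t) (at t)) \<Longrightarrow> continuous_on UNIV F"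
  using DERIV_isCont by (blast intro: continuous_at_imp_continuous_on)

lemma ennreal_linear:
  "0 \<le> a \<Longrightarrow> 0 \<le> x \<Longrightarrow> 0 \<le> y \<Longrightarrow> ennreal (a * x + y) = ennreal a * ennreal x + ennreal y"
  by (simp add: ennreal_mult)

context drift_setting
begin

abbreviation "grad2 f x \<equiv> (grad_norm X f x)\<^sup>2"

lemma grad2_d_AE: "AE x in lborel. 1 / \<sigma>\<^sup>2 \<le> grad2 d x \<and> grad2 d x \<le> 1"
  using grad_d
proof eventually_elim
  case (elim x)
  have "(1 / \<sigma>)\<^sup>2 \<le> (grad_norm X d x)\<^sup>2" using elim sigma by (intro power_mono) auto
  moreover have "(grad_norm X d x)\<^sup>2 \<le> 1\<^sup>2" using elim grad_norm_nonneg by (intro power_mono) auto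
  ultimately show ?case by (simp add: power_divide)
qed

lemma dw_Linf_loc: "dw \<in> Linf_loc"
  by (rule continuous_Linf_loc[OF dw_cont])

lemma cutoff_d_cont: "continuous_on UNIV (\<lambda>x. cutoff (d x))"
  by (rule continuous_on_compose2[OF DERIV_continuous_on_UNIV[OF cutoff_deriv] d_cont]) auto

text \<open>Compact support makes all integrals finite, so the integral of \<open>?T\<close>,
  nonnegative by the weak Laplacian bound tested with u^2 G(d), may be added before the integrands
  are compared. The result is restated with nonnegative integrals, which may be infinite once the
  support restriction is dropped.\<close>

lemma U_bound_compact_support:
  assumes u: "u \<in> classL X" and supp: "\<And>x. R < d x \<Longrightarrow> u x = 0"
  shows "(\<integral>\<^sup>+x. ennreal (dw x * (\<delta> / 2 * (cutoff (d x) * (dp x)\<^sup>2 * (u x)\<^sup>2))) \<partial>lborel)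
    \<le> (\<integral>\<^sup>+x. ennreal (dw x * (4 / \<delta> * grad2 u x + (K\<^sup>2 / \<delta> + 5) * (u x)\<^sup>2)) \<partial>lborel)"
proof -
  obtain r where r: "\<And>x. d x \<le> R \<Longrightarrow> norm x \<le> r"
    using compact_imp_bounded[OF balls[of R]] unfolding bounded_iff by blast
  have u0: "u x = 0" if "r < norm x" for x using supp[of x] r[of x] that by force
  let ?E = "\<lambda>i. distr_deriv (X i) d" and ?U = "\<lambda>i. distr_deriv (X i) u"
  have E: "loc_deriv (X i) d (?E i)" and U: "loc_deriv (X i) u (?U i)" for i
    by (intro loc_deriv_distr_deriv d_L u)+
  have EL: "?E i \<in> Linf_loc" and UL: "?U i \<in> Linf_loc" for i
    by (rule loc_deriv_Linf_loc[OF E], rule loc_deriv_Linf_loc[OF U])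
  have cu: "continuous_on UNIV u" by (rule classL_continuous[OF u])
  have cG: "continuous_on UNIV (\<lambda>x. G (d x))"
    by (rule continuous_on_compose2[OF DERIV_continuous_on_UNIV[OF G_deriv] d_cont]) auto
  let ?\<phi> = "\<lambda>x. (u x)\<^sup>2 * G (d x)"
  let ?P = "\<lambda>i x. 2 * u x * ?U i x * G (d x) + (u x)\<^sup>2 * (G' (d x) * ?E i x)"
  let ?h = "\<lambda>x. K + \<beta> * \<theta> * \<epsilon> * dp x"
  have c\<phi>: "continuous_on UNIV ?\<phi>" by (intro continuous_intros cu cG)
  have sq: "((\<lambda>t. t^2 :: real) has_real_derivative 2 * t) (at t)" for t
    by (auto intro!: derivative_eq_intros)
  have usq: "loc_deriv (X i) (\<lambda>x. (u x)\<^sup>2) (\<lambda>x. 2 * u x * ?U i x)" for i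
    by (rule loc_deriv_compose[OF X_smooth X_div cu U sq]) (intro continuous_intros)
  have Gd: "loc_deriv (X i) (\<lambda>x. G (d x)) (\<lambda>x. G' (d x) * ?E i x)" for i
    by (rule loc_deriv_compose[OF X_smooth X_div d_cont E G_deriv G'_continuous])
  have P: "loc_deriv (X i) ?\<phi> (?P i)" for i
    by (rule loc_deriv_mult[OF X_smooth X_div _ usq cG Gd]) (intro continuous_intros cu)
  have hL: "?h \<in> Linf_loc" by (intro continuous_Linf_loc continuous_intros dp_cont)
  let ?T = "\<lambda>x. ?h x * ?\<phi> x + (\<Sum>i\<in>UNIV. ?E i x * ?P i x)"
  have T0: "0 \<le> (LBINT x. ?T x)"
  proof (rule weak_laplacian_bound[OF X_smooth X_div d_cont E lap_d hL c\<phi> _ _ _ _ P, of r 2])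
    show "0 \<le> ?\<phi> x" for x by (simp add: G_def weight_def cutoff_bounds)
    show "?\<phi> x = 0" if "d x \<le> 2" for x using that by (simp add: G_def cutoff_bounds)
  qed (auto simp: u0)
  let ?A = "\<lambda>x. dw x * (\<delta> / 2 * (cutoff (d x) * (dp x)\<^sup>2 * (u x)\<^sup>2))"
  let ?B = "\<lambda>x. indicator (cball 0 r) x * (dw x * (4 / \<delta> * grad2 u x + (K\<^sup>2 / \<delta> + 5) * (u x)\<^sup>2))"
  have AT: "AE x in lborel. ?A x + ?T x \<le> ?B x"
    using grad2_d_AE
  proof eventually_elim
    case (elim x)
    let ?c = "\<Sum>i\<in>UNIV. ?E i x * ?U i x"
    show ?case
    proof (cases "norm x \<le> r")
      case True
      have "?c\<^sup>2 \<le> grad2 d x * grad2 u x" unfolding grad_norm_sq by (rule Cauchy_Schwarz_ineq_sum)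
      also have "\<dots> \<le> 1 * grad2 u x" using elim by (intro mult_right_mono) auto
      finally have c: "\<bar>?c\<bar> \<le> grad_norm X u x"
        using grad_norm_nonneg[of X u x] by (simp add: abs_le_square_iff[symmetric])
      have "(\<Sum>i\<in>UNIV. ?E i x * ?P i x) = 2 * u x * G (d x) * ?c + (u x)\<^sup>2 * G' (d x) * grad2 d x"
        unfolding grad_norm_sq sum_distrib_left sum.distrib[symmetric]
        by (intro sum.cong) (simp_all add: power2_eq_square algebra_simps)
      then have "?T x \<le> dw x * (- (\<delta> / 2) * (cutoff (d x) * (dp x)\<^sup>2 * (u x)\<^sup>2) + 4 / \<delta> * grad2 u x + (K\<^sup>2 / \<delta> + 5) * (u x)\<^sup>2)"
        using U_bound_pointwise[OF d_nonneg _ _ grad_norm_nonneg c, of "grad2 d x" x "u x"] elim by simp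
      then have "?A x + ?T x \<le> dw x * (4 / \<delta> * grad2 u x + (K\<^sup>2 / \<delta> + 5) * (u x)\<^sup>2)" by (simp add: algebra_simps)
      then show ?thesis using True by simp
    qed (simp add: u0)
  qed
  have iA: "integrable lborel ?A"
    by (rule Linf_loc_integrable[of _ r]) (auto intro!: continuous_Linf_loc continuous_intros dw_cont dp_cont cu cutoff_d_cont simp: u0)
  have iT: "integrable lborel ?T"
  proof (rule Linf_loc_integrable[of _ r])
    have "?P i \<in> Linf_loc" for i
      using P loc_deriv_Linf_loc by blast
    then show "?T \<in> Linf_loc"
      by (rule Linf_loc_add[OF Linf_loc_mult[OF hL continuous_Linf_loc[OF c\<phi>]] Linf_loc_sum[OF Linf_loc_mult[OF EL]]])
  qed (simp add: u0)
  have gL: "grad2 u \<in> Linf_loc"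
    unfolding grad_norm_sq unfolding power2_eq_square by (intro Linf_loc_sum Linf_loc_mult UL)
  have iB: "integrable lborel ?B"
    by (intro Linf_loc_integrable_cball Linf_loc_mult Linf_loc_add Linf_loc_const dw_Linf_loc gL
        continuous_Linf_loc[OF continuous_on_power[OF cu]])
  have B0: "0 \<le> ?B x" for x
    using \<delta>_pos dw_pos[of x] by (intro mult_nonneg_nonneg add_nonneg_nonneg) auto
  have A0: "0 \<le> ?A x" for x
    using \<delta>_pos dw_pos[of x] by (intro mult_nonneg_nonneg cutoff_bounds) auto
  have "(LBINT x. ?A x) \<le> (LBINT x. ?A x + ?T x)" using iA iT T0 by simp
  also have "\<dots> \<le> (LBINT x. ?B x)"
    by (rule integral_mono_AE[OF Bochner_Integration.integrable_add[OF iA iT] iB AT])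
  finally have le: "(LBINT x. ?A x) \<le> (LBINT x. ?B x)" .
  have "(\<integral>\<^sup>+x. ennreal (?A x) \<partial>lborel) = ennreal (LBINT x. ?A x)"
    by (rule nn_integral_eq_integral[OF iA]) (use A0 in auto)
  also have "\<dots> \<le> ennreal (LBINT x. ?B x)" using le by (rule ennreal_leI)
  also have "\<dots> = (\<integral>\<^sup>+x. ennreal (?B x) \<partial>lborel)"
    by (rule nn_integral_eq_integral[OF iB, symmetric]) (use B0 in auto)
  also have "\<dots> \<le> (\<integral>\<^sup>+x. ennreal (dw x * (4 / \<delta> * grad2 u x + (K\<^sup>2 / \<delta> + 5) * (u x)\<^sup>2)) \<partial>lborel)"
    by (intro nn_integral_mono ennreal_leI mult_left_le_one_le mult_nonneg_nonneg add_nonneg_nonneg)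
       (use \<delta>_pos less_imp_le[OF dw_pos] in auto)
  finally show ?thesis .
qed

text \<open>Serves both multiplications by a function of d that follow: the truncation at infinity
  and the square root of the density. |\<nabla>d| \<le> 1 removes the gradient of d from the
  bound.\<close>

lemma classL_mult_compose_d:
  assumes f: "f \<in> classL X"
    and F: "\<And>t. (F has_real_derivative F' t) (at t)" "continuous_on UNIV F'"
  shows "(\<lambda>x. f x * F (d x)) \<in> classL X"
    and "AE x in lborel. grad2 (\<lambda>x. f x * F (d x)) x
      \<le> 2 * grad2 f x * (F (d x))\<^sup>2 + 2 * (f x)\<^sup>2 * (F' (d x))\<^sup>2"
proof -
  let ?E = "\<lambda>i. distr_deriv (X i) d" and ?F = "\<lambda>i. distr_deriv (X i) f"
  let ?V = "\<lambda>i x. ?F i x * F (d x) + f x * (F' (d x) * ?E i x)"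
  have cf: "continuous_on UNIV f" by (rule classL_continuous[OF f])
  have cF: "continuous_on UNIV (\<lambda>x. F (d x))"
    by (rule continuous_on_compose2[OF DERIV_continuous_on_UNIV[OF F(1)] d_cont]) auto
  have c: "continuous_on UNIV (\<lambda>x. f x * F (d x))" by (intro continuous_intros cf cF)
  have V: "loc_deriv (X i) (\<lambda>x. f x * F (d x)) (?V i)" for i
    by (rule loc_deriv_mult[OF X_smooth X_div cf loc_deriv_distr_deriv[OF f] cF
          loc_deriv_compose[OF X_smooth X_div d_cont loc_deriv_distr_deriv[OF d_L] F]])
  show "(\<lambda>x. f x * F (d x)) \<in> classL X" using c V by (auto simp: classL_iff)
  have gAE: "AE x in lborel. grad2 (\<lambda>x. f x * F (d x)) x = (\<Sum>i\<in>UNIV. (?V i x)\<^sup>2)"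
    by (rule grad_norm_sq_AE[OF c V])
  show "AE x in lborel. grad2 (\<lambda>x. f x * F (d x)) x
      \<le> 2 * grad2 f x * (F (d x))\<^sup>2 + 2 * (f x)\<^sup>2 * (F' (d x))\<^sup>2"
    using gAE grad2_d_AE
  proof eventually_elim
    case (elim x)
    have "grad2 (\<lambda>x. f x * F (d x)) x \<le> (\<Sum>i\<in>UNIV. 2 * (?F i x * F (d x))\<^sup>2 + 2 * (f x * (F' (d x) * ?E i x))\<^sup>2)"
      unfolding elim(1)
    proof (rule sum_mono)
      have "(a + b)\<^sup>2 \<le> 2 * a\<^sup>2 + 2 * b\<^sup>2" for a b :: real
        using zero_le_power2[of "a - b"] by (simp add: power2_eq_square algebra_simps)
      then show "(?V i x)\<^sup>2 \<le> 2 * (?F i x * F (d x))\<^sup>2 + 2 * (f x * (F' (d x) * ?E i x))\<^sup>2" for i .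
    qed
    also have "\<dots> = 2 * grad2 f x * (F (d x))\<^sup>2 + 2 * (f x)\<^sup>2 * (F' (d x))\<^sup>2 * grad2 d x"
      unfolding grad_norm_sq by (simp add: sum.distrib sum_distrib_left power_mult_distrib mult_ac)
    also have "\<dots> \<le> 2 * grad2 f x * (F (d x))\<^sup>2 + 2 * (f x)\<^sup>2 * (F' (d x))\<^sup>2 * 1"
      using elim(2) by (intro add_left_mono mult_left_mono) auto
    finally show ?case by simp
  qed
qed

text \<open>Truncation at infinity and Fatou's lemma. Fatou needs only a bound uniform in n, so the
  truncation may keep a fixed cost, the 32/\<delta> in the coefficient of f^2.\<close>

lemma U_bound_cutoff:
  assumes f: "f \<in> classL X"
  shows "(\<integral>\<^sup>+x. ennreal (dw x * (\<delta> / 2 * (cutoff (d x) * (dp x)\<^sup>2 * (f x)\<^sup>2))) \<partial>lborel)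
    \<le> (\<integral>\<^sup>+x. ennreal (dw x * (8 / \<delta> * grad2 f x + (32 / \<delta> + K\<^sup>2 / \<delta> + 5) * (f x)\<^sup>2)) \<partial>lborel)"
    (is "_ \<le> ?rhs")
proof -
  have cf: "continuous_on UNIV f" by (rule classL_continuous[OF f])
  \<comment> \<open>Squared in order to be C1. On the range of d the function is at most 1 and its
    derivative at most 2 in absolute value; the cost is therefore (4/\<delta>) * 2 * 4 =
    32/\<delta>.\<close>
  define \<psi> where "\<psi> n t = (max 0 (1 - t / real (Suc n)))\<^sup>2" for n t
  define \<psi>' where "\<psi>' n t = - (1 / real (Suc n)) * (2 * max 0 (1 - t / real (Suc n)))" for n t
  have \<psi>d: "(\<psi> n has_real_derivative \<psi>' n t) (at t)" for n t
  proof -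
    have "((\<lambda>t. 1 - t / real (Suc n)) has_real_derivative - (1 / real (Suc n))) (at t)"
      by (auto intro!: derivative_eq_intros simp del: of_nat_Suc)
    from DERIV_chain2[OF has_derivative_pos_part_sq this] show ?thesis
      unfolding \<psi>_def[abs_def] \<psi>'_def by (simp add: mult.commute)
  qed
  have \<psi>'c: "continuous_on UNIV (\<psi>' n)" for n
    unfolding \<psi>'_def[abs_def] by (intro continuous_intros) auto
  have \<psi>c: "continuous_on UNIV (\<lambda>x. \<psi> n (d x))" for n
    unfolding \<psi>_def by (intro continuous_intros d_cont) auto
  have \<psi>b: "0 \<le> \<psi> n (d x)" "\<psi> n (d x) \<le> 1" "(\<psi> n (d x))\<^sup>2 \<le> 1" "(\<psi>' n (d x))\<^sup>2 \<le> 4" for n x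
  proof -
    let ?m = "max 0 (1 - d x / real (Suc n))"
    have m: "0 \<le> ?m" "?m \<le> 1" using d_nonneg by auto
    show *: "0 \<le> \<psi> n (d x)" "\<psi> n (d x) \<le> 1" using m power_mono[of ?m 1 2] by (auto simp: \<psi>_def)
    show "(\<psi> n (d x))\<^sup>2 \<le> 1" using * power_mono[of "\<psi> n (d x)" 1 2] by simp
    have "1 / real (Suc n) \<le> 1" by simp
    then have "\<bar>\<psi>' n (d x)\<bar> \<le> 1 * (2 * 1)"
      unfolding \<psi>'_def abs_mult using m by (intro mult_mono) auto
    then have "\<bar>\<psi>' n (d x)\<bar>\<^sup>2 \<le> 2\<^sup>2" by (intro power_mono) auto
    then show "(\<psi>' n (d x))\<^sup>2 \<le> 4" by simp
  qed
  define u where "u n x = f x * \<psi> n (d x)" for n x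
  have cu: "continuous_on UNIV (u n)" for n unfolding u_def by (intro continuous_intros cf \<psi>c)
  note uX = classL_mult_compose_d[OF f \<psi>d \<psi>'c, folded u_def]
  have u0: "u n x = 0" if "real (Suc n) < d x" for n x
  proof -
    have "1 \<le> d x / real (Suc n)" using that by (simp add: le_divide_eq del: of_nat_Suc)
    then show ?thesis by (simp add: u_def \<psi>_def del: of_nat_Suc)
  qed
  have usq: "(u n x)\<^sup>2 \<le> (f x)\<^sup>2" for n x
    using mult_left_mono[OF \<psi>b(3), of "(f x)\<^sup>2"] by (simp add: u_def power_mult_distrib)
  have bound: "(\<integral>\<^sup>+x. ennreal (dw x * (\<delta> / 2 * (cutoff (d x) * (dp x)\<^sup>2 * (u n x)\<^sup>2))) \<partial>lborel) \<le> ?rhs" for n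
  proof -
    have "AE x in lborel. dw x * (4 / \<delta> * grad2 (u n) x + (K\<^sup>2 / \<delta> + 5) * (u n x)\<^sup>2)
        \<le> dw x * (8 / \<delta> * grad2 f x + (32 / \<delta> + K\<^sup>2 / \<delta> + 5) * (f x)\<^sup>2)"
      using uX(2)[of n]
    proof eventually_elim
      case (elim x)
      note elim
      also have "2 * grad2 f x * (\<psi> n (d x))\<^sup>2 + 2 * (f x)\<^sup>2 * (\<psi>' n (d x))\<^sup>2
          \<le> 2 * grad2 f x * 1 + 2 * (f x)\<^sup>2 * 4"
        by (intro add_mono mult_left_mono \<psi>b) auto
      finally have "4 / \<delta> * grad2 (u n) x \<le> 4 / \<delta> * (2 * grad2 f x + 8 * (f x)\<^sup>2)"
        using \<delta>_pos by (intro mult_left_mono) auto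
      moreover have "(K\<^sup>2 / \<delta> + 5) * (u n x)\<^sup>2 \<le> (K\<^sup>2 / \<delta> + 5) * (f x)\<^sup>2"
        using \<delta>_pos by (intro mult_left_mono usq) auto
      ultimately have "4 / \<delta> * grad2 (u n) x + (K\<^sup>2 / \<delta> + 5) * (u n x)\<^sup>2
          \<le> 8 / \<delta> * grad2 f x + (32 / \<delta> + K\<^sup>2 / \<delta> + 5) * (f x)\<^sup>2"
        by (simp add: algebra_simps)
      then show ?case using dw_pos[of x] by (intro mult_left_mono) auto
    qed
    then have "(\<integral>\<^sup>+x. ennreal (dw x * (4 / \<delta> * grad2 (u n) x + (K\<^sup>2 / \<delta> + 5) * (u n x)\<^sup>2)) \<partial>lborel) \<le> ?rhs"
      by (intro nn_integral_mono_AE) (auto elim!: eventually_mono intro: ennreal_leI)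
    with U_bound_compact_support[OF uX(1) u0] show ?thesis by (rule order_trans)
  qed
  let ?a = "\<lambda>n x. ennreal (dw x * (\<delta> / 2 * (cutoff (d x) * (dp x)\<^sup>2 * (u n x)\<^sup>2)))"
  have lim: "(\<lambda>n. ?a n x) \<longlonglongrightarrow> ennreal (dw x * (\<delta> / 2 * (cutoff (d x) * (dp x)\<^sup>2 * (f x)\<^sup>2)))" for x
  proof -
    have "(\<lambda>n. d x * (1 / real (Suc n))) \<longlonglongrightarrow> d x * 0"
      using LIMSEQ_Suc[OF lim_1_over_n] by (intro tendsto_mult tendsto_const) simp
    then have l0: "(\<lambda>n. d x / real (Suc n)) \<longlonglongrightarrow> 0" by simp
    have "(\<lambda>n. u n x) \<longlonglongrightarrow> f x * (max 0 (1 - 0))\<^sup>2"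
      unfolding u_def \<psi>_def by (intro tendsto_intros l0)
    then have "(\<lambda>n. u n x) \<longlonglongrightarrow> f x" by simp
    then show ?thesis by (intro tendsto_intros) auto
  qed
  have "(\<integral>\<^sup>+x. ennreal (dw x * (\<delta> / 2 * (cutoff (d x) * (dp x)\<^sup>2 * (f x)\<^sup>2))) \<partial>lborel)
      = (\<integral>\<^sup>+x. liminf (\<lambda>n. ?a n x) \<partial>lborel)"
    by (intro nn_integral_cong lim_imp_Liminf[symmetric] lim) simp
  also have "\<dots> \<le> liminf (\<lambda>n. \<integral>\<^sup>+x. ?a n x \<partial>lborel)"
  proof (rule nn_integral_liminf)
    show "?a n \<in> borel_measurable lborel" for n
    proof -
      have "continuous_on UNIV (\<lambda>x. dw x * (\<delta> / 2 * (cutoff (d x) * (dp x)\<^sup>2 * (u n x)\<^sup>2)))"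
        by (intro continuous_intros dw_cont cutoff_d_cont dp_cont cu)
      then show ?thesis using borel_measurable_continuous_onI by fastforce
    qed
  qed
  also have "\<dots> \<le> limsup (\<lambda>n. \<integral>\<^sup>+x. ?a n x \<partial>lborel)" by (rule Liminf_le_Limsup) simp
  also have "\<dots> \<le> ?rhs" by (rule Limsup_bounded[OF always_eventually]) (rule allI, rule bound)
  finally show ?thesis .
qed

text \<open>Removes the cutoff near the unit ball: it is at least 1/2 where d \<ge> 3, and elsewhere
  d^(2(\<theta>-1)) \<le> 3^2 is charged to f^2.\<close>

lemma U_bound:
  obtains A B where "0 \<le> A" "0 \<le> B"
    "\<And>f. f \<in> classL X \<Longrightarrow> (\<integral>\<^sup>+x. ennreal (dw x * ((dp x)\<^sup>2 * (f x)\<^sup>2)) \<partial>lborel)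
      \<le> (\<integral>\<^sup>+x. ennreal (dw x * (A * grad2 f x + B * (f x)\<^sup>2)) \<partial>lborel)"
proof
  let ?L = "32 / \<delta> + K\<^sup>2 / \<delta> + 5"
  let ?A = "4 / \<delta> * (8 / \<delta>)" and ?B = "4 / \<delta> * ?L + 9"
  show "0 \<le> ?A" "0 \<le> ?B" using \<delta>_pos by auto
  fix f assume f: "f \<in> classL X"
  have cf: "continuous_on UNIV f" by (rule classL_continuous[OF f])
  have [measurable]: "dw \<in> borel_measurable borel" "f \<in> borel_measurable borel" "dp \<in> borel_measurable borel"
    "(\<lambda>x. cutoff (d x)) \<in> borel_measurable borel" "(\<lambda>x. grad2 f x) \<in> borel_measurable borel"
    by (intro borel_measurable_continuous_onI dw_cont cf dp_cont cutoff_d_cont measurable_grad_norm_sq f)+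
  let ?c = "\<lambda>x. dw x * (\<delta> / 2 * (cutoff (d x) * (dp x)\<^sup>2 * (f x)\<^sup>2))"
  let ?r = "\<lambda>x. dw x * (8 / \<delta> * grad2 f x + ?L * (f x)\<^sup>2)"
  have c0: "0 \<le> ?c x" and r0: "0 \<le> ?r x" for x
    using \<delta>_pos dw_pos[of x] by (intro mult_nonneg_nonneg add_nonneg_nonneg cutoff_bounds; simp)+
  have p: "(dp x)\<^sup>2 \<le> 2 * cutoff (d x) * (dp x)\<^sup>2 + 9" for x
  proof (cases "3 \<le> d x")
    case True
    have "(2 * (1 / 2)) * (dp x)\<^sup>2 \<le> (2 * cutoff (d x)) * (dp x)\<^sup>2"
      using cutoff_ge_half[OF True] by (intro mult_right_mono) auto
    then show ?thesis by simp
  next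
    case False
    have "dp x \<le> 3 powr (\<theta> - 1)" using False d_nonneg theta by (intro powr_mono2) auto
    also have "\<dots> \<le> 3 powr 1" using theta by (intro powr_mono) auto
    finally have "(dp x)\<^sup>2 \<le> 3\<^sup>2" by (intro power_mono) auto
    moreover have "0 \<le> 2 * cutoff (d x) * (dp x)\<^sup>2" by (intro mult_nonneg_nonneg cutoff_bounds) auto
    ultimately show ?thesis by simp
  qed
  have "dw x * ((dp x)\<^sup>2 * (f x)\<^sup>2) \<le> 4 / \<delta> * ?c x + 9 * (dw x * (f x)\<^sup>2)" for x
  proof -
    have "dw x * (f x)\<^sup>2 * (dp x)\<^sup>2 \<le> dw x * (f x)\<^sup>2 * (2 * cutoff (d x) * (dp x)\<^sup>2 + 9)"
      using dw_pos[of x] by (intro mult_left_mono p) auto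
    then show ?thesis using \<delta>_pos by (simp add: algebra_simps)
  qed
  then have "ennreal (dw x * ((dp x)\<^sup>2 * (f x)\<^sup>2)) \<le> ennreal (4 / \<delta> * ?c x + 9 * (dw x * (f x)\<^sup>2))" for x
    by (rule ennreal_leI)
  moreover have "ennreal (4 / \<delta> * ?c x + 9 * (dw x * (f x)\<^sup>2)) = ennreal (4 / \<delta>) * ennreal (?c x) + ennreal (9 * (dw x * (f x)\<^sup>2))" for x
    using \<delta>_pos dw_pos[of x] by (intro ennreal_linear c0) auto
  ultimately have "(\<integral>\<^sup>+x. ennreal (dw x * ((dp x)\<^sup>2 * (f x)\<^sup>2)) \<partial>lborel)
      \<le> (\<integral>\<^sup>+x. ennreal (4 / \<delta>) * ennreal (?c x) + ennreal (9 * (dw x * (f x)\<^sup>2)) \<partial>lborel)"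
    by (intro nn_integral_mono) simp
  also have "\<dots> = ennreal (4 / \<delta>) * (\<integral>\<^sup>+x. ennreal (?c x) \<partial>lborel) + (\<integral>\<^sup>+x. ennreal (9 * (dw x * (f x)\<^sup>2)) \<partial>lborel)"
    by (simp add: nn_integral_add nn_integral_cmult)
  also have "\<dots> \<le> ennreal (4 / \<delta>) * (\<integral>\<^sup>+x. ennreal (?r x) \<partial>lborel) + (\<integral>\<^sup>+x. ennreal (9 * (dw x * (f x)\<^sup>2)) \<partial>lborel)"
    by (intro add_mono mult_left_mono U_bound_cutoff f) auto
  also have "\<dots> = (\<integral>\<^sup>+x. ennreal (4 / \<delta>) * ennreal (?r x) + ennreal (9 * (dw x * (f x)\<^sup>2)) \<partial>lborel)"
    by (simp add: nn_integral_add nn_integral_cmult)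
  also have "\<dots> = (\<integral>\<^sup>+x. ennreal (dw x * (?A * grad2 f x + ?B * (f x)\<^sup>2)) \<partial>lborel)"
  proof (intro nn_integral_cong)
    fix x
    have "ennreal (4 / \<delta>) * ennreal (?r x) + ennreal (9 * (dw x * (f x)\<^sup>2))
        = ennreal (4 / \<delta> * ?r x + 9 * (dw x * (f x)\<^sup>2))"
      using \<delta>_pos dw_pos[of x] by (intro ennreal_linear[symmetric] r0) auto
    also have "4 / \<delta> * ?r x + 9 * (dw x * (f x)\<^sup>2) = dw x * (?A * grad2 f x + ?B * (f x)\<^sup>2)"
      by (simp add: algebra_simps)
    finally show "ennreal (4 / \<delta>) * ennreal (?r x) + ennreal (9 * (dw x * (f x)\<^sup>2))
        = ennreal (dw x * (?A * grad2 f x + ?B * (f x)\<^sup>2))" .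
  qed
  finally show "(\<integral>\<^sup>+x. ennreal (dw x * ((dp x)\<^sup>2 * (f x)\<^sup>2)) \<partial>lborel)
      \<le> (\<integral>\<^sup>+x. ennreal (dw x * (?A * grad2 f x + ?B * (f x)\<^sup>2)) \<partial>lborel)" .
qed

end

section \<open>Inequalities for powers of logarithms\<close>

text \<open>With r = exp t, the inequality exp s \<ge> 1 + s is used at s = t - ct and s = -ct with
  weights c and 1 - c, for which the linear terms cancel.\<close>

lemma powr_le_tangent:
  fixes r c :: real
  assumes "0 \<le> r" "0 \<le> c" "c \<le> 1"
  shows "r powr c \<le> 1 + c * (r - 1)"
proof (cases "r = 0")
  case False
  define t where "t = ln r"
  have r: "r = exp t" "r powr c = exp (c * t)" using False assms(1) by (simp_all add: t_def powr_def)
  have "1 + (t - c * t) \<le> exp (t - c * t)" "1 + (- (c * t)) \<le> exp (- (c * t))" by (rule exp_ge_add_one_self)+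
  then have "c * (1 + (t - c * t)) + (1 - c) * (1 + (- (c * t))) \<le> c * exp (t - c * t) + (1 - c) * exp (- (c * t))"
    using assms by (intro add_mono mult_left_mono) auto
  then have "1 \<le> c * exp (t - c * t) + (1 - c) * exp (- (c * t))" by (simp add: algebra_simps)
  then have "exp (c * t) * 1 \<le> exp (c * t) * (c * exp (t - c * t) + (1 - c) * exp (- (c * t)))"
    by (intro mult_left_mono) auto
  also have "\<dots> = c * (exp (c * t) * exp (t - c * t)) + (1 - c) * (exp (c * t) * exp (- (c * t)))"
    by (simp add: algebra_simps)
  also have "\<dots> = c * exp t + (1 - c)" by (simp flip: exp_add)
  finally show ?thesis unfolding r(2) unfolding r(1) by (simp add: algebra_simps)
qed (use assms in simp)

text \<open>After division by a + b both fractions lie in [0, 1], where y \<le> y^c, and they add up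
  to 1.\<close>

lemma powr_subadditive:
  fixes a b c :: real
  assumes "0 \<le> a" "0 \<le> b" "0 < c" "c \<le> 1"
  shows "(a + b) powr c \<le> a powr c + b powr c"
proof (cases "a + b = 0")
  case False
  then have pos: "0 < a + b" using assms by linarith
  have "x / (a + b) \<le> (x / (a + b)) powr c" if "0 \<le> x" "x \<le> a + b" for x
    using that pos assms powr_mono'[of c 1 "x / (a + b)"] by simp
  from this[of a] this[of b]
  have "a / (a + b) + b / (a + b) \<le> (a / (a + b)) powr c + (b / (a + b)) powr c" using assms by linarith
  moreover have "a / (a + b) + b / (a + b) = 1" using pos by (simp flip: add_divide_distrib)
  ultimately have "1 \<le> (a powr c + b powr c) / (a + b) powr c"
    using assms pos by (simp add: powr_divide add_divide_distrib)
  then show ?thesis using pos by (simp add: le_divide_eq)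
qed (use assms in simp)

lemma powr_le_one_plus:
  fixes t c :: real
  assumes "0 \<le> t" "0 \<le> c" "c \<le> 1"
  shows "t powr c \<le> 1 + t"
  using powr_le_tangent[OF assms] mult_right_mono[OF assms(3,1)] assms by (simp add: algebra_simps)

text \<open>Converts the Sobolev bound on Y^(1/p) into a bound on ln(1 + Y) that is linear in the
  energy. Subadditivity pulls the p-th root inside the logarithm, where ln(1 + t) \<le> t
  applies.\<close>

lemma ln_one_plus_le_powr:
  fixes y p :: real
  assumes "0 \<le> y" "1 \<le> p"
  shows "ln (1 + y) \<le> p * y powr (1 / p)"
proof -
  have "(1 + y) powr (1 / p) \<le> 1 powr (1 / p) + y powr (1 / p)"
    using assms by (intro powr_subadditive) auto
  then have "ln ((1 + y) powr (1 / p)) \<le> ln (1 + y powr (1 / p))"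
    using assms by (intro ln_mono) (auto intro: add_pos_nonneg)
  also have "\<dots> \<le> y powr (1 / p)" by (rule ln_add_one_self_le_self) simp
  finally have "ln (1 + y) / p \<le> y powr (1 / p)" using assms by (simp add: ln_powr)
  then show ?thesis using assms by (simp add: divide_le_eq mult.commute)
qed

text \<open>Replaces Jensen's inequality for the probability density \<open>g\<^sup>2\<close> and the concave logarithm: the bound is
  affine in \<open>g powr (2 + e)\<close> and \<open>g\<^sup>2\<close>, so it can be integrated; \<open>Y\<close> will be the integral of
  \<open>g powr (2 + e)\<close>.\<close>

lemma sq_log_powr_le:
  fixes g c e Y :: real
  assumes "0 \<le> c" "c \<le> 1" "0 < e" "e \<le> 2" "0 \<le> Y"
  shows "g\<^sup>2 * ln (1 + g\<^sup>2) powr c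
    \<le> (1 + 2 / e * ln (1 + Y)) * g\<^sup>2 + 2 / e / (1 + Y) * (g\<^sup>2 + \<bar>g\<bar> powr (2 + e))"
proof -
  have "ln (1 + g\<^sup>2) powr c \<le> 1 + ln (1 + g\<^sup>2)" using assms by (intro powr_le_one_plus) auto
  also have "ln (1 + g\<^sup>2) \<le> 2 / e * (ln (1 + Y) + (1 + \<bar>g\<bar> powr e) / (1 + Y))"
  proof -
    have "(1 + g\<^sup>2) powr (e / 2) \<le> 1 powr (e / 2) + (g\<^sup>2) powr (e / 2)"
      using assms by (intro powr_subadditive) auto
    also have "(g\<^sup>2) powr (e / 2) = \<bar>g\<bar> powr e"
    proof (cases "g = 0")
      case False
      have "g\<^sup>2 = \<bar>g\<bar> powr 2" using False by simp
      then show ?thesis by (simp only: powr_powr) simp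
    qed simp
    finally have 1: "(1 + g\<^sup>2) powr (e / 2) \<le> 1 + \<bar>g\<bar> powr e" by simp
    have pos: "0 < 1 + g\<^sup>2" "0 < 1 + \<bar>g\<bar> powr e" by (auto intro: add_pos_nonneg)
    have "e / 2 * ln (1 + g\<^sup>2) = ln ((1 + g\<^sup>2) powr (e / 2))" using pos(1) by (simp add: ln_powr)
    also have "\<dots> \<le> ln (1 + \<bar>g\<bar> powr e)" using 1 pos by (intro ln_mono) auto
    \<comment> \<open>Comparison with the tangent of ln at 1 + Y. After multiplication by g^2 the
      linear part contains |g|^(2+e), whose integral will be Y, so that dividing by 1 + Y leaves a
      constant.\<close>
    also have "\<dots> = ln (1 + Y) + ln ((1 + \<bar>g\<bar> powr e) / (1 + Y))"
      using pos(2) assms(5) by (subst ln_divide_pos) auto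
    also have "\<dots> \<le> ln (1 + Y) + (1 + \<bar>g\<bar> powr e) / (1 + Y)"
      using ln_le_minus_one[of "(1 + \<bar>g\<bar> powr e) / (1 + Y)"] pos(2) assms(5) by simp
    finally show ?thesis using assms(3) by (simp add: field_simps)
  qed
  finally have "g\<^sup>2 * ln (1 + g\<^sup>2) powr c \<le> g\<^sup>2 * (1 + 2 / e * (ln (1 + Y) + (1 + \<bar>g\<bar> powr e) / (1 + Y)))"
    by (intro mult_left_mono) auto
  also have "\<dots> = (1 + 2 / e * ln (1 + Y)) * g\<^sup>2 + 2 / e / (1 + Y) * (g\<^sup>2 + g\<^sup>2 * \<bar>g\<bar> powr e)"
    by (simp add: algebra_simps add_divide_distrib)
  also have "g\<^sup>2 * \<bar>g\<bar> powr e = \<bar>g\<bar> powr (2 + e)"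
    by (cases "g = 0") (auto simp: powr_add)
  finally show ?thesis .
qed

section \<open>Pointwise estimates of Rothaus type\<close>

text \<open>Concavity of ln(1 + x)^c in x, by composing the tangent inequalities of the power and of
  ln. The factor m is what makes l \<le> 1 possible uniformly in m: m/(1 + m) is at most 1 and at
  most ln(1 + m).\<close>

lemma ln_one_plus_powr_tangent:
  fixes x m c :: real
  assumes "0 \<le> x" "0 < m" "0 \<le> c" "c \<le> 1"
  shows "\<exists>l. 0 \<le> l \<and> l \<le> 1 \<and> (\<forall>x\<ge>0. m * (ln (1 + x) powr c - ln (1 + m) powr c) \<le> l * (x - m))"
proof -
  let ?y = "ln (1 + m)"
  define l where "l = c * ?y powr (c - 1) * (m / (1 + m))"
  have y: "0 < ?y" using assms by simp
  have l0: "0 \<le> l" using assms y by (simp add: l_def)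
  have "m / (1 + m) \<le> ?y"
  proof -
    have "ln (1 / (1 + m)) \<le> 1 / (1 + m) - 1" using assms by (intro ln_le_minus_one) simp
    also have "1 / (1 + m) - 1 = - (m / (1 + m))" using assms by (simp add: field_simps)
    finally show ?thesis using assms by (simp add: ln_div)
  qed
  have "?y powr (c - 1) * (m / (1 + m)) \<le> 1"
  proof (cases "1 \<le> ?y")
    case True
    have "?y powr (c - 1) \<le> ?y powr 0" using True assms by (intro powr_mono) auto
    then have "?y powr (c - 1) * (m / (1 + m)) \<le> 1 * 1" using assms y by (intro mult_mono) auto
    then show ?thesis by simp
  next
    case False
    have "?y powr (c - 1) * (m / (1 + m)) \<le> ?y powr (c - 1) * ?y"
      using \<open>m / (1 + m) \<le> ?y\<close> by (intro mult_left_mono) auto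
    also have "\<dots> = ?y powr c" using y by (simp add: powr_diff)
    also have "\<dots> \<le> 1" using False y assms by (intro powr_le1) auto
    finally show ?thesis .
  qed
  then have "c * (?y powr (c - 1) * (m / (1 + m))) \<le> 1 * 1" using assms y by (intro mult_mono) auto
  then have l1: "l \<le> 1" by (simp add: l_def mult.assoc)
  have "m * (ln (1 + x) powr c - ?y powr c) \<le> l * (x - m)" if x: "x \<ge> 0" for x
  proof -
    have "(ln (1 + x) / ?y) powr c \<le> 1 + c * (ln (1 + x) / ?y - 1)"
      using assms y x by (intro powr_le_tangent) auto
    then have "?y powr c * (ln (1 + x) / ?y) powr c \<le> ?y powr c * (1 + c * (ln (1 + x) / ?y - 1))"
      by (intro mult_left_mono) auto
    also have "?y powr c * (ln (1 + x) / ?y) powr c = ln (1 + x) powr c"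
      using y x by (simp add: powr_divide)
    also have "?y powr c * (1 + c * (ln (1 + x) / ?y - 1)) = ?y powr c + c * ?y powr (c - 1) * (ln (1 + x) - ?y)"
      using y by (simp add: powr_diff field_simps)
    finally have 1: "ln (1 + x) powr c - ?y powr c \<le> c * ?y powr (c - 1) * (ln (1 + x) - ?y)" by simp
    have "ln ((1 + x) / (1 + m)) \<le> (1 + x) / (1 + m) - 1" using assms x by (intro ln_le_minus_one) auto
    also have "(1 + x) / (1 + m) - 1 = (x - m) / (1 + m)" using assms by (simp add: field_simps)
    finally have "ln (1 + x) - ?y \<le> (x - m) / (1 + m)" using assms x by (simp add: ln_div)
    then have "c * ?y powr (c - 1) * (ln (1 + x) - ?y) \<le> c * ?y powr (c - 1) * ((x - m) / (1 + m))"
      using assms by (intro mult_left_mono) auto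
    with 1 have "ln (1 + x) powr c - ?y powr c \<le> c * ?y powr (c - 1) * ((x - m) / (1 + m))" by linarith
    from mult_left_mono[OF this, of m] show ?thesis using assms by (simp add: l_def mult_ac)
  qed
  with l0 l1 show ?thesis by blast
qed

text \<open>The analogue of Rothaus' lemma: with \<open>s\<close> and \<open>m = a\<^sup>2 + s\<close> the variance and second moment of
  \<open>a + h\<close>, the term \<open>l * ((a + h)\<^sup>2 - m)\<close> integrates to zero.\<close>

lemma rothaus_pointwise:
  fixes a s c :: real
  assumes s: "0 < s" and c: "0 < c" "c \<le> 1"
  defines "m \<equiv> a\<^sup>2 + s"
  shows "\<exists>l. 0 \<le> l \<and> l \<le> 1 \<and> (\<forall>h. (a + h)\<^sup>2 * ln (1 + (a + h)\<^sup>2) powr c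
    \<le> (a + h)\<^sup>2 * ln (1 + m) powr c + l * ((a + h)\<^sup>2 - m) + 18 * (h\<^sup>2 + s) + 4 * (h\<^sup>2 * ln (1 + h\<^sup>2 / s) powr c))"
proof -
  have m: "0 < m" "s \<le> m" "a\<^sup>2 \<le> m" using s by (auto simp: m_def add_nonneg_pos)
  obtain l where l: "0 \<le> l" "l \<le> 1" "\<And>x. 0 \<le> x \<Longrightarrow> m * (ln (1 + x) powr c - ln (1 + m) powr c) \<le> l * (x - m)"
    using ln_one_plus_powr_tangent[OF order_refl m(1), of c] c by auto
  have "(a + h)\<^sup>2 * (ln (1 + (a + h)\<^sup>2) powr c - ln (1 + m) powr c)
      \<le> l * ((a + h)\<^sup>2 - m) + 18 * (h\<^sup>2 + s) + 4 * (h\<^sup>2 * ln (1 + h\<^sup>2 / s) powr c)" for h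
  proof -
    let ?x = "(a + h)\<^sup>2" and ?L = "\<lambda>x. ln (1 + x) powr c"
    have hL: "0 \<le> h\<^sup>2 * ?L (h\<^sup>2 / s)" by simp
    show ?thesis
    proof (cases "\<bar>h\<bar> < \<bar>a\<bar>")
      case True
      \<comment> \<open>The tangent inequality is multiplied by \<open>?x\<close>, split as m +
        (\<open>?x\<close> - m). The resulting square of \<open>?x\<close> - m is at most 18 m (h^2
        + s) because |h| < |a| and both a^2 and s are at most m; finally m is divided out.\<close>
      have "m * (?x * (?L ?x - ?L m)) \<le> ?x * (l * (?x - m))"
        using mult_left_mono[OF l(3)[of ?x], of ?x] by (simp add: mult_ac)
      also have "\<dots> = m * (l * (?x - m)) + l * (?x - m)\<^sup>2" by (simp add: power2_eq_square algebra_simps)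
      also have "l * (?x - m)\<^sup>2 \<le> 1 * (?x - m)\<^sup>2" using l by (intro mult_right_mono) auto
      also have "1 * (?x - m)\<^sup>2 \<le> m * (18 * (h\<^sup>2 + s))"
      proof -
        have eq: "?x - m = h * (2 * a + h) - s" by (simp add: m_def power2_eq_square algebra_simps)
        have "(?x - m)\<^sup>2 \<le> 2 * (h * (2 * a + h))\<^sup>2 + 2 * s\<^sup>2"
          unfolding eq using zero_le_power2[of "h * (2 * a + h) + s"] by (simp add: power2_eq_square algebra_simps)
        also have "(h * (2 * a + h))\<^sup>2 \<le> 9 * (h\<^sup>2 * a\<^sup>2)"
        proof -
          have "\<bar>2 * a + h\<bar> \<le> 3 * \<bar>a\<bar>" using True by linarith
          then have "\<bar>2 * a + h\<bar>\<^sup>2 \<le> (3 * \<bar>a\<bar>)\<^sup>2" by (intro power_mono) auto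
          then have "h\<^sup>2 * (2 * a + h)\<^sup>2 \<le> h\<^sup>2 * (9 * a\<^sup>2)" by (intro mult_left_mono) (auto simp: power_mult_distrib)
          then show ?thesis by (simp add: power_mult_distrib)
        qed
        also have "h\<^sup>2 * a\<^sup>2 \<le> h\<^sup>2 * m" using m by (intro mult_left_mono) auto
        also have "2 * s\<^sup>2 \<le> 18 * (s * m)" using m s mult_left_mono[OF m(2), of s] by (simp add: power2_eq_square)
        finally show ?thesis by (simp add: algebra_simps)
      qed
      finally have "m * (?x * (?L ?x - ?L m)) \<le> m * (l * (?x - m) + 18 * (h\<^sup>2 + s))" by (simp add: algebra_simps)
      then have "?x * (?L ?x - ?L m) \<le> l * (?x - m) + 18 * (h\<^sup>2 + s)" using m(1) by simp
      then show ?thesis using hL by linarith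
    next
      \<comment> \<open>Here the perturbation dominates, (a + h)^2 \<le> 4 h^2, and the logarithm is
        split directly without the tangent.\<close>
      case False
      have a2: "\<bar>a * h\<bar> \<le> h\<^sup>2"
        using False mult_right_mono[of "\<bar>a\<bar>" "\<bar>h\<bar>" "\<bar>h\<bar>"] by (simp add: abs_mult power2_eq_square)
      have a2': "a\<^sup>2 \<le> h\<^sup>2" using False by (simp add: abs_le_square_iff[symmetric])
      have x4: "?x \<le> 4 * h\<^sup>2" using a2 a2' by (simp add: power2_sum abs_le_iff)
      have "?x - m = 2 * (a * h) + h\<^sup>2 - s" by (simp add: m_def power2_sum)
      then have "\<bar>?x - m\<bar> \<le> 3 * h\<^sup>2 + s" using a2 s by (simp add: abs_le_iff)
      \<comment> \<open>The linear term on the right-hand side may be negative; its size 3 h^2 + s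
        together with the 8 h^2 found below fits under 18 (h^2 + s).\<close>
      then have lin: "- (3 * h\<^sup>2 + s) \<le> l * (?x - m)"
        using l mult_mono[of l 1 "\<bar>?x - m\<bar>" "3 * h\<^sup>2 + s"] abs_ge_minus_self[of "l * (?x - m)"] by (simp add: abs_mult)
      have "?L ?x \<le> ?L m + (2 + ?L (h\<^sup>2 / s))"
      proof -
        have fs: "0 \<le> h\<^sup>2 / s" using s by simp
        \<comment> \<open>A product bound, so that the logarithm becomes a sum; s \<le> m is what
          bounds \<open>?x\<close> by \<open>?x * (m / s)\<close>.\<close>
        have "1 + ?x \<le> (1 + m) * (1 + ?x / s)"
        proof -
          have "?x * 1 \<le> ?x * (m / s)" using m s by (intro mult_left_mono) auto
          moreover have "(1 + m) * (1 + ?x / s) = 1 + m + ?x / s + ?x * (m / s)" by (simp add: algebra_simps add_divide_distrib)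
          moreover have "0 \<le> ?x / s" using s by simp
          ultimately show ?thesis using m by linarith
        qed
        also have "\<dots> \<le> (1 + m) * (4 * (1 + h\<^sup>2 / s))"
        proof (rule mult_left_mono)
          have "?x / s \<le> 4 * h\<^sup>2 / s" using x4 s by (intro divide_right_mono) auto
          then show "1 + ?x / s \<le> 4 * (1 + h\<^sup>2 / s)" by simp
        qed (use m in simp)
        finally have "ln (1 + ?x) \<le> ln ((1 + m) * (4 * (1 + h\<^sup>2 / s)))"
          by (intro ln_mono) (auto intro: add_pos_nonneg)
        also have "\<dots> = ln (1 + m) + (ln 4 + ln (1 + h\<^sup>2 / s))"
        proof -
          have pos: "0 < 1 + m" "0 < 1 + h\<^sup>2 / s" using m fs by linarith+
          then have "0 < 4 * (1 + h\<^sup>2 / s)" by (intro mult_pos_pos) simp_all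
          then show ?thesis using pos by (simp only: ln_mult_pos)
        qed
        finally have "?L ?x \<le> (ln (1 + m) + (ln 4 + ln (1 + h\<^sup>2 / s))) powr c"
          using c by (intro powr_mono2) auto
        also have "\<dots> \<le> ?L m + (ln 4 + ln (1 + h\<^sup>2 / s)) powr c"
          using m c fs by (intro powr_subadditive) auto
        also have "(ln 4 + ln (1 + h\<^sup>2 / s)) powr c \<le> ln 4 powr c + ?L (h\<^sup>2 / s)"
          using c fs by (intro powr_subadditive) auto
        also have "ln 4 powr c \<le> 2"
        proof -
          have l4: "ln (4::real) = 2 * ln 2" using ln_realpow[of 2 2] by simp
          have "ln (2::real) \<le> 1" using ln_le_minus_one[of 2] by simp
          then have "c * (ln 4 - 1) \<le> c * 1" using c l4 by (intro mult_left_mono) auto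
          moreover have "ln 4 powr c \<le> 1 + c * (ln 4 - 1)" using c by (intro powr_le_tangent) auto
          ultimately show ?thesis using c by linarith
        qed
        finally show ?thesis by simp
      qed
      then have "?x * (?L ?x - ?L m) \<le> ?x * (2 + ?L (h\<^sup>2 / s))" by (intro mult_left_mono) auto
      also have "\<dots> \<le> 4 * h\<^sup>2 * (2 + ?L (h\<^sup>2 / s))" using x4 by (intro mult_right_mono) auto
      finally have "?x * (?L ?x - ?L m) \<le> 8 * h\<^sup>2 + 4 * (h\<^sup>2 * ?L (h\<^sup>2 / s))" by (simp add: algebra_simps)
      then show ?thesis using lin s zero_le_power2[of h] by argo
    qed
  qed
  then have "(a + h)\<^sup>2 * ln (1 + (a + h)\<^sup>2) powr c
    \<le> (a + h)\<^sup>2 * ln (1 + m) powr c + l * ((a + h)\<^sup>2 - m) + 18 * (h\<^sup>2 + s) + 4 * (h\<^sup>2 * ln (1 + h\<^sup>2 / s) powr c)" for h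
    unfolding right_diff_distrib by (smt (verit))
  with l(1,2) show ?thesis by blast
qed

section \<open>The defective inequality\<close>

lemma nn_integral_linear:
  fixes f g :: "'a \<Rightarrow> real"
  assumes "f \<in> borel_measurable M" "g \<in> borel_measurable M" "0 \<le> a" "0 \<le> b" "\<And>x. 0 \<le> f x" "\<And>x. 0 \<le> g x"
  shows "(\<integral>\<^sup>+x. ennreal (a * f x + b * g x) \<partial>M)
    = ennreal a * (\<integral>\<^sup>+x. ennreal (f x) \<partial>M) + ennreal b * (\<integral>\<^sup>+x. ennreal (g x) \<partial>M)"
proof -
  have "(\<integral>\<^sup>+x. ennreal (a * f x + b * g x) \<partial>M) = (\<integral>\<^sup>+x. ennreal a * ennreal (f x) + ennreal b * ennreal (g x) \<partial>M)"
    using assms(3-) by (intro nn_integral_cong) (simp add: ennreal_mult)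
  then show ?thesis using assms(1,2) by (simp add: nn_integral_add nn_integral_cmult)
qed

locale coercive_setting = drift_setting X d \<theta> \<beta> \<sigma> K \<epsilon>
  for X :: "'k::finite \<Rightarrow> 'a::euclidean_space \<Rightarrow> 'a" and d and \<theta> \<beta> \<sigma> K \<epsilon> :: real +
  fixes Z e C D :: real
  assumes Z: "0 < Z"
    and e: "0 < e" "e < 1"
    and CD: "0 < C" "0 < D"
    and sobolev: "\<And>g. g \<in> classL X \<Longrightarrow>
           ennpowr (\<integral>\<^sup>+x. ennreal (\<bar>g x\<bar> powr (2 + e)) \<partial>lborel) (2 / (2 + e))
             \<le> ennreal C * (\<integral>\<^sup>+x. ennreal ((grad_norm X g x)\<^sup>2) \<partial>lborel)
               + ennreal D * (\<integral>\<^sup>+x. ennreal ((g x)\<^sup>2) \<partial>lborel)"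
begin

abbreviation "\<mu> \<equiv> mu_theta d \<beta> Z \<theta>"

definition expo where "expo = 2 * (\<theta> - 1) / \<theta>"

text \<open>The upper bound, from \<theta> \<le> 2, is what makes the power of the logarithm concave
  and subadditive.\<close>

lemma expo_bounds: "0 < expo" "expo \<le> 1"
  using theta by (auto simp: expo_def field_simps)

lemma measurable_dw [measurable]: "dw \<in> borel_measurable borel"
  and measurable_dp [measurable]: "dp \<in> borel_measurable borel"
  by (intro borel_measurable_continuous_onI dw_cont dp_cont)+

lemma sets_mu: "sets \<mu> = sets borel"
  by (simp add: mu_theta_def)

lemma measurable_mu [simp]: "borel_measurable \<mu> = (borel_measurable borel :: ('a \<Rightarrow> 'b::topological_space) set)"
  by (rule measurable_cong_sets[OF sets_mu refl])

lemma nn_integral_mu: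
  assumes [measurable]: "h \<in> borel_measurable borel"
  shows "(\<integral>\<^sup>+x. ennreal (h x) \<partial>\<mu>) = (\<integral>\<^sup>+x. ennreal (dw x / Z * h x) \<partial>lborel)"
proof -
  have "\<mu> = density lborel (\<lambda>x. ennreal (dw x / Z))" by (simp add: mu_theta_def weight_def)
  then show ?thesis
    using Z dw_pos by (simp add: nn_integral_density ennreal_mult'[symmetric] less_imp_le)
qed

lemma U_bound_mu:
  obtains A B where "0 \<le> A" "0 \<le> B"
    "\<And>f. f \<in> classL X \<Longrightarrow> (\<integral>\<^sup>+x. ennreal ((dp x)\<^sup>2 * (f x)\<^sup>2) \<partial>\<mu>)
      \<le> ennreal A * (\<integral>\<^sup>+x. ennreal (grad2 f x) \<partial>\<mu>) + ennreal B * (\<integral>\<^sup>+x. ennreal ((f x)\<^sup>2) \<partial>\<mu>)"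
proof -
  obtain A B where AB: "0 \<le> A" "0 \<le> B"
    "\<And>f. f \<in> classL X \<Longrightarrow> (\<integral>\<^sup>+x. ennreal (dw x * ((dp x)\<^sup>2 * (f x)\<^sup>2)) \<partial>lborel)
      \<le> (\<integral>\<^sup>+x. ennreal (dw x * (A * grad2 f x + B * (f x)\<^sup>2)) \<partial>lborel)"
    using U_bound by blast
  show ?thesis
  proof (rule that[OF AB(1,2)])
    fix f assume f: "f \<in> classL X"
    have [measurable]: "f \<in> borel_measurable borel" "(\<lambda>x. grad2 f x) \<in> borel_measurable borel"
      by (intro borel_measurable_continuous_onI classL_continuous[OF f] measurable_grad_norm_sq f)+
    have scale: "(\<integral>\<^sup>+x. ennreal (h x) \<partial>\<mu>) = ennreal (1 / Z) * (\<integral>\<^sup>+x. ennreal (dw x * h x) \<partial>lborel)"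
      if [measurable]: "h \<in> borel_measurable borel" for h
      using Z by (simp add: nn_integral_mu nn_integral_cmult[symmetric] ennreal_mult'[symmetric])
    have "(\<integral>\<^sup>+x. ennreal ((dp x)\<^sup>2 * (f x)\<^sup>2) \<partial>\<mu>) \<le> (\<integral>\<^sup>+x. ennreal (A * grad2 f x + B * (f x)\<^sup>2) \<partial>\<mu>)"
      using AB(3)[OF f] by (simp add: scale mult_left_mono)
    also have "\<dots> = ennreal A * (\<integral>\<^sup>+x. ennreal (grad2 f x) \<partial>\<mu>) + ennreal B * (\<integral>\<^sup>+x. ennreal ((f x)\<^sup>2) \<partial>\<mu>)"
      using AB(1,2) by (intro nn_integral_linear) auto
    finally show "(\<integral>\<^sup>+x. ennreal ((dp x)\<^sup>2 * (f x)\<^sup>2) \<partial>\<mu>)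
      \<le> ennreal A * (\<integral>\<^sup>+x. ennreal (grad2 f x) \<partial>\<mu>) + ennreal B * (\<integral>\<^sup>+x. ennreal ((f x)\<^sup>2) \<partial>\<mu>)" .
  qed
qed

text \<open>The square root of the density of \<mu> as a function of d. The positive part makes it
  C1 on the whole line and is invisible for d \<ge> 0.\<close>

definition q :: "real \<Rightarrow> real" where
  "q t = exp (- (\<beta> / 2) * max 0 t powr \<theta>) / sqrt Z"

definition q' :: "real \<Rightarrow> real" where
  "q' t = - (\<beta> / 2) * (\<theta> * max 0 t powr (\<theta> - 1)) * q t"

lemma q_deriv: "(q has_real_derivative q' t) (at t)"
proof -
  have "((\<lambda>t. - (\<beta> / 2) * max 0 t powr \<theta>) has_real_derivative - (\<beta> / 2) * (\<theta> * max 0 t powr (\<theta> - 1))) (at t)"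
    by (rule DERIV_cmult[OF has_derivative_pos_part_powr[OF theta(1)]])
  from DERIV_cdivide[OF DERIV_chain2[OF DERIV_exp this], of "sqrt Z"] show ?thesis
    unfolding q_def[abs_def] q'_def by (simp add: mult_ac)
qed

lemma q'_continuous: "continuous_on UNIV q'"
  unfolding q'_def[abs_def] using theta
  by (intro continuous_intros continuous_pos_part_powr DERIV_continuous_on_UNIV[OF q_deriv]) auto

lemma q_d_sq: "(q (d x))\<^sup>2 = dw x / Z"
  using Z d_nonneg[of x] by (simp add: q_def weight_def power_divide flip: exp_double)

lemma q'_d_sq: "(q' (d x))\<^sup>2 = (\<beta> * \<theta> / 2)\<^sup>2 * (dp x)\<^sup>2 * (dw x / Z)"
  unfolding q'_def power_mult_distrib q_d_sq using d_nonneg[of x]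
  by (simp add: power_mult_distrib power_divide)

text \<open>Multiplication by the square root of the density carries L2(\<mu>) isometrically into L2
  of Lebesgue measure, where the Sobolev inequality lives. The gradient of the factor leaves behind
  exactly the weight that the U-bound controls.\<close>

lemma ground_state_transform:
  assumes u: "u \<in> classL X"
  defines "g \<equiv> \<lambda>x. u x * q (d x)"
  shows "g \<in> classL X"
    and "(\<integral>\<^sup>+x. ennreal (grad2 g x) \<partial>lborel)
      \<le> ennreal 2 * (\<integral>\<^sup>+x. ennreal (grad2 u x) \<partial>\<mu>)
        + ennreal (2 * (\<beta> * \<theta> / 2)\<^sup>2) * (\<integral>\<^sup>+x. ennreal ((dp x)\<^sup>2 * (u x)\<^sup>2) \<partial>\<mu>)"
    and "(\<integral>\<^sup>+x. ennreal ((g x)\<^sup>2) \<partial>lborel) = (\<integral>\<^sup>+x. ennreal ((u x)\<^sup>2) \<partial>\<mu>)"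
proof -
  have cu: "continuous_on UNIV u" by (rule classL_continuous[OF u])
  have [measurable]: "u \<in> borel_measurable borel" "(\<lambda>x. grad2 u x) \<in> borel_measurable borel"
    by (intro borel_measurable_continuous_onI cu measurable_grad_norm_sq u)+
  note gX = classL_mult_compose_d[OF u q_deriv q'_continuous, folded g_def]
  show "g \<in> classL X" by (rule gX(1))
  have gsq: "(g x)\<^sup>2 = dw x / Z * (u x)\<^sup>2" for x
    by (simp only: g_def power_mult_distrib q_d_sq mult.commute)
  show "(\<integral>\<^sup>+x. ennreal ((g x)\<^sup>2) \<partial>lborel) = (\<integral>\<^sup>+x. ennreal ((u x)\<^sup>2) \<partial>\<mu>)"
    unfolding gsq by (rule nn_integral_mu[symmetric]) simp
  have "AE x in lborel. grad2 g x \<le> dw x / Z * (2 * grad2 u x + 2 * (\<beta> * \<theta> / 2)\<^sup>2 * ((dp x)\<^sup>2 * (u x)\<^sup>2))"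
    using gX(2)
  proof eventually_elim
    case (elim x)
    note elim
    also have "2 * grad2 u x * (q (d x))\<^sup>2 + 2 * (u x)\<^sup>2 * (q' (d x))\<^sup>2
        = dw x / Z * (2 * grad2 u x + 2 * (\<beta> * \<theta> / 2)\<^sup>2 * ((dp x)\<^sup>2 * (u x)\<^sup>2))"
      unfolding q_d_sq q'_d_sq by (simp add: distrib_left mult_ac)
    finally show ?case .
  qed
  then have "(\<integral>\<^sup>+x. ennreal (grad2 g x) \<partial>lborel)
      \<le> (\<integral>\<^sup>+x. ennreal (dw x / Z * (2 * grad2 u x + 2 * (\<beta> * \<theta> / 2)\<^sup>2 * ((dp x)\<^sup>2 * (u x)\<^sup>2))) \<partial>lborel)"
    by (intro nn_integral_mono_AE) (auto elim!: eventually_mono intro: ennreal_leI)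
  also have "\<dots> = (\<integral>\<^sup>+x. ennreal (2 * grad2 u x + 2 * (\<beta> * \<theta> / 2)\<^sup>2 * ((dp x)\<^sup>2 * (u x)\<^sup>2)) \<partial>\<mu>)"
    by (rule nn_integral_mu[symmetric]) simp
  also have "\<dots> = ennreal 2 * (\<integral>\<^sup>+x. ennreal (grad2 u x) \<partial>\<mu>)
        + ennreal (2 * (\<beta> * \<theta> / 2)\<^sup>2) * (\<integral>\<^sup>+x. ennreal ((dp x)\<^sup>2 * (u x)\<^sup>2) \<partial>\<mu>)"
    by (intro nn_integral_linear) auto
  finally show "(\<integral>\<^sup>+x. ennreal (grad2 g x) \<partial>lborel)
      \<le> ennreal 2 * (\<integral>\<^sup>+x. ennreal (grad2 u x) \<partial>\<mu>)
        + ennreal (2 * (\<beta> * \<theta> / 2)\<^sup>2) * (\<integral>\<^sup>+x. ennreal ((dp x)\<^sup>2 * (u x)\<^sup>2) \<partial>\<mu>)" .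
qed

lemma d_powr_expo: "(\<beta> * d x powr \<theta>) powr expo = \<beta> powr expo * (dp x)\<^sup>2"
proof -
  have "\<theta> * expo = (\<theta> - 1) + (\<theta> - 1)" using theta by (simp add: expo_def)
  then have "(d x powr \<theta>) powr expo = (dp x)\<^sup>2"
    by (simp only: powr_powr powr_add power2_eq_square)
  then show ?thesis using beta by (simp add: powr_mult)
qed

text \<open>With V = \<beta>d^\<theta> one has u^2 = Z g^2 e^V, hence 1 + u^2 \<le> (1 + g^2)(1 +
  Z)e^V. The logarithm becomes a sum of three terms, separated by subadditivity of the power; the
  one with V yields the U-bound weight. \<open>Y\<close> is a free parameter here.\<close>

lemma entropy_integrand_le:
  fixes u Y :: real and x :: 'a
  assumes Y: "0 \<le> Y"
  defines "g \<equiv> u * q (d x)"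
  shows "dw x / Z * (u\<^sup>2 * ln (1 + u\<^sup>2) powr expo)
    \<le> (1 + 2 / e * ln (1 + Y) + ln (1 + Z) powr expo) * g\<^sup>2 + 2 / e / (1 + Y) * (g\<^sup>2 + \<bar>g\<bar> powr (2 + e))
      + \<beta> powr expo * (dw x / Z * ((dp x)\<^sup>2 * u\<^sup>2))"
proof -
  let ?V = "\<beta> * d x powr \<theta>"
  have V: "0 \<le> ?V" using beta by simp
  have gsq: "g\<^sup>2 = dw x / Z * u\<^sup>2" by (simp only: g_def power_mult_distrib q_d_sq mult.commute)
  have usq: "u\<^sup>2 = g\<^sup>2 * Z * exp ?V"
    unfolding gsq weight_def using Z by (simp add: exp_minus)
  have g0: "0 < 1 + g\<^sup>2" by (simp add: add_pos_nonneg)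
  have "1 + u\<^sup>2 \<le> exp ?V + g\<^sup>2 * Z * exp ?V" unfolding usq using V by simp
  also have "\<dots> = (1 + g\<^sup>2 * Z) * exp ?V" by (simp add: algebra_simps)
  also have "\<dots> \<le> ((1 + g\<^sup>2) * (1 + Z)) * exp ?V"
    using Z by (intro mult_right_mono) (auto simp: algebra_simps)
  finally have "ln (1 + u\<^sup>2) \<le> ln (((1 + g\<^sup>2) * (1 + Z)) * exp ?V)" by (intro ln_mono) (auto intro: add_pos_nonneg)
  also have "\<dots> = ln (1 + g\<^sup>2) + (ln (1 + Z) + ?V)" using Z g0 by (simp add: ln_mult_pos)
  finally have "ln (1 + u\<^sup>2) powr expo \<le> (ln (1 + g\<^sup>2) + (ln (1 + Z) + ?V)) powr expo"
    using expo_bounds by (intro powr_mono2) auto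
  also have "\<dots> \<le> ln (1 + g\<^sup>2) powr expo + (ln (1 + Z) + ?V) powr expo"
    using Z V expo_bounds by (intro powr_subadditive) auto
  also have "(ln (1 + Z) + ?V) powr expo \<le> ln (1 + Z) powr expo + ?V powr expo"
    using Z V expo_bounds by (intro powr_subadditive) auto
  finally have "ln (1 + u\<^sup>2) powr expo \<le> ln (1 + g\<^sup>2) powr expo + ln (1 + Z) powr expo + \<beta> powr expo * (dp x)\<^sup>2"
    by (simp add: d_powr_expo)
  then have "g\<^sup>2 * ln (1 + u\<^sup>2) powr expo \<le> g\<^sup>2 * (ln (1 + g\<^sup>2) powr expo + ln (1 + Z) powr expo + \<beta> powr expo * (dp x)\<^sup>2)"
    by (rule mult_left_mono) simp
  moreover have "g\<^sup>2 * ln (1 + g\<^sup>2) powr expo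
    \<le> (1 + 2 / e * ln (1 + Y)) * g\<^sup>2 + 2 / e / (1 + Y) * (g\<^sup>2 + \<bar>g\<bar> powr (2 + e))"
    using expo_bounds e Y by (intro sq_log_powr_le) auto
  moreover have "dw x / Z * (u\<^sup>2 * ln (1 + u\<^sup>2) powr expo) = g\<^sup>2 * ln (1 + u\<^sup>2) powr expo"
    "\<beta> powr expo * (dw x / Z * ((dp x)\<^sup>2 * u\<^sup>2)) = g\<^sup>2 * (\<beta> powr expo * (dp x)\<^sup>2)"
    unfolding gsq by simp_all
  ultimately show ?thesis by (simp add: algebra_simps)
qed

text \<open>Stated for \<mu>(u^2) = 1 because ln(1 + u^2) is not homogeneous; B stands for the
  multiple of \<mu>(u^2) still to be removed. The energy i enters linearly, so it survives the
  rescaling in the tightening step.\<close>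

lemma defective_inequality:
  obtains A B where "0 \<le> A" "0 \<le> B"
    "\<And>u i. u \<in> classL X \<Longrightarrow> (\<integral>\<^sup>+x. ennreal ((u x)\<^sup>2) \<partial>\<mu>) = 1 \<Longrightarrow> 0 \<le> i \<Longrightarrow>
      (\<integral>\<^sup>+x. ennreal (grad2 u x) \<partial>\<mu>) = ennreal i \<Longrightarrow>
      (\<integral>\<^sup>+x. ennreal ((u x)\<^sup>2 * ln (1 + (u x)\<^sup>2) powr expo) \<partial>\<mu>) \<le> ennreal (A * i + B)"
proof -
  obtain A1 B1 where AB: "0 \<le> A1" "0 \<le> B1"
    "\<And>f. f \<in> classL X \<Longrightarrow> (\<integral>\<^sup>+x. ennreal ((dp x)\<^sup>2 * (f x)\<^sup>2) \<partial>\<mu>)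
      \<le> ennreal A1 * (\<integral>\<^sup>+x. ennreal (grad2 f x) \<partial>\<mu>) + ennreal B1 * (\<integral>\<^sup>+x. ennreal ((f x)\<^sup>2) \<partial>\<mu>)"
    using U_bound_mu by blast
  define b where "b = 2 * (\<beta> * \<theta> / 2)\<^sup>2"
  define p where "p = (2 + e) / 2"
  \<comment> \<open>In A and B, 2/e comes from the logarithmic estimate, p from ln(1 + Y) \<le> p
    Y^(1/p), C and D from Sobolev, 2 and b from the energy of \<open>?g\<close>, and the terms with
    \<beta> powr expo from the logarithm of the density.\<close>
  define A where "A = 2 / e * (p * (C * (2 + b * A1))) + \<beta> powr expo * A1"
  define B where "B = 1 + ln (1 + Z) powr expo + 2 / e * (p * (C * (b * B1) + D)) + 2 / e + \<beta> powr expo * B1"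
  have b: "0 \<le> b" by (simp add: b_def)
  have p: "1 \<le> p" "1 / p = 2 / (2 + e)" using e by (auto simp: p_def)
  have A: "0 \<le> A" and B: "0 \<le> B"
    unfolding A_def B_def using AB b p e CD
    by (auto intro!: add_nonneg_nonneg mult_nonneg_nonneg divide_nonneg_nonneg)
  show ?thesis
  proof (rule that[OF A B])
    fix u i
    assume u: "u \<in> classL X" and u1: "(\<integral>\<^sup>+x. ennreal ((u x)\<^sup>2) \<partial>\<mu>) = 1" and i: "0 \<le> i"
      and I: "(\<integral>\<^sup>+x. ennreal (grad2 u x) \<partial>\<mu>) = ennreal i"
    let ?g = "\<lambda>x. u x * q (d x)"
    have [measurable]: "u \<in> borel_measurable borel" "(\<lambda>x. q (d x)) \<in> borel_measurable borel"
      by (intro borel_measurable_continuous_onI classL_continuous[OF u]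
          continuous_on_compose2[OF DERIV_continuous_on_UNIV[OF q_deriv] d_cont] subset_UNIV)+
    define w where "w = A1 * i + B1"
    have w: "0 \<le> w" using AB i by (simp add: w_def)
    have Q: "(\<integral>\<^sup>+x. ennreal ((dp x)\<^sup>2 * (u x)\<^sup>2) \<partial>\<mu>) \<le> ennreal w"
      using AB(3)[OF u] AB(1,2) i by (simp add: u1 I w_def ennreal_mult)
    define j where "j = 2 * i + b * w"
    have j: "0 \<le> j" using i b w by (simp add: j_def)
    have J: "(\<integral>\<^sup>+x. ennreal (grad2 ?g x) \<partial>lborel) \<le> ennreal j"
    proof -
      have "(\<integral>\<^sup>+x. ennreal (grad2 ?g x) \<partial>lborel) \<le> ennreal 2 * ennreal i + ennreal b * ennreal w"
        using ground_state_transform(2)[OF u] mult_left_mono[OF Q, of "ennreal b"]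
        unfolding I b_def by (meson add_left_mono order_trans zero_le)
      then show ?thesis using i b w by (simp add: j_def ennreal_mult)
    qed
    have g1: "(\<integral>\<^sup>+x. ennreal ((?g x)\<^sup>2) \<partial>lborel) = 1"
      using ground_state_transform(3)[OF u] u1 by simp
    let ?Y = "\<integral>\<^sup>+x. ennreal (\<bar>?g x\<bar> powr (2 + e)) \<partial>lborel"
    have "ennpowr ?Y (2 / (2 + e)) \<le> ennreal C * (\<integral>\<^sup>+x. ennreal (grad2 ?g x) \<partial>lborel) + ennreal D * 1"
      using sobolev[OF ground_state_transform(1)[OF u]] g1 by simp
    also have "\<dots> \<le> ennreal C * ennreal j + ennreal D * 1"
      by (intro add_right_mono mult_left_mono J) simp
    also have "\<dots> = ennreal (C * j + D)" using CD j by (simp add: ennreal_mult)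
    finally have Ys: "ennpowr ?Y (2 / (2 + e)) \<le> ennreal (C * j + D)" .
    \<comment> \<open>\<open>ennpowr\<close> sends infinity to infinity, so the finite right-hand
      side forces integrability of |g|^(2+e).\<close>
    then have "?Y \<noteq> \<infinity>" by (auto simp: ennpowr_def top_unique)
    define Y where "Y = enn2real ?Y"
    have Y: "0 \<le> Y" "?Y = ennreal Y"
      unfolding Y_def using \<open>?Y \<noteq> \<infinity>\<close> by (simp_all add: less_top)
    have "ennpowr ?Y (2 / (2 + e)) = ennreal (Y powr (1 / p))"
      by (simp only: ennpowr_def if_not_P[OF \<open>?Y \<noteq> \<infinity>\<close>] Y_def p(2))
    then have "ennreal (Y powr (1 / p)) \<le> ennreal (C * j + D)" using Ys by (simp only:)
    then have Yp: "Y powr (1 / p) \<le> C * j + D"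
      by (rule ennreal_le_iff[THEN iffD1, rotated]) (use CD j in simp)
    define k0 where "k0 = 1 + 2 / e * ln (1 + Y) + ln (1 + Z) powr expo"
    define k1 where "k1 = 2 / e / (1 + Y)"
    have k: "0 \<le> k0" "0 \<le> k1"
      unfolding k0_def k1_def using e Y(1) by (auto intro!: add_nonneg_nonneg)
    have "(\<integral>\<^sup>+x. ennreal ((u x)\<^sup>2 * ln (1 + (u x)\<^sup>2) powr expo) \<partial>\<mu>)
        = (\<integral>\<^sup>+x. ennreal (dw x / Z * ((u x)\<^sup>2 * ln (1 + (u x)\<^sup>2) powr expo)) \<partial>lborel)"
      by (rule nn_integral_mu) simp
    also have "\<dots> \<le> (\<integral>\<^sup>+x. ennreal (k0 * (?g x)\<^sup>2 + k1 * ((?g x)\<^sup>2 + \<bar>?g x\<bar> powr (2 + e)))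
        + ennreal (\<beta> powr expo) * ennreal (dw x / Z * ((dp x)\<^sup>2 * (u x)\<^sup>2)) \<partial>lborel)"
    proof (rule nn_integral_mono)
      fix x
      have nn: "0 \<le> k0 * (?g x)\<^sup>2 + k1 * ((?g x)\<^sup>2 + \<bar>?g x\<bar> powr (2 + e))"
        "0 \<le> dw x / Z * ((dp x)\<^sup>2 * (u x)\<^sup>2)"
        using k Z less_imp_le[OF dw_pos[of x]] by (auto intro!: add_nonneg_nonneg mult_nonneg_nonneg divide_nonneg_nonneg)
      have "ennreal (dw x / Z * ((u x)\<^sup>2 * ln (1 + (u x)\<^sup>2) powr expo))
          \<le> ennreal (k0 * (?g x)\<^sup>2 + k1 * ((?g x)\<^sup>2 + \<bar>?g x\<bar> powr (2 + e))
            + \<beta> powr expo * (dw x / Z * ((dp x)\<^sup>2 * (u x)\<^sup>2)))"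
        unfolding k0_def k1_def by (intro ennreal_leI entropy_integrand_le Y)
      also have "\<dots> = ennreal (k0 * (?g x)\<^sup>2 + k1 * ((?g x)\<^sup>2 + \<bar>?g x\<bar> powr (2 + e)))
            + ennreal (\<beta> powr expo * (dw x / Z * ((dp x)\<^sup>2 * (u x)\<^sup>2)))"
        by (rule ennreal_plus[OF nn(1) mult_nonneg_nonneg[OF powr_ge_zero nn(2)]])
      finally show "ennreal (dw x / Z * ((u x)\<^sup>2 * ln (1 + (u x)\<^sup>2) powr expo))
          \<le> ennreal (k0 * (?g x)\<^sup>2 + k1 * ((?g x)\<^sup>2 + \<bar>?g x\<bar> powr (2 + e)))
        + ennreal (\<beta> powr expo) * ennreal (dw x / Z * ((dp x)\<^sup>2 * (u x)\<^sup>2))"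
        by (simp only: ennreal_mult'[OF powr_ge_zero])
    qed
    also have "\<dots> = (\<integral>\<^sup>+x. ennreal (k0 * (?g x)\<^sup>2 + k1 * ((?g x)\<^sup>2 + \<bar>?g x\<bar> powr (2 + e))) \<partial>lborel)
        + ennreal (\<beta> powr expo) * (\<integral>\<^sup>+x. ennreal ((dp x)\<^sup>2 * (u x)\<^sup>2) \<partial>\<mu>)"
      by (simp add: nn_integral_add nn_integral_cmult nn_integral_mu)
    also have "(\<integral>\<^sup>+x. ennreal (k0 * (?g x)\<^sup>2 + k1 * ((?g x)\<^sup>2 + \<bar>?g x\<bar> powr (2 + e))) \<partial>lborel)
        = ennreal k0 * 1 + ennreal k1 * (\<integral>\<^sup>+x. ennreal ((?g x)\<^sup>2 + \<bar>?g x\<bar> powr (2 + e)) \<partial>lborel)"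
      using k by (subst nn_integral_linear) (auto simp: g1)
    also have "(\<integral>\<^sup>+x. ennreal ((?g x)\<^sup>2 + \<bar>?g x\<bar> powr (2 + e)) \<partial>lborel) = 1 + ennreal Y"
      using nn_integral_linear[of "\<lambda>x. (?g x)\<^sup>2" lborel "\<lambda>x. \<bar>?g x\<bar> powr (2 + e)" 1 1] g1 Y(2) by simp
    also have "ennreal k0 * 1 + ennreal k1 * (1 + ennreal Y) + ennreal (\<beta> powr expo) * (\<integral>\<^sup>+x. ennreal ((dp x)\<^sup>2 * (u x)\<^sup>2) \<partial>\<mu>)
        \<le> ennreal k0 * 1 + ennreal k1 * (1 + ennreal Y) + ennreal (\<beta> powr expo) * ennreal w"
      by (intro add_left_mono mult_left_mono Q) simp
    also have "\<dots> = ennreal (k0 + k1 * (1 + Y) + \<beta> powr expo * w)"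
      using k Y(1) w by (simp add: ennreal_mult)
    also have "\<dots> \<le> ennreal (A * i + B)"
    proof (rule ennreal_leI)
      have "ln (1 + Y) \<le> p * Y powr (1 / p)" by (rule ln_one_plus_le_powr[OF Y(1) p(1)])
      also have "\<dots> \<le> p * (C * j + D)" using p(1) by (intro mult_left_mono Yp) simp
      finally have "2 / e * ln (1 + Y) \<le> 2 / e * (p * (C * j + D))" using e by (intro mult_left_mono) auto
      moreover have "k1 * (1 + Y) = 2 / e"
        using Y(1) k1_def nonzero_eq_divide_eq[of "1 + Y" k1 "2 / e"] by simp
      moreover have "A * i + B = 1 + 2 / e * (p * (C * j + D)) + ln (1 + Z) powr expo + 2 / e + \<beta> powr expo * w"
        by (simp add: A_def B_def j_def w_def algebra_simps add_divide_distrib)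
      ultimately show "k0 + k1 * (1 + Y) + \<beta> powr expo * w \<le> A * i + B" by (simp add: k0_def)
    qed
    finally show "(\<integral>\<^sup>+x. ennreal ((u x)\<^sup>2 * ln (1 + (u x)\<^sup>2) powr expo) \<partial>\<mu>) \<le> ennreal (A * i + B)" .
  qed
qed

end

section \<open>Tightening\<close>

context coercive_setting
begin

text \<open>In the Rothaus estimate with a the mean of f and h = f - a, all errors are multiples of
  the variance v or v times the entropy of h / sqrt v. The defect B thus comes multiplied by v, and
  the Poincare inequality gives v \<le> i / M.\<close>

lemma tight_inequality:
  assumes prob: "prob_space \<mu>" and M: "0 < M"
    and poincare: "\<And>f. f \<in> classL X \<Longrightarrow> (\<integral>\<^sup>+x. ennreal ((f x)\<^sup>2) \<partial>\<mu>) < \<infinity> \<Longrightarrow>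
           ennreal M * (\<integral>\<^sup>+x. ennreal ((f x - (\<integral>y. f y \<partial>\<mu>))\<^sup>2) \<partial>\<mu>) \<le> (\<integral>\<^sup>+x. ennreal (grad2 f x) \<partial>\<mu>)"
  shows "\<exists>c>0. \<forall>f\<in>classL X. (\<integral>\<^sup>+x. ennreal ((f x)\<^sup>2) \<partial>\<mu>) < \<infinity> \<longrightarrow>
           enn2ereal (\<integral>\<^sup>+x. ennreal (Phi \<theta> ((f x)\<^sup>2)) \<partial>\<mu>) - ereal (Phi \<theta> (\<integral>x. (f x)\<^sup>2 \<partial>\<mu>))
           \<le> ereal c * enn2ereal (\<integral>\<^sup>+x. ennreal (grad2 f x) \<partial>\<mu>)"
proof -
  interpret prob_space \<mu> by (rule prob)
  obtain A B where AB: "0 \<le> A" "0 \<le> B"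
    and defective: "\<And>u i. u \<in> classL X \<Longrightarrow> (\<integral>\<^sup>+x. ennreal ((u x)\<^sup>2) \<partial>\<mu>) = 1 \<Longrightarrow> 0 \<le> i \<Longrightarrow>
      (\<integral>\<^sup>+x. ennreal (grad2 u x) \<partial>\<mu>) = ennreal i \<Longrightarrow>
      (\<integral>\<^sup>+x. ennreal ((u x)\<^sup>2 * ln (1 + (u x)\<^sup>2) powr expo) \<partial>\<mu>) \<le> ennreal (A * i + B)"
    using defective_inequality by blast
  \<comment> \<open>36 v is the integral of 18 (h^2 + v), and 4 is the factor of the last Rothaus
    term; v is then replaced by i / M.\<close>
  define c where "c = 36 / M + 4 * (A + B / M) + 1"
  have c: "0 < c" using M AB by (simp add: c_def add_nonneg_pos)
  have Phi: "Phi \<theta> x = x * ln (1 + x) powr expo" for x by (simp add: Phi_def expo_def)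
  have main: "enn2ereal (\<integral>\<^sup>+x. ennreal (Phi \<theta> ((f x)\<^sup>2)) \<partial>\<mu>) - ereal (Phi \<theta> (\<integral>x. (f x)\<^sup>2 \<partial>\<mu>))
           \<le> ereal c * enn2ereal (\<integral>\<^sup>+x. ennreal (grad2 f x) \<partial>\<mu>)"
    if f: "f \<in> classL X" and fin: "(\<integral>\<^sup>+x. ennreal ((f x)\<^sup>2) \<partial>\<mu>) < \<infinity>" for f
  proof (cases "(\<integral>\<^sup>+x. ennreal (grad2 f x) \<partial>\<mu>) = \<infinity>")
    case True
    then show ?thesis using c by simp
  next
    case False
    define i where "i = enn2real (\<integral>\<^sup>+x. ennreal (grad2 f x) \<partial>\<mu>)"
    have i: "0 \<le> i" "(\<integral>\<^sup>+x. ennreal (grad2 f x) \<partial>\<mu>) = ennreal i"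
      unfolding i_def using False by (simp_all add: less_top)
    have cf: "continuous_on UNIV f" by (rule classL_continuous[OF f])
    have [measurable]: "f \<in> borel_measurable borel" by (rule borel_measurable_continuous_onI[OF cf])
    have int_f2: "integrable \<mu> (\<lambda>x. (f x)\<^sup>2)"
      using fin by (intro integrableI_nonneg) auto
    have int_f: "integrable \<mu> f"
    proof (rule Bochner_Integration.integrable_bound)
      show "integrable \<mu> (\<lambda>x. 1 + (f x)\<^sup>2)" using int_f2 by simp
      have "\<bar>y\<bar> \<le> 1 + y\<^sup>2" for y :: real
        using zero_le_power2[of "\<bar>y\<bar> - 1"] by (simp add: power2_diff)
      then show "AE x in \<mu>. norm (f x) \<le> norm (1 + (f x)\<^sup>2)" by (intro AE_I2) simp
    qed simp
    define a where "a = (\<integral>x. f x \<partial>\<mu>)"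
    define h where "h x = f x - a" for x
    have [measurable]: "h \<in> borel_measurable borel" unfolding h_def[abs_def] by simp
    have fh: "f x = a + h x" for x by (simp add: h_def)
    have int_h: "integrable \<mu> h" unfolding h_def[abs_def] using int_f by simp
    have h0: "(\<integral>x. h x \<partial>\<mu>) = 0" unfolding h_def using int_f prob_space by (simp add: a_def)
    have h2: "(h x)\<^sup>2 = (f x)\<^sup>2 - 2 * a * f x + a\<^sup>2" for x by (simp add: h_def power2_diff)
    have int_h2: "integrable \<mu> (\<lambda>x. (h x)\<^sup>2)" unfolding h2 using int_f int_f2 by simp
    define v where "v = (\<integral>x. (h x)\<^sup>2 \<partial>\<mu>)"
    have v0: "0 \<le> v" unfolding v_def by simp
    have vnn: "(\<integral>\<^sup>+x. ennreal ((h x)\<^sup>2) \<partial>\<mu>) = ennreal v"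
      unfolding v_def by (rule nn_integral_eq_integral[OF int_h2]) simp
    have m: "(\<integral>x. (f x)\<^sup>2 \<partial>\<mu>) = a\<^sup>2 + v"
    proof -
      have "v = (\<integral>x. (f x)\<^sup>2 \<partial>\<mu>) - 2 * a * a + a\<^sup>2"
        unfolding v_def h2 using int_f int_f2 prob_space by (simp add: a_def)
      then show ?thesis by (simp add: power2_eq_square)
    qed
    have Mv: "M * v \<le> i"
    proof -
      have "ennreal M * ennreal v \<le> ennreal i"
        using poincare[OF f fin] by (simp add: i(2) vnn[symmetric] h_def a_def)
      then show ?thesis using M v0 i(1) by (simp add: ennreal_mult[symmetric])
    qed
    have vi: "v \<le> i / M" using Mv M by (simp add: le_divide_eq mult.commute)
    show ?thesis
    \<comment> \<open>Zero variance means that f equals its mean almost everywhere, and the two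
      entropy terms coincide. The case is separated because the other one divides by v.\<close>
    proof (cases "v = 0")
      case True
      have "AE x in \<mu>. (h x)\<^sup>2 = 0"
        using int_h2 True by (subst integral_nonneg_eq_0_iff_AE[symmetric]) (auto simp: v_def)
      then have "(\<integral>\<^sup>+x. ennreal (Phi \<theta> ((f x)\<^sup>2)) \<partial>\<mu>) = (\<integral>\<^sup>+x. ennreal (Phi \<theta> (a\<^sup>2)) \<partial>\<mu>)"
        by (intro nn_integral_cong_AE) (auto elim!: eventually_mono simp: fh)
      also have "\<dots> = ennreal (Phi \<theta> (a\<^sup>2))" by (simp add: emeasure_space_1)
      finally have "enn2ereal (\<integral>\<^sup>+x. ennreal (Phi \<theta> ((f x)\<^sup>2)) \<partial>\<mu>) = ereal (Phi \<theta> (a\<^sup>2))"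
        by (simp add: Phi)
      then show ?thesis using c i by (simp add: m True)
    next
      case False
      then have v: "0 < v" using v0 by simp
      define u where "u x = 1 / sqrt v * h x" for x
      have usq: "(u x)\<^sup>2 = (h x)\<^sup>2 / v" for x using v by (simp add: u_def power_mult_distrib power_divide)
      have gu: "u \<in> classL X" "AE x in lborel. grad2 u x = 1 / v * grad2 f x"
      proof -
        have cc: "continuous_on UNIV (\<lambda>x::'a. - a)" by (rule continuous_on_const)
        have ld: "loc_deriv (X k) (\<lambda>x. 1 / sqrt v * (f x + - a)) (\<lambda>x. 1 / sqrt v * (distr_deriv (X k) f x + 0))" for k
          by (rule loc_deriv_cmult[OF loc_deriv_add[OF X_smooth cf cc loc_deriv_distr_deriv[OF f] loc_deriv_const[OF X_smooth X_div]]])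
        have cu: "continuous_on UNIV u" unfolding u_def h_def by (intro continuous_intros cf)
        have ld': "loc_deriv (X k) u (\<lambda>x. 1 / sqrt v * distr_deriv (X k) f x)" for k
          using ld[of k] by (simp add: u_def[abs_def] h_def)
        show "u \<in> classL X" using cu ld' by (auto simp: classL_iff)
        have "AE x in lborel. grad2 u x = (\<Sum>k\<in>UNIV. (1 / sqrt v * distr_deriv (X k) f x)\<^sup>2)"
          by (rule grad_norm_sq_AE[OF cu ld'])
        then show "AE x in lborel. grad2 u x = 1 / v * grad2 f x"
        proof eventually_elim
          case (elim x)
          then show ?case
            unfolding grad_norm_sq power_mult_distrib sum_distrib_left[symmetric] using v by (simp add: power_divide)
        qed
      qed
      have [measurable]: "u \<in> borel_measurable borel" unfolding u_def[abs_def] by simp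
      have [measurable]: "(\<lambda>x. grad2 u x) \<in> borel_measurable borel" "(\<lambda>x. grad2 f x) \<in> borel_measurable borel"
        by (intro measurable_grad_norm_sq gu f)+
      have u1: "(\<integral>\<^sup>+x. ennreal ((u x)\<^sup>2) \<partial>\<mu>) = 1"
      proof -
        have "(\<integral>\<^sup>+x. ennreal ((u x)\<^sup>2) \<partial>\<mu>) = (\<integral>\<^sup>+x. ennreal (1 / v) * ennreal ((h x)\<^sup>2) \<partial>\<mu>)"
          unfolding usq using v by (intro nn_integral_cong) (simp add: ennreal_mult'[symmetric])
        also have "\<dots> = ennreal (1 / v) * ennreal v" by (simp add: nn_integral_cmult vnn)
        also have "\<dots> = 1" using v by (simp add: ennreal_mult'[symmetric])
        finally show ?thesis .
      qed
      have I: "(\<integral>\<^sup>+x. ennreal (grad2 u x) \<partial>\<mu>) = ennreal (i / v)"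
      proof -
        have "(\<integral>\<^sup>+x. ennreal (grad2 u x) \<partial>\<mu>) = (\<integral>\<^sup>+x. ennreal (dw x / Z * grad2 u x) \<partial>lborel)"
          by (rule nn_integral_mu) simp
        also have "\<dots> = (\<integral>\<^sup>+x. ennreal (dw x / Z * (1 / v * grad2 f x)) \<partial>lborel)"
          using gu(2) by (intro nn_integral_cong_AE) (auto elim!: eventually_mono simp: mult.commute)
        also have "\<dots> = (\<integral>\<^sup>+x. ennreal (1 / v * grad2 f x) \<partial>\<mu>)"
          by (rule nn_integral_mu[symmetric]) simp
        also have "\<dots> = ennreal (1 / v) * ennreal i"
          unfolding i(2)[symmetric] using v by (simp add: nn_integral_cmult[symmetric] ennreal_mult'[symmetric])
        also have "\<dots> = ennreal (i / v)" using v by (simp add: ennreal_mult'[symmetric])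
        finally show ?thesis .
      qed
      let ?W = "\<lambda>x. (h x)\<^sup>2 * ln (1 + (h x)\<^sup>2 / v) powr expo"
      have W0: "0 \<le> ?W x" for x by simp
      have "(\<integral>\<^sup>+x. ennreal (?W x) \<partial>\<mu>) = (\<integral>\<^sup>+x. ennreal v * ennreal ((u x)\<^sup>2 * ln (1 + (u x)\<^sup>2) powr expo) \<partial>\<mu>)"
        unfolding usq using v by (intro nn_integral_cong) (simp add: ennreal_mult'[symmetric])
      also have "\<dots> = ennreal v * (\<integral>\<^sup>+x. ennreal ((u x)\<^sup>2 * ln (1 + (u x)\<^sup>2) powr expo) \<partial>\<mu>)"
        by (rule nn_integral_cmult) simp
      \<comment> \<open>Undoing the normalisation keeps the energy term at A i and turns the defect
        into B v.\<close>
      also have "\<dots> \<le> ennreal v * ennreal (A * (i / v) + B)"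
        by (intro mult_left_mono defective gu u1 I) (use i v in auto)
      also have "\<dots> = ennreal (A * i + B * v)"
        using v by (simp add: ennreal_mult'[symmetric] algebra_simps)
      finally have Wle: "(\<integral>\<^sup>+x. ennreal (?W x) \<partial>\<mu>) \<le> ennreal (A * i + B * v)" .
      \<comment> \<open>Integrability allows the passage to Bochner integrals, where the Rothaus
        term of variable sign can be integrated.\<close>
      have int_W: "integrable \<mu> ?W"
        by (rule integrableI_nonneg) (use Wle W0 in \<open>auto simp: le_less_trans[OF _ ennreal_less_top]\<close>)
      have WI: "(\<integral>x. ?W x \<partial>\<mu>) \<le> A * i + B * v"
      proof (rule ennreal_le_iff[THEN iffD1])
        show "0 \<le> A * i + B * v" using AB i(1) v0 by simp
        show "ennreal (\<integral>x. ?W x \<partial>\<mu>) \<le> ennreal (A * i + B * v)"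
          unfolding nn_integral_eq_integral[OF int_W AE_I2[OF W0], symmetric] by (rule Wle)
      qed
      obtain l where l: "0 \<le> l" "l \<le> 1" "\<And>y. (a + y)\<^sup>2 * ln (1 + (a + y)\<^sup>2) powr expo
          \<le> (a + y)\<^sup>2 * ln (1 + (a\<^sup>2 + v)) powr expo + l * ((a + y)\<^sup>2 - (a\<^sup>2 + v)) + 18 * (y\<^sup>2 + v)
            + 4 * (y\<^sup>2 * ln (1 + y\<^sup>2 / v) powr expo)"
        using rothaus_pointwise[OF v expo_bounds, of a] by blast
      let ?R = "\<lambda>x. (f x)\<^sup>2 * ln (1 + (a\<^sup>2 + v)) powr expo + l * ((f x)\<^sup>2 - (a\<^sup>2 + v)) + 18 * ((h x)\<^sup>2 + v) + 4 * ?W x"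
      have PR: "Phi \<theta> ((f x)\<^sup>2) \<le> ?R x" for x
        using l(3)[of "h x"] by (simp add: Phi fh)
      have P0: "0 \<le> Phi \<theta> ((f x)\<^sup>2)" for x by (simp add: Phi)
      have int_R: "integrable \<mu> ?R" using int_f2 int_h2 int_W by simp
      \<comment> \<open>The term with l integrates to 0 because a^2 + v is the second moment of
        f.\<close>
      have RI: "(\<integral>x. ?R x \<partial>\<mu>) \<le> Phi \<theta> (a\<^sup>2 + v) + c * i"
      proof -
        have "(\<integral>x. ?R x \<partial>\<mu>) = (a\<^sup>2 + v) * ln (1 + (a\<^sup>2 + v)) powr expo + 36 * v + 4 * (\<integral>x. ?W x \<partial>\<mu>)"
          using int_f2 int_h2 int_W prob_space by (simp add: m v_def[symmetric])
        also have "\<dots> \<le> Phi \<theta> (a\<^sup>2 + v) + (36 * v + 4 * (A * i + B * v))"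
          using WI by (simp add: Phi)
        also have "36 * v + 4 * (A * i + B * v) \<le> 36 * (i / M) + 4 * (A * i + B * (i / M))"
          using vi AB by (intro add_mono mult_left_mono) auto
        also have "\<dots> \<le> c * i" using i(1) by (simp add: c_def algebra_simps)
        finally show ?thesis by simp
      qed
      have "(\<integral>\<^sup>+x. ennreal (Phi \<theta> ((f x)\<^sup>2)) \<partial>\<mu>) \<le> (\<integral>\<^sup>+x. ennreal (?R x) \<partial>\<mu>)"
        by (intro nn_integral_mono ennreal_leI PR)
      also have "\<dots> = ennreal (\<integral>x. ?R x \<partial>\<mu>)"
        by (rule nn_integral_eq_integral[OF int_R]) (use order_trans[OF P0 PR] in auto)
      also have "\<dots> \<le> ennreal (Phi \<theta> (a\<^sup>2 + v) + c * i)" by (rule ennreal_leI[OF RI])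
      finally have "enn2ereal (\<integral>\<^sup>+x. ennreal (Phi \<theta> ((f x)\<^sup>2)) \<partial>\<mu>) \<le> enn2ereal (ennreal (Phi \<theta> (a\<^sup>2 + v) + c * i))"
        by (simp only: less_eq_ennreal.rep_eq)
      also have "\<dots> = ereal (Phi \<theta> (a\<^sup>2 + v) + c * i)"
        using c i(1) v0 by (intro enn2ereal_ennreal add_nonneg_nonneg mult_nonneg_nonneg) (auto simp: Phi)
      finally have "enn2ereal (\<integral>\<^sup>+x. ennreal (Phi \<theta> ((f x)\<^sup>2)) \<partial>\<mu>) \<le> ereal (c * i) + ereal (Phi \<theta> (a\<^sup>2 + v))"
        by (simp add: add.commute)
      then show ?thesis
        unfolding m i(2) using i(1) by (simp add: ereal_minus_le)
    qed
  qed
  with c show ?thesis by blast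
qed

end

text \<open>The subtraction takes place in \<open>ereal\<close> because the first term may be
  infinite, while the second is a real number. \<open>Z\<close> is determined by requiring total
  mass one.\<close>

theorem theorem4p3:
  fixes X :: "'k::finite \<Rightarrow> real ^ 'n \<Rightarrow> real ^ 'n"
    and \<rho> :: "real ^ 'n \<Rightarrow> real ^ 'n \<Rightarrow> real"
    and d :: "real ^ 'n \<Rightarrow> real"
    and \<theta> \<beta> Z \<sigma> K \<epsilon> \<epsilon>\<^sub>0 C D M :: real
  assumes X_smooth: "\<And>i. smooth (X i)"
    and X_div: "\<And>i x. divergence (X i) x = 0"
    and metric: "Metric_space UNIV \<rho>"
    and d_def: "\<And>x. d x = \<rho> 0 x"
    and d_L: "d \<in> classL X"
    and balls: "\<And>R. compact {x. d x \<le> R}"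
    and theta: "1 \<le> \<theta>" "\<theta> \<le> 2"
    and beta: "0 < \<beta>"
    and Z: "0 < Z"
    and mu_prob: "prob_space (mu_theta d \<beta> Z \<theta>)"
    and sigma: "1 \<le> \<sigma>"
    and grad_d: "AE x in lborel. 1 / \<sigma> \<le> grad_norm X d x \<and> grad_norm X d x \<le> 1"
    and K: "0 \<le> K"
    and eps: "0 \<le> \<epsilon>" "\<epsilon> < 1 / \<sigma>\<^sup>2"
    and lap_d: "distr_laplacian_le X {x. d x > 1} d
                  (\<lambda>x. K + \<beta> * \<theta> * \<epsilon> * d x powr (\<theta> - 1))"
    and sobolev_const: "0 < \<epsilon>\<^sub>0" "\<epsilon>\<^sub>0 < 1" "0 < C" "0 < D"
    and sobolev: "\<And>g. g \<in> classL X \<Longrightarrow>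
           ennpowr (\<integral>\<^sup>+x. ennreal (\<bar>g x\<bar> powr (2 + \<epsilon>\<^sub>0)) \<partial>lborel) (2 / (2 + \<epsilon>\<^sub>0))
             \<le> ennreal C * (\<integral>\<^sup>+x. ennreal ((grad_norm X g x)\<^sup>2) \<partial>lborel)
               + ennreal D * (\<integral>\<^sup>+x. ennreal ((g x)\<^sup>2) \<partial>lborel)"
    and M: "0 < M"
    and poincare: "\<And>f. f \<in> classL X \<Longrightarrow>
           (\<integral>\<^sup>+x. ennreal ((f x)\<^sup>2) \<partial>(mu_theta d \<beta> Z \<theta>)) < \<infinity> \<Longrightarrow>
           ennreal M * (\<integral>\<^sup>+x. ennreal ((f x - (\<integral>y. f y \<partial>(mu_theta d \<beta> Z \<theta>)))\<^sup>2) \<partial>(mu_theta d \<beta> Z \<theta>))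
             \<le> (\<integral>\<^sup>+x. ennreal ((grad_norm X f x)\<^sup>2) \<partial>(mu_theta d \<beta> Z \<theta>))"
  shows "\<exists>c>0. \<forall>f\<in>classL X.
           (\<integral>\<^sup>+x. ennreal ((f x)\<^sup>2) \<partial>(mu_theta d \<beta> Z \<theta>)) < \<infinity> \<longrightarrow>
           enn2ereal (\<integral>\<^sup>+x. ennreal (Phi \<theta> ((f x)\<^sup>2)) \<partial>(mu_theta d \<beta> Z \<theta>))
             - ereal (Phi \<theta> (\<integral>x. (f x)\<^sup>2 \<partial>(mu_theta d \<beta> Z \<theta>)))
           \<le> ereal c * enn2ereal (\<integral>\<^sup>+x. ennreal ((grad_norm X f x)\<^sup>2) \<partial>(mu_theta d \<beta> Z \<theta>))"
proof (cases "\<theta> = 1")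
  case True
  let ?\<mu> = "mu_theta d \<beta> Z \<theta>"
  have Phi: "Phi \<theta> (y\<^sup>2) = y\<^sup>2" for y
  proof (cases "y = 0")
    case False
    then have "0 < ln (1 + y\<^sup>2)" by (intro ln_gt_zero) simp
    then show ?thesis using True by (simp add: Phi_def)
  qed (simp add: Phi_def)
  show ?thesis
  proof (intro exI[of _ 1] conjI ballI impI)
    fix f assume f: "f \<in> classL X" and fin: "(\<integral>\<^sup>+x. ennreal ((f x)\<^sup>2) \<partial>?\<mu>) < \<infinity>"
    have "f \<in> borel_measurable borel" by (rule borel_measurable_continuous_onI[OF classL_continuous[OF f]])
    then have "f \<in> borel_measurable ?\<mu>" by (simp add: mu_theta_def)
    then have int: "integrable ?\<mu> (\<lambda>x. (f x)\<^sup>2)" using fin by (intro integrableI_nonneg) auto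
    have "(\<integral>\<^sup>+x. ennreal ((f x)\<^sup>2) \<partial>?\<mu>) = ennreal (\<integral>x. (f x)\<^sup>2 \<partial>?\<mu>)"
      by (rule nn_integral_eq_integral[OF int]) simp
    moreover have nn: "0 \<le> (\<integral>x. (f x)\<^sup>2 \<partial>?\<mu>)" by simp
    \<comment> \<open>\<open>Phi\<close> has been evaluated at squares only, hence the square root
      of the second moment.\<close>
    moreover have "Phi \<theta> (\<integral>x. (f x)\<^sup>2 \<partial>?\<mu>) = (\<integral>x. (f x)\<^sup>2 \<partial>?\<mu>)"
      using Phi[of "sqrt (\<integral>x. (f x)\<^sup>2 \<partial>?\<mu>)"] nn by simp
    ultimately show "enn2ereal (\<integral>\<^sup>+x. ennreal (Phi \<theta> ((f x)\<^sup>2)) \<partial>?\<mu>) - ereal (Phi \<theta> (\<integral>x. (f x)\<^sup>2 \<partial>?\<mu>))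
        \<le> ereal 1 * enn2ereal (\<integral>\<^sup>+x. ennreal ((grad_norm X f x)\<^sup>2) \<partial>?\<mu>)"
      unfolding Phi by simp
  qed simp
next
  case False
  have "0 \<le> d x" for x
    using Metric_space.nonneg[OF metric] by (simp add: d_def)
  then interpret coercive_setting X d \<theta> \<beta> \<sigma> K \<epsilon> Z \<epsilon>\<^sub>0 C D
    using assms False by unfold_locales auto
  show ?thesis by (rule tight_inequality[OF mu_prob M poincare])
qed

end
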